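(* Let $A$ be a nontrivial prime associative superalgebra over $\Phi$ (where $\frac12\in\Phi$) such that $A$ is not a central order in $C(n)$ for $n=1,2,3$. Let $W$ be a (graded) subalgebra of $A$ and $L$ a Lie ideal of $A$ such that $[W,L]\subseteq W$. Then either $L\subseteq Z$, or $W\subseteq Z$, or $W$ is dense in $A$.
   Context: $\Phi$ is a commutative unital ring of scalars with $\frac12\in\Phi$. An associative superalgebra over $\Phi$ is a $\mathbb{Z}/2$-graded associative $\Phi$-algebra $A=A_0+A_1$ (direct sum, $A_iA_j\subseteq A_{i+j}$); it is nontrivial if $A_1\neq 0$. Elements of $A_0\cup A_1$ are called homogeneous, and $\bar a$ denotes the degree of a homogeneous element $a$. "Subalgebra", "submodule", "ideal" always mean graded subalgebra, graded submodule, graded (two-sided) ideal. $A$ is prime if the product of any two nonzero (graded) ideals of $A$ is nonzero. The superbracket is $[a,b]=ab-(-1)^{\bar a\bar b}ba$ for homogeneous $a,b$, extended bilinearly; for submodules $M,N$, $[M,N]$ is the $\Phi$-span of all $[m,n]$ with $m\in M$, $n\in N$. A Lie ideal of $A$ is a (graded) $\Phi$-submodule $L$ with $[L,A]\subseteq L$. $Z$ denotes the even part of the center of $A$. A $\Phi$-submodule $M$ of $A$ is dense in $A$ if the subalgebra $\overline{M}$ of $A$ generated by $M$ contains a nonzero ideal of $A$ (so a subalgebra $W$ is dense if and only if $W$ itself contains a nonzero ideal of $A$). If $A$ is prime and $Z\neq0$, one forms the localization $Z^{-1}A=\{z^{-1}a: 0\neq z\in Z,\ a\in A\}$, a superalgebra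 over the field $Z^{-1}Z$. $A$ is called a central order in $C(n)$ if $Z\neq 0$ and $Z^{-1}A$ is isomorphic, as a superalgebra over $Z^{-1}Z$, to the Clifford superalgebra of a non-degenerate quadratic space of dimension $n$ over $Z^{-1}Z$ (with its usual $\mathbb{Z}/2$-grading in which vectors are odd). *)

theory Defs
  imports HOL.Modules "HOL-Library.Z2" "HOL-Algebra.QuotRing" "HOL-Algebra.Module"
begin

section \<open>Clifford superalgebras of quadratic spaces\<close>

text \<open>Vector spaces are modules over a field record; the \<open>mult\<close> and \<open>one\<close>
  components of the record \<open>V\<close> play no role.  The polar form is symmetric because \<open>V\<close> is
  abelian, so linearity in the first argument is bilinearity.\<close>

definition polar_form ::
    "('f, 'm) ring_scheme \<Rightarrow> ('f, 'v, 'n) module_scheme \<Rightarrow> ('v \<Rightarrow> 'f) \<Rightarrow> 'v \<Rightarrow> 'v \<Rightarrow> 'f" where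
  "polar_form F V q u v = q (u \<oplus>\<^bsub>V\<^esub> v) \<ominus>\<^bsub>F\<^esub> q u \<ominus>\<^bsub>F\<^esub> q v"

locale quadratic_space = F?: field F + V?: Module.module F V
  for F (structure) and V (structure) +
  fixes q
  assumes form_closed: "v \<in> carrier V \<Longrightarrow> q v \<in> carrier F"
    and form_smult: "c \<in> carrier F \<Longrightarrow> v \<in> carrier V \<Longrightarrow> q (c \<odot>\<^bsub>V\<^esub> v) = c \<otimes> c \<otimes> q v"
    and polar_add: "u \<in> carrier V \<Longrightarrow> v \<in> carrier V \<Longrightarrow> w \<in> carrier V \<Longrightarrow>
      polar_form F V q (u \<oplus>\<^bsub>V\<^esub> v) w = polar_form F V q u w \<oplus> polar_form F V q v w"
    and polar_smult: "c \<in> carrier F \<Longrightarrow> v \<in> carrier V \<Longrightarrow> w \<in> carrier V \<Longrightarrow>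
      polar_form F V q (c \<odot>\<^bsub>V\<^esub> v) w = c \<otimes> polar_form F V q v w"

definition nondegenerate_form ::
    "('f, 'm) ring_scheme \<Rightarrow> ('f, 'v, 'n) module_scheme \<Rightarrow> ('v \<Rightarrow> 'f) \<Rightarrow> bool" where
  "nondegenerate_form F V q \<longleftrightarrow>
    (\<forall>u\<in>carrier V. (\<forall>v\<in>carrier V. polar_form F V q u v = \<zero>\<^bsub>F\<^esub>) \<longrightarrow> u = \<zero>\<^bsub>V\<^esub>)"

definition has_dimension ::
    "('f, 'm) ring_scheme \<Rightarrow> ('f, 'v, 'n) module_scheme \<Rightarrow> nat \<Rightarrow> bool" where
  "has_dimension F V n \<longleftrightarrow>
    (\<exists>b. (\<forall>i<n. b i \<in> carrier V) \<and>
      (\<forall>v\<in>carrier V. \<exists>!c. c \<in> {..<n} \<rightarrow>\<^sub>E carrier F \<and>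
        v = (\<Oplus>\<^bsub>V\<^esub>i\<in>{..<n}. c i \<odot>\<^bsub>V\<^esub> b i)))"

text \<open>The unital free associative algebra on a set \<open>X\<close> over \<open>F\<close>: finitely supported functions
  from the words over \<open>X\<close> to \<open>F\<close>, multiplied by convolution along concatenation.\<close>

definition free_algebra ::
    "('f, 'm) ring_scheme \<Rightarrow> 'x set \<Rightarrow> ('f, 'x list \<Rightarrow> 'f) module" where
  "free_algebra F X =
    \<lparr>carrier = {f. range f \<subseteq> carrier F \<and> finite {w. f w \<noteq> \<zero>\<^bsub>F\<^esub>} \<and> {w. f w \<noteq> \<zero>\<^bsub>F\<^esub>} \<subseteq> lists X},
     mult = (\<lambda>f g w. \<Oplus>\<^bsub>F\<^esub>k\<in>{..length w}. f (take k w) \<otimes>\<^bsub>F\<^esub> g (drop k w)),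
     one = (\<lambda>w. if w = [] then \<one>\<^bsub>F\<^esub> else \<zero>\<^bsub>F\<^esub>),
     zero = (\<lambda>w. \<zero>\<^bsub>F\<^esub>),
     add = (\<lambda>f g w. f w \<oplus>\<^bsub>F\<^esub> g w),
     smult = (\<lambda>c f w. c \<otimes>\<^bsub>F\<^esub> f w)\<rparr>"

definition free_gen :: "('f, 'm) ring_scheme \<Rightarrow> 'x \<Rightarrow> 'x list \<Rightarrow> 'f" where
  "free_gen F x = (\<lambda>w. if w = [x] then \<one>\<^bsub>F\<^esub> else \<zero>\<^bsub>F\<^esub>)"

text \<open>Dividing the free algebra on the carrier of \<open>V\<close> by the first two families of
  relations gives the tensor algebra of \<open>V\<close>; the third family is \<open>v \<otimes> v = q(v) 1\<close>.\<close>

definition clifford_relations ::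
    "('f, 'm) ring_scheme \<Rightarrow> ('f, 'v, 'n) module_scheme \<Rightarrow> ('v \<Rightarrow> 'f) \<Rightarrow> ('v list \<Rightarrow> 'f) set" where
  "clifford_relations F V q = (let T = free_algebra F (carrier V); \<iota> = free_gen F in
     {\<iota> (u \<oplus>\<^bsub>V\<^esub> v) \<ominus>\<^bsub>T\<^esub> (\<iota> u \<oplus>\<^bsub>T\<^esub> \<iota> v) | u v. u \<in> carrier V \<and> v \<in> carrier V} \<union>
     {\<iota> (c \<odot>\<^bsub>V\<^esub> v) \<ominus>\<^bsub>T\<^esub> c \<odot>\<^bsub>T\<^esub> \<iota> v | c v. c \<in> carrier F \<and> v \<in> carrier V} \<union>
     {\<iota> v \<otimes>\<^bsub>T\<^esub> \<iota> v \<ominus>\<^bsub>T\<^esub> q v \<odot>\<^bsub>T\<^esub> \<one>\<^bsub>T\<^esub> | v. v \<in> carrier V})"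

text \<open>Unital superalgebras over a field record, with the scalar action and the two homogeneous
  components as part of the record.\<close>

record ('f, 'b) superalg = "('f, 'b) module" +
  component :: "bit \<Rightarrow> 'b set"

definition clifford_superalg ::
    "('f, 'm) ring_scheme \<Rightarrow> ('f, 'v, 'n) module_scheme \<Rightarrow> ('v \<Rightarrow> 'f) \<Rightarrow>
      ('f, ('v list \<Rightarrow> 'f) set) superalg" where
  "clifford_superalg F V q =
    (let T = free_algebra F (carrier V); I = Idl\<^bsub>T\<^esub> (clifford_relations F V q); C = T Quot I in
     \<lparr>carrier = carrier C, mult = mult C, one = one C, zero = zero C, add = add C,
      smult = (\<lambda>c X. \<Union>f\<in>X. I +>\<^bsub>T\<^esub> (c \<odot>\<^bsub>T\<^esub> f)),
      component = (\<lambda>i. {I +>\<^bsub>T\<^esub> f | f. f \<in> carrier T \<and>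
        (\<forall>w. f w \<noteq> \<zero>\<^bsub>F\<^esub> \<longrightarrow> of_nat (length w) = i)})\<rparr>)"

definition superalg_isomorphic ::
    "('f, 'm) ring_scheme \<Rightarrow> ('f, 'b) superalg \<Rightarrow> ('f, 'c) superalg \<Rightarrow> bool" where
  "superalg_isomorphic F B C \<longleftrightarrow>
    (\<exists>\<phi>\<in>ring_iso B C.
      (\<forall>c\<in>carrier F. \<forall>x\<in>carrier B. \<phi> (c \<odot>\<^bsub>B\<^esub> x) = c \<odot>\<^bsub>C\<^esub> \<phi> x) \<and>
      (\<forall>i. \<phi> ` component B i = component C i))"


section \<open>Associative superalgebras\<close>

text \<open>The algebra is the whole type \<open>'a\<close>, which is not assumed to have a unit;
  \<open>A 0\<close> and \<open>A 1\<close> are its even and odd parts.\<close>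

locale superalgebra = Modules.module scale
  for scale :: "'r::comm_ring_1 \<Rightarrow> 'a::ring \<Rightarrow> 'a" +
  fixes A :: "bit \<Rightarrow> 'a set"
  assumes scale_mult_left: "scale c (x * y) = scale c x * y"
    and scale_mult_right: "scale c (x * y) = x * scale c y"
    and subspace_A: "subspace (A i)"
    and A_sum: "\<exists>a\<in>A 0. \<exists>b\<in>A 1. x = a + b"
    and A_direct: "A 0 \<inter> A 1 = {0}"
    and A_mult: "a \<in> A i \<Longrightarrow> b \<in> A j \<Longrightarrow> a * b \<in> A (i + j)"
begin

definition part :: "bit \<Rightarrow> 'a \<Rightarrow> 'a" where
  "part i x = (THE a. a \<in> A i \<and> x - a \<in> A (i + 1))"

definition superbracket :: "'a \<Rightarrow> 'a \<Rightarrow> 'a" where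
  "superbracket x y = (\<Sum>i\<in>{0, 1}. \<Sum>j\<in>{0, 1}.
     part i x * part j y - scale ((- 1) ^ of_bool (i * j = 1)) (part j y * part i x))"

definition bracket_span :: "'a set \<Rightarrow> 'a set \<Rightarrow> 'a set" where
  "bracket_span M N = span {superbracket m n | m n. m \<in> M \<and> n \<in> N}"

definition graded_submodule :: "'a set \<Rightarrow> bool" where
  "graded_submodule M \<longleftrightarrow> subspace M \<and> (\<forall>x\<in>M. \<forall>i. part i x \<in> M)"

definition graded_subalgebra :: "'a set \<Rightarrow> bool" where
  "graded_subalgebra W \<longleftrightarrow> graded_submodule W \<and> (\<forall>x\<in>W. \<forall>y\<in>W. x * y \<in> W)"

definition graded_ideal :: "'a set \<Rightarrow> bool" where
  "graded_ideal I \<longleftrightarrow> graded_submodule I \<and> (\<forall>x\<in>I. \<forall>a. a * x \<in> I \<and> x * a \<in> I)"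

definition lie_ideal :: "'a set \<Rightarrow> bool" where
  "lie_ideal L \<longleftrightarrow> graded_submodule L \<and> bracket_span L UNIV \<subseteq> L"

definition nontrivial :: bool where
  "nontrivial \<longleftrightarrow> A 1 \<noteq> {0}"

definition prime_superalgebra :: bool where
  "prime_superalgebra \<longleftrightarrow>
    (\<forall>I J. graded_ideal I \<and> I \<noteq> {0} \<and> graded_ideal J \<and> J \<noteq> {0} \<longrightarrow>
      span {x * y | x y. x \<in> I \<and> y \<in> J} \<noteq> {0})"

definition dense_in :: "'a set \<Rightarrow> bool" where
  "dense_in M \<longleftrightarrow> (\<exists>I. graded_ideal I \<and> I \<noteq> {0} \<and> I \<subseteq> graded_subalgebra hull M)"

definition even_center :: "'a set" where
  "even_center = {z \<in> A 0. \<forall>a. z * a = a * z}"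


subsection \<open>The localization at the nonzero elements of the even center\<close>

text \<open>\<open>frac z a\<close> is the fraction \<open>z\<inverse>a\<close>, as an equivalence class of pairs.  The relation
  \<open>w a = z b\<close> is an equivalence when nonzero elements of the even center are not zero
  divisors, which is the case if the superalgebra is prime.\<close>

definition frac :: "'a \<Rightarrow> 'a \<Rightarrow> ('a \<times> 'a) set" where
  "frac z a = {(w, b). w \<in> even_center - {0} \<and> w * a = z * b}"

definition frac_add :: "('a \<times> 'a) set \<Rightarrow> ('a \<times> 'a) set \<Rightarrow> ('a \<times> 'a) set" where
  "frac_add X Y = (\<Union>(z, a)\<in>X. \<Union>(w, b)\<in>Y. frac (z * w) (w * a + z * b))"

definition frac_mult :: "('a \<times> 'a) set \<Rightarrow> ('a \<times> 'a) set \<Rightarrow> ('a \<times> 'a) set" where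
  "frac_mult X Y = (\<Union>(z, a)\<in>X. \<Union>(w, b)\<in>Y. frac (z * w) (a * b))"

definition frac_zero :: "('a \<times> 'a) set" where
  "frac_zero = (\<Union>z\<in>even_center - {0}. frac z 0)"

definition frac_one :: "('a \<times> 'a) set" where
  "frac_one = (\<Union>z\<in>even_center - {0}. frac z z)"

definition fracs :: "'a set \<Rightarrow> ('a \<times> 'a) set set" where
  "fracs M = {frac z a | z a. z \<in> even_center - {0} \<and> a \<in> M}"

text \<open>The field \<open>Z\<inverse>Z\<close> is realized inside \<open>Z\<inverse>A\<close>, so that it acts by multiplication.\<close>

definition center_field :: "('a \<times> 'a) set ring" where
  "center_field = \<lparr>carrier = fracs even_center, mult = frac_mult, one = frac_one,
     zero = frac_zero, add = frac_add\<rparr>"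

definition central_localization :: "(('a \<times> 'a) set, ('a \<times> 'a) set) superalg" where
  "central_localization = \<lparr>carrier = fracs UNIV, mult = frac_mult, one = frac_one,
     zero = frac_zero, add = frac_add, smult = frac_mult, component = (\<lambda>i. fracs (A i))\<rparr>"

text \<open>Every \<open>n\<close>-dimensional space over \<open>Z\<inverse>Z\<close> is isomorphic to one whose vectors are functions
  from \<open>nat\<close> to \<open>Z\<inverse>Z\<close>, so fixing this type for the vectors loses no quadratic space.\<close>

definition central_order_in_C :: "nat \<Rightarrow> bool" where
  "central_order_in_C n \<longleftrightarrow> even_center \<noteq> {0} \<and>
    (\<exists>(V :: (('a \<times> 'a) set, nat \<Rightarrow> ('a \<times> 'a) set) module) q.
      quadratic_space center_field V q \<and> nondegenerate_form center_field V q \<and>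
      has_dimension center_field V n \<and>
      superalg_isomorphic center_field central_localization (clifford_superalg center_field V q))"

end

end

theory Submission
  imports Defs
begin

text \<open>If some bracket \<open>p = [l, l']\<close> of homogeneous elements of \<open>L\<close> is nonzero, then the ideal
  \<open>M = A p A\<close> satisfies \<open>[M, A] \<subseteq> L\<close> and lies in the subalgebra generated by \<open>L\<close>.
  For \<open>w \<in> W\<^sub>0\<close>, \<open>v \<in> W\<close>, \<open>m \<in> M\<close> the elements \<open>[v, [w, w m]]\<close> and \<open>[w, [w, v m]]\<close> of \<open>W\<close> show
  \<open>[w, [w, v]] M \<subseteq> W\<close>, and \<open>c M \<subseteq> W\<close> with \<open>0 \<noteq> c \<in> W\<close> makes \<open>W\<close> contain the ideal \<open>M c M\<close>.
  So if \<open>W\<close> is not dense then \<open>(ad w)\<^sup>2\<close> vanishes on \<open>W\<close>; primeness forces first \<open>[W\<^sub>0, W\<^sub>0] = 0\<close>,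
  then \<open>[w, M] = 0\<close>, and \<open>W\<^sub>0 \<subseteq> Z\<close>.

  Let \<open>0 \<noteq> u \<in> W\<^sub>1\<close>.  If \<open>u\<^sup>2 \<noteq> 0\<close>, the even elements of \<open>M\<close> commuting with \<open>u\<close> are central, so
  after localization \<open>A\<close> is spanned by \<open>1, u\<close> or by \<open>1, u, x, u x\<close> with \<open>x\<close> odd anticommuting with \<open>u\<close>.
  If all odd elements of \<open>W\<close> square to zero, there is an odd \<open>v\<close> with \<open>v\<^sup>2 = 0\<close> and \<open>0 \<noteq> u v + v u \<in> Z\<close>, and
  the Peirce decomposition identifies the localization with \<open>C(2)\<close>; the same happens for a
  noncentral \<open>L\<close> with \<open>[L, L] = 0\<close>.\<close>


section \<open>Graded algebra\<close>

context superalgebra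
begin

text \<open>\<open>A\<close> may lack a unit and need not be prime as an ungraded ring, so primeness
  is used in the form \<open>x I y = 0\<close> with \<open>x\<close>, \<open>y\<close> homogeneous
  and \<open>I\<close> a nonzero graded ideal. Taking \<open>I = M\<close> puts the middle factor
  where brackets are known to fall into \<open>L\<close>. The scalar 1/2 turns
  \<open>D (D (x y)) = 2 (D x) (D y)\<close>, for a derivation \<open>D\<close> whose square kills
  \<open>x\<close> and \<open>y\<close>, into vanishing products.

  Nonzero odd elements of \<open>W\<close> cannot be excluded in this way; they only force
  \<open>A\<close> to be small over \<open>Z\<close>. A \<open>clifford_frame\<close> records the
  smallness without fractions: each homogeneous \<open>a\<close> acquires coefficients in
  \<open>Z\<close> after multiplication by some nonzero \<open>z\<close> in \<open>Z\<close>.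

  The frame must then be matched with a Clifford superalgebra given by generators and relations. The
  obstacle is to see that the relations generate the whole kernel of the evaluation map; it is
  overcome by reducing words to a normal form with the same coefficients in the quotient and in the
  localization.\<close>

lemma bit_add_self [simp]: "(i::bit) + i = 0"
  by (cases i) auto

lemma A_add: "a \<in> A i \<Longrightarrow> b \<in> A i \<Longrightarrow> a + b \<in> A i"
  and A_diff: "a \<in> A i \<Longrightarrow> b \<in> A i \<Longrightarrow> a - b \<in> A i"
  and A_neg: "a \<in> A i \<Longrightarrow> - a \<in> A i"
  and A_scale: "a \<in> A i \<Longrightarrow> scale c a \<in> A i"
  and A_zero [simp]: "0 \<in> A i"
  using subspace_A[of i] subspace_add subspace_diff subspace_neg subspace_scale subspace_0 by blast+

lemma A_mult_even_even: "a \<in> A 0 \<Longrightarrow> b \<in> A 0 \<Longrightarrow> a * b \<in> A 0"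
  and A_mult_even_odd: "a \<in> A 0 \<Longrightarrow> b \<in> A 1 \<Longrightarrow> a * b \<in> A 1"
  and A_mult_odd_even: "a \<in> A 1 \<Longrightarrow> b \<in> A 0 \<Longrightarrow> a * b \<in> A 1"
  and A_mult_odd_odd: "a \<in> A 1 \<Longrightarrow> b \<in> A 1 \<Longrightarrow> a * b \<in> A 0"
  using A_mult[of a 0 b 0] A_mult[of a 0 b 1] A_mult[of a 1 b 0] A_mult[of a 1 b 1] by auto

lemmas A_intros = A_add A_diff A_neg A_scale A_zero A_mult_even_even A_mult_even_odd
  A_mult_odd_even A_mult_odd_odd

lemma A_disjoint: "x \<in> A i \<Longrightarrow> x \<in> A (i + 1) \<Longrightarrow> x = 0"
  using A_direct by (cases i) auto

lemma A_decomp: "\<exists>a\<in>A i. \<exists>b\<in>A (i + 1). x = a + b"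
  using A_sum[of x] by (cases i) (auto, metis add.commute)

lemma part_eqI:
  assumes "a \<in> A i" "x - a \<in> A (i + 1)"
  shows "part i x = a"
  unfolding part_def
proof (rule the_equality)
  fix b assume b: "b \<in> A i \<and> x - b \<in> A (i + 1)"
  have "b - a \<in> A i" using b assms(1) by (simp add: A_diff)
  moreover have "(x - a) - (x - b) \<in> A (i + 1)" using b assms(2) by (blast intro: A_diff)
  ultimately have "b - a = 0" by (intro A_disjoint[of _ i]) (simp_all add: algebra_simps)
  then show "b = a" by simp
qed (use assms in simp)

lemma part_sum: "a \<in> A i \<Longrightarrow> b \<in> A (i + 1) \<Longrightarrow> part i (a + b) = a"
  by (rule part_eqI) auto

lemma part_in [simp]: "part i x \<in> A i"
  using A_decomp[where i=i and x=x] part_sum by metis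

lemma part_compl: "x - part i x \<in> A (i + 1)"
  using A_decomp[where i=i and x=x] part_sum by (metis add_diff_cancel_left')

lemma part_same: "x \<in> A i \<Longrightarrow> part i x = x"
  by (rule part_eqI) auto

lemma part_other: "x \<in> A i \<Longrightarrow> i \<noteq> j \<Longrightarrow> part j x = 0"
  by (rule part_eqI) (cases i; cases j; auto)+

lemma part_add_eq: "part 0 x + part 1 x = x"
proof -
  have "part 1 x = x - part 0 x"
    by (rule part_eqI) (use part_compl[of x 0] in auto)
  then show ?thesis by simp
qed

lemma part_add: "part i (x + y) = part i x + part i y"
proof (rule part_eqI)
  show "x + y - (part i x + part i y) \<in> A (i + 1)"
    using A_add[OF part_compl[of x i] part_compl[of y i]] by (simp add: algebra_simps)
qed (simp add: A_add)

lemma part_scale: "part i (scale c x) = scale c (part i x)"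
proof (rule part_eqI)
  show "scale c x - scale c (part i x) \<in> A (i + 1)"
    using A_scale[OF part_compl[of x i], of c] by (simp add: scale_right_diff_distrib)
qed (simp add: A_scale)

lemma part_zero [simp]: "part i 0 = 0"
  by (rule part_same) simp

text \<open>Multiplication by a homogeneous element only shifts degrees. This is what makes the
  annihilators below closed under \<open>part\<close>.\<close>

lemma part_mult_right:
  assumes "y \<in> A j"
  shows "part (k + j) (x * y) = part k x * y"
proof (rule part_eqI)
  show "part k x * y \<in> A (k + j)"
    by (rule A_mult[OF part_in assms])
  show "x * y - part k x * y \<in> A (k + j + 1)"
    using A_mult[OF part_compl[of x k] assms] by (simp only: left_diff_distrib ac_simps)
qed

lemma part_mult_left:
  assumes "y \<in> A j"
  shows "part (j + k) (y * x) = y * part k x"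
proof (rule part_eqI)
  show "y * part k x \<in> A (j + k)"
    by (rule A_mult[OF assms part_in])
  show "y * x - y * part k x \<in> A (j + k + 1)"
    using A_mult[OF assms part_compl[of x k]] by (simp only: right_diff_distrib ac_simps)
qed

lemma homogeneous_induct [case_names sum even odd]:
  assumes "\<And>a b. P a \<Longrightarrow> P b \<Longrightarrow> P (a + b)" and "\<And>a. a \<in> A 0 \<Longrightarrow> P a" and "\<And>a. a \<in> A 1 \<Longrightarrow> P a"
  shows "P x"
  using assms part_add_eq[of x] part_in by metis

lemma mult_zero_partsR: "(\<And>k. x * part k y = 0) \<Longrightarrow> x * y = 0"
  by (subst part_add_eq[symmetric, of y]) (simp only: distrib_left add_0)

lemma mult_zero_partsM: "(\<And>k. x * part k i * y = 0) \<Longrightarrow> x * i * y = 0"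
  by (subst part_add_eq[symmetric, of i]) (simp only: distrib_left distrib_right add_0)

lemma bracket_even_left: "x \<in> A 0 \<Longrightarrow> superbracket x y = x * y - y * x"
  by (subst (2 3) part_add_eq[symmetric, of y])
     (simp add: superbracket_def part_same part_other distrib_left distrib_right)

lemma bracket_even_right: "y \<in> A 0 \<Longrightarrow> superbracket x y = x * y - y * x"
  by (subst (2 3) part_add_eq[symmetric, of x])
     (simp add: superbracket_def part_same part_other distrib_left distrib_right)

lemma bracket_odd: "x \<in> A 1 \<Longrightarrow> y \<in> A 1 \<Longrightarrow> superbracket x y = x * y + y * x"
  by (simp add: superbracket_def part_same part_other)

text \<open>The sign (-1)^(i j), realized by negation instead of \<open>scale\<close>, so that sign
  computations become ring identities after a case split on the degrees.\<close>

definition koszul :: "bit \<Rightarrow> bit \<Rightarrow> 'a \<Rightarrow> 'a" where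
  "koszul i j x = (if i = 1 \<and> j = 1 then - x else x)"

lemma bracket_hom: "x \<in> A i \<Longrightarrow> y \<in> A j \<Longrightarrow> superbracket x y = x * y - koszul i j (y * x)"
  by (cases i; cases j) (simp_all add: bracket_even_left bracket_even_right bracket_odd koszul_def)

lemma bracket_add_left: "superbracket (x + y) z = superbracket x z + superbracket y z"
  and bracket_add_right: "superbracket z (x + y) = superbracket z x + superbracket z y"
  by (simp_all add: superbracket_def part_add scale_right_distrib scale_right_diff_distrib algebra_simps)

lemma bracket_scale_left: "superbracket (scale c x) z = scale c (superbracket x z)"
  by (simp add: superbracket_def part_scale scale_right_distrib scale_right_diff_distrib
      scale_mult_left[symmetric] scale_mult_right[symmetric] scale_left_commute)

lemma A_bracket: "x \<in> A i \<Longrightarrow> y \<in> A j \<Longrightarrow> superbracket x y \<in> A (i + j)"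
  by (cases i; cases j) (simp_all add: bracket_hom koszul_def A_intros)

lemma graded_submodule_part: "graded_submodule M \<Longrightarrow> x \<in> M \<Longrightarrow> part i x \<in> M"
  by (simp add: graded_submodule_def)

lemma graded_submodule_neg: "graded_submodule M \<Longrightarrow> x \<in> M \<Longrightarrow> - x \<in> M"
  by (simp add: graded_submodule_def subspace_neg)

lemma graded_idealI:
  assumes "0 \<in> K" and "\<And>x y. x \<in> K \<Longrightarrow> y \<in> K \<Longrightarrow> x + y \<in> K"
    and "\<And>c x. x \<in> K \<Longrightarrow> scale c x \<in> K" and "\<And>i x. x \<in> K \<Longrightarrow> part i x \<in> K"
    and "\<And>a x. x \<in> K \<Longrightarrow> a * x \<in> K" and "\<And>a x. x \<in> K \<Longrightarrow> x * a \<in> K"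
  shows "graded_ideal K"
  using assms by (simp add: graded_ideal_def graded_submodule_def subspace_def)

lemma graded_ideal_part: "graded_ideal I \<Longrightarrow> x \<in> I \<Longrightarrow> part i x \<in> I"
  by (simp add: graded_ideal_def graded_submodule_def)

lemma graded_ideal_mult: "graded_ideal I \<Longrightarrow> x \<in> I \<Longrightarrow> a * x \<in> I"
    "graded_ideal I \<Longrightarrow> x \<in> I \<Longrightarrow> x * a \<in> I"
  by (simp_all add: graded_ideal_def)

lemma graded_ideal_UNIV: "graded_ideal UNIV"
  by (simp add: graded_ideal_def graded_submodule_def)

text \<open>Homogeneous outer factors give every generator a single degree, so \<open>part\<close>
  fixes or kills it and the span is graded. A multiplier \<open>a\<close> is split into its two
  parts to keep the outer factors homogeneous.\<close>

lemma sandwich_ideal: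
  assumes I: "graded_ideal I" and c: "c \<in> A k"
  shows "graded_ideal (span {i * c * j | i j s t. i \<in> I \<inter> A s \<and> j \<in> I \<inter> A t})"
    (is "graded_ideal (span ?S)")
proof -
  have gen: "i * c * j \<in> span ?S" if "i \<in> I" "j \<in> I" "i \<in> A s" "j \<in> A t" for i j s t
    by (rule span_base) (use that in blast)
  have "part l x \<in> span ?S" if "x \<in> span ?S" for x l
    using that
  proof (induction rule: span_induct)
    show "subspace {x. part l x \<in> span ?S}"
      by (rule subspaceI) (simp_all add: part_add part_scale span_zero span_add span_scale)
  next
    fix x assume "x \<in> ?S"
    then obtain i j s t where ij: "x = i * c * j" "i \<in> I" "j \<in> I" "i \<in> A s" "j \<in> A t" by blast
    have "x \<in> A (s + k + t)" unfolding ij(1) by (intro A_mult ij c)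
    then have "part l x = x \<or> part l x = 0" using part_same part_other by metis
    then show "part l x \<in> span ?S" using gen ij span_zero by auto
  qed
  moreover have "a * x \<in> span ?S" if "x \<in> span ?S" for x a
    using that
  proof (induction rule: span_induct)
    show "subspace {x. a * x \<in> span ?S}"
      by (rule subspaceI)
         (simp_all add: distrib_left span_zero span_add span_scale flip: scale_mult_right)
  next
    fix x assume "x \<in> ?S"
    then obtain i j s t where ij: "x = i * c * j" "i \<in> I" "j \<in> I" "i \<in> A s" "j \<in> A t" by blast
    have "(part 0 a * i) * c * j \<in> span ?S"
      by (rule gen[OF graded_ideal_mult(1)[OF I ij(2)] ij(3) A_mult[OF part_in ij(4)] ij(5)])
    moreover have "(part 1 a * i) * c * j \<in> span ?S"
      by (rule gen[OF graded_ideal_mult(1)[OF I ij(2)] ij(3) A_mult[OF part_in ij(4)] ij(5)])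
    moreover have "a * x = (part 0 a * i) * c * j + (part 1 a * i) * c * j"
      unfolding ij(1) by (subst (1) part_add_eq[symmetric, of a]) (simp add: algebra_simps)
    ultimately show "a * x \<in> span ?S" by (simp add: span_add)
  qed
  moreover have "x * a \<in> span ?S" if "x \<in> span ?S" for x a
    using that
  proof (induction rule: span_induct)
    show "subspace {x. x * a \<in> span ?S}"
      by (rule subspaceI)
         (simp_all add: distrib_right span_zero span_add span_scale flip: scale_mult_left)
  next
    fix x assume "x \<in> ?S"
    then obtain i j s t where ij: "x = i * c * j" "i \<in> I" "j \<in> I" "i \<in> A s" "j \<in> A t" by blast
    have "i * c * (j * part 0 a) \<in> span ?S"
      by (rule gen[OF ij(2) graded_ideal_mult(2)[OF I ij(3)] ij(4) A_mult[OF ij(5) part_in]])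
    moreover have "i * c * (j * part 1 a) \<in> span ?S"
      by (rule gen[OF ij(2) graded_ideal_mult(2)[OF I ij(3)] ij(4) A_mult[OF ij(5) part_in]])
    moreover have "x * a = i * c * (j * part 0 a) + i * c * (j * part 1 a)"
      unfolding ij(1) by (subst (1) part_add_eq[symmetric, of a]) (simp add: algebra_simps)
    ultimately show "x * a \<in> span ?S" by (simp add: span_add)
  qed
  ultimately show ?thesis
    by (simp add: graded_ideal_def graded_submodule_def)
qed

lemma lie_ideal_bracket:
  assumes "lie_ideal L" "l \<in> L"
  shows "superbracket l a \<in> L"
proof -
  have "superbracket l a \<in> bracket_span L UNIV"
    unfolding bracket_span_def by (rule span_base) (use assms(2) in blast)
  then show ?thesis using assms(1) by (auto simp: lie_ideal_def)
qed

lemma lie_ideal_submodule: "lie_ideal L \<Longrightarrow> graded_submodule L"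
  by (simp add: lie_ideal_def)

text \<open>For homogeneous arguments the bracket is antisymmetric up to the Koszul sign, and
  \<open>L\<close> is closed under negation.\<close>

lemma lie_ideal_bracket':
  assumes "lie_ideal L" "l \<in> L" "l \<in> A i" "a \<in> A j"
  shows "superbracket a l \<in> L"
proof -
  have "superbracket a l = - koszul i j (superbracket l a)"
    using assms by (simp add: bracket_hom koszul_def algebra_simps)
  then show ?thesis
    using lie_ideal_bracket[OF assms(1,2), of a]
      graded_submodule_neg[OF lie_ideal_submodule[OF assms(1)], of "superbracket l a"]
    by (simp add: koszul_def split: if_splits)
qed

end


section \<open>Prime superalgebras: annihilators and sandwich products\<close>

locale prime_superalg = superalgebra scale A
  for scale :: "'r::comm_ring_1 \<Rightarrow> 'a::ring \<Rightarrow> 'a" and A +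
  assumes half: "2 dvd (1::'r)"
    and nontriv: nontrivial
    and prime: prime_superalgebra
begin

lemma subspace_halve:
  assumes "subspace S" "x + x \<in> S"
  shows "x \<in> S"
proof -
  obtain h :: 'r where h: "1 = 2 * h" using half by blast
  have "scale h (x + x) = scale (2 * h) x"
    by (simp only: scale_right_distrib scale_left_distrib mult_2)
  then have "scale h (x + x) = x" by (simp flip: h)
  then show ?thesis using subspace_scale[OF assms, of h] by (simp only:)
qed

lemma double_zero: "(x::'a) + x = 0 \<Longrightarrow> x = 0"
  using subspace_halve[of "{0}" x] by (simp add: subspace_def)

lemma ideal_product_zero:
  assumes "graded_ideal I" "graded_ideal J" "\<And>x y. x \<in> I \<Longrightarrow> y \<in> J \<Longrightarrow> x * y = 0"
  shows "I = {0} \<or> J = {0}"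
proof -
  have "{x * y |x y. x \<in> I \<and> y \<in> J} \<subseteq> {0}" using assms(3) by blast
  then have "span {x * y |x y. x \<in> I \<and> y \<in> J} \<subseteq> {0}"
    by (rule span_minimal) (simp add: subspace_single_0)
  then have "span {x * y |x y. x \<in> I \<and> y \<in> J} = {0}"
    using span_zero[of "{x * y |x y. x \<in> I \<and> y \<in> J}"] by blast
  then show ?thesis using prime assms(1,2) unfolding prime_superalgebra_def by blast
qed

text \<open>The left annihilator \<open>K\<close> of \<open>I\<close> is a two-sided ideal because
  \<open>I\<close> absorbs multiplication from the left, and it is graded because \<open>I\<close>
  is. Its product with \<open>I\<close> vanishes, so primeness leaves only
  \<open>K = {0}\<close>.\<close>

lemma left_annihilator_zero:
  assumes I: "graded_ideal I" "I \<noteq> {0}" and x: "\<And>i. i \<in> I \<Longrightarrow> x * i = 0"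
  shows "x = 0"
proof -
  define K where "K = {x. \<forall>i\<in>I. x * i = 0}"
  have K: "graded_ideal K"
  proof (rule graded_idealI)
    fix y k assume y: "y \<in> K"
    have "part k y * i = 0" if i: "i \<in> I" for i
    proof -
      have "part k y * part j i = 0" for j
      proof -
        have "part j i \<in> I" by (rule graded_ideal_part[OF I(1) i])
        then have "y * part j i = 0" using y K_def by simp
        then show ?thesis using part_mult_right[OF part_in, of k j y i] by (metis part_zero)
      qed
      then show ?thesis by (rule mult_zero_partsR)
    qed
    then show "part k y \<in> K" by (simp add: K_def)
  qed (use graded_ideal_mult(1)[OF I(1)] in
      \<open>simp_all add: K_def distrib_right mult.assoc flip: scale_mult_left\<close>)
  have "K = {0} \<or> I = {0}"
    by (rule ideal_product_zero[OF K I(1)]) (simp add: K_def)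
  moreover have "x \<in> K" using x by (simp add: K_def)
  ultimately show ?thesis using I(2) by blast
qed

text \<open>The \<open>b\<close> with \<open>x I b = 0\<close> form an ideal \<open>K\<close>,
  graded because \<open>x\<close> is homogeneous. If \<open>y\<close> is nonzero then so is
  \<open>K\<close>; every \<open>x i\<close> annihilates \<open>K\<close> from the left and
  vanishes, and then \<open>x\<close> annihilates \<open>I\<close>.\<close>

lemma sandwich_zero:
  assumes I: "graded_ideal I" "I \<noteq> {0}" and xy: "x \<in> A j" "y \<in> A k"
    and zero: "\<And>i s. i \<in> I \<Longrightarrow> i \<in> A s \<Longrightarrow> x * i * y = 0"
  shows "x = 0 \<or> y = 0"
proof (rule disjCI)
  assume y: "y \<noteq> 0"
  note parts = graded_ideal_part[OF I(1)]
  define K where "K = {b. \<forall>i\<in>I. x * i * b = 0}"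
  have K: "graded_ideal K"
  proof (rule graded_idealI)
    fix b l assume b: "b \<in> K"
    have "x * i * part l b = 0" if i: "i \<in> I" for i
    proof (rule mult_zero_partsM)
      fix s
      have "x * part s i * b = 0" using b parts[OF i] K_def by blast
      moreover have "part (j + s + l) (x * part s i * b) = x * part s i * part l b"
        by (rule part_mult_left[OF A_mult[OF xy(1) part_in]])
      ultimately show "x * part s i * part l b = 0" by (metis part_zero)
    qed
    then show "part l b \<in> K" by (simp add: K_def)
  next
    fix b a assume b: "b \<in> K"
    have "x * i * (a * b) = 0" if "i \<in> I" for i
    proof -
      have "x * (i * a) * b = 0" using b that graded_ideal_mult(2)[OF I(1)] K_def by blast
      then show ?thesis by (simp add: mult.assoc)
    qed
    then show "a * b \<in> K" by (simp add: K_def)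
  qed (simp_all add: K_def distrib_left mult.assoc[symmetric] flip: scale_mult_right)
  have "x * i * y = 0" if "i \<in> I" for i
    by (rule mult_zero_partsM) (rule zero[OF parts[OF that] part_in])
  then have "y \<in> K" by (simp add: K_def)
  then have "K \<noteq> {0}" using y by blast
  then have "x * i = 0" if "i \<in> I" for i
    by (rule left_annihilator_zero[OF K]) (use that in \<open>simp_all add: K_def\<close>)
  then show "x = 0" by (rule left_annihilator_zero[OF I])
qed

lemma UNIV_nonzero: "(UNIV :: 'a set) \<noteq> {0}"
proof
  assume "(UNIV :: 'a set) = {0}"
  then have "A 1 \<subseteq> {0}" by blast
  then show False using nontriv A_zero[of 1] unfolding nontrivial_def by blast
qed

text \<open>\<open>I c I = 0\<close> gives \<open>I c = 0\<close> by
  \<open>left_annihilator_zero\<close>, hence \<open>c I c = 0\<close>, which contradicts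
  \<open>sandwich_zero\<close>.\<close>

lemma sandwich_ideal_nonzero:
  assumes I: "graded_ideal I" "I \<noteq> {0}" and c: "c \<in> A k" "c \<noteq> 0"
  shows "span {i * c * j | i j s t. i \<in> I \<inter> A s \<and> j \<in> I \<inter> A t} \<noteq> {0}"
    (is "span ?S \<noteq> _")
proof
  assume *: "span ?S = {0}"
  note parts = graded_ideal_part[OF I(1)]
  have "i * c * j = 0" if "i \<in> I" "j \<in> I" "i \<in> A s" "j \<in> A t" for i j s t
  proof -
    have "i * c * j \<in> span ?S"
      by (rule span_base) (use that in blast)
    then show ?thesis using * by simp
  qed
  note zero = this
  have "i * c * j = 0" if "i \<in> I" "i \<in> A s" "j \<in> I" for i j s
    by (rule mult_zero_partsR) (rule zero[OF that(1) parts[OF that(3)] that(2) part_in])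
  note zero = this
  have "i * c = 0" if "i \<in> I" "i \<in> A s" for i s
    by (rule left_annihilator_zero[OF I]) (rule zero[OF that])
  then have ccc: "c * i * c = 0" if "i \<in> I" "i \<in> A s" for i s
    using that by (simp add: mult.assoc)
  have "c = 0 \<or> c = 0" by (rule sandwich_zero[OF I c(1) c(1) ccc])
  then show False using c(2) by simp
qed

end


section \<open>Lie ideals\<close>

context superalgebra
begin

lemma bracket_mult_right:
  assumes "x \<in> A i" "y \<in> A j" "z \<in> A k"
  shows "superbracket x (y * z) = superbracket x y * z + koszul i j (y * superbracket x z)"
  unfolding bracket_hom[OF assms(1) A_mult[OF assms(2,3)]] bracket_hom[OF assms(1,2)]
    bracket_hom[OF assms(1,3)]
  by (cases i; cases j; cases k) (simp_all add: koszul_def algebra_simps)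

text \<open>The cyclic identity is used instead of the Leibniz rule because both terms on the right
  have \<open>x\<close> or \<open>y\<close> alone in the first argument: if these lie in a Lie
  ideal, so does the bracket of \<open>x * y\<close> with anything.\<close>

lemma bracket_mult_left:
  assumes "x \<in> A i" "y \<in> A j" "z \<in> A k"
  shows "superbracket (x * y) z = superbracket x (y * z) + koszul i (j + k) (superbracket y (z * x))"
  unfolding bracket_hom[OF A_mult[OF assms(1,2)] assms(3)]
    bracket_hom[OF assms(1) A_mult[OF assms(2,3)]] bracket_hom[OF assms(2) A_mult[OF assms(3,1)]]
  by (cases i; cases j; cases k) (simp_all add: koszul_def algebra_simps)

lemma bracket_jacobi:
  assumes "x \<in> A i" "y \<in> A j" "z \<in> A k"
  shows "superbracket x (superbracket y z) =
    superbracket (superbracket x y) z + koszul i j (superbracket y (superbracket x z))"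
  using bracket_hom[OF assms(1) A_bracket[OF assms(2,3)]]
    bracket_hom[OF A_bracket[OF assms(1,2)] assms(3)]
    bracket_hom[OF assms(2) A_bracket[OF assms(1,3)]] bracket_hom[OF assms(2,3)]
    bracket_hom[OF assms(1,2)] bracket_hom[OF assms(1,3)]
  by (cases i; cases j; cases k) (simp_all only: koszul_def, simp_all add: algebra_simps)

lemma subspace_koszul: "subspace S \<Longrightarrow> x \<in> S \<Longrightarrow> koszul i j x \<in> S"
  by (simp add: koszul_def subspace_neg)

lemma koszul_involutive [simp]: "koszul i j (koszul i j x) = x"
  by (simp add: koszul_def)

lemma even_center_even: "z \<in> even_center \<Longrightarrow> z \<in> A 0"
  and even_center_commute: "z \<in> even_center \<Longrightarrow> z * a = a * z"
  by (simp_all add: even_center_def)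

lemma even_centerI: "z \<in> A 0 \<Longrightarrow> (\<And>a. z * a = a * z) \<Longrightarrow> z \<in> even_center"
  by (simp add: even_center_def)

lemma even_center_0: "0 \<in> even_center"
  and even_center_add: "z \<in> even_center \<Longrightarrow> w \<in> even_center \<Longrightarrow> z + w \<in> even_center"
  and even_center_neg: "z \<in> even_center \<Longrightarrow> - z \<in> even_center"
  and even_center_diff: "z \<in> even_center \<Longrightarrow> w \<in> even_center \<Longrightarrow> z - w \<in> even_center"
  by (simp_all add: even_center_def A_intros algebra_simps)

lemma even_center_mult:
  assumes "z \<in> even_center" "w \<in> even_center"
  shows "z * w \<in> even_center"
proof (rule even_centerI)
  show "z * w * a = a * (z * w)" for a
    using assms by (metis even_center_commute mult.assoc)
qed (use assms in \<open>simp add: even_center_even A_mult_even_even\<close>)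

lemma even_center_left_commute: "z \<in> even_center \<Longrightarrow> a * (z * b) = z * (a * b)"
  by (metis even_center_commute mult.assoc)

lemma even_centerI_hom:
  assumes "z \<in> A 0" "\<And>a. a \<in> A 0 \<Longrightarrow> z * a = a * z" "\<And>a. a \<in> A 1 \<Longrightarrow> z * a = a * z"
  shows "z \<in> even_center"
proof (rule even_centerI[OF assms(1)])
  show "z * a = a * z" for a
    by (induction a rule: homogeneous_induct) (simp_all add: distrib_left distrib_right assms)
qed

end

context prime_superalg
begin

text \<open>A central \<open>z\<close> can be moved past any middle factor, so
  \<open>z a = 0\<close> becomes \<open>z A a = 0\<close>, and \<open>sandwich_zero\<close> applies
  to each homogeneous part of \<open>a\<close>. This regularity justifies all later cancellations
  and the localization.\<close>

lemma even_center_mult_zero: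
  assumes z: "z \<in> even_center" "z \<noteq> 0" and za: "z * a = 0"
  shows "a = 0"
proof -
  have "part k a = 0" for k
  proof -
    have "part (0 + k) (z * a) = z * part k a"
      by (rule part_mult_left[OF even_center_even[OF z(1)]])
    then have zp: "z * part k a = 0" using za by simp
    have "z * i * part k a = 0" for i
      using zp even_center_commute[OF z(1)] by (metis mult.assoc mult_zero_right)
    then have "z = 0 \<or> part k a = 0"
      by (intro sandwich_zero[OF graded_ideal_UNIV UNIV_nonzero even_center_even[OF z(1)] part_in])
    then show ?thesis using z(2) by simp
  qed
  then show ?thesis using part_add_eq[of a] by simp
qed

lemma even_center_cancel: "z \<in> even_center \<Longrightarrow> z \<noteq> 0 \<Longrightarrow> z * a = z * b \<Longrightarrow> a = b"
  using even_center_mult_zero[of z "a - b"] by (simp add: right_diff_distrib)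

lemma even_center_mult_nonzero:
  "z \<in> even_center \<Longrightarrow> w \<in> even_center \<Longrightarrow> z \<noteq> 0 \<Longrightarrow> w \<noteq> 0 \<Longrightarrow> z * w \<noteq> 0"
  using even_center_mult_zero by metis

lemma even_center_of_multiple:
  assumes z: "z \<in> even_center" "z \<noteq> 0" and za: "z * a \<in> even_center" and a: "a \<in> A 0"
  shows "a \<in> even_center"
proof (rule even_centerI[OF a])
  fix b
  have "z * (a * b) = z * (b * a)"
    using even_center_commute[OF za, of b] even_center_commute[OF z(1)] by (metis mult.assoc)
  then show "a * b = b * a" by (rule even_center_cancel[OF z])
qed

text \<open>Since \<open>w\<close> commutes with both \<open>m\<close> and \<open>a m\<close>, the
  commutator of \<open>w\<close> and \<open>a\<close> annihilates \<open>m\<close>.\<close>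

lemma commute_ideal_central:
  assumes I: "graded_ideal I" "I \<noteq> {0}" and w: "w \<in> A 0" and c: "\<And>m. m \<in> I \<Longrightarrow> w * m = m * w"
  shows "w \<in> even_center"
proof (rule even_centerI[OF w])
  fix a
  have "(w * a - a * w) * m = 0" if m: "m \<in> I" for m
  proof -
    have "w * (a * m) = a * m * w" by (rule c) (rule graded_ideal_mult(1)[OF I(1) m])
    then show ?thesis using c[OF m] by (simp add: left_diff_distrib mult.assoc)
  qed
  then have "w * a - a * w = 0" by (rule left_annihilator_zero[OF I])
  then show "w * a = a * w" by simp
qed

text \<open>For odd \<open>x\<close> in \<open>I\<close> put \<open>y = c x c\<close>. Then
  \<open>y m y\<close> contains the factor \<open>c m c\<close> if \<open>m\<close> is even and
  \<open>c (x c m) c\<close> if \<open>m\<close> is odd; both middle factors are even, so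
  \<open>y = 0\<close> and the odd elements of \<open>I\<close> are covered as well.\<close>

lemma even_sandwich_zero:
  assumes I: "graded_ideal I" "I \<noteq> {0}" and c: "c \<in> A 0"
    and zero: "\<And>m. m \<in> I \<Longrightarrow> m \<in> A 0 \<Longrightarrow> c * m * c = 0"
  shows "c = 0"
proof -
  have cxc: "c * x * c = 0" if x: "x \<in> I" "x \<in> A 1" for x
  proof -
    have y: "c * x * c \<in> A 1" using c x by (simp add: A_intros)
    have "(c * x * c) * m * (c * x * c) = 0" if m: "m \<in> I" "m \<in> A s" for m s
    proof (cases "s = 0")
      case True
      then have "c * m * c = 0" using zero m by simp
      then have "c * x * (c * m * c) * x * c = 0" by simp
      then show ?thesis by (simp only: mult.assoc)
    next
      case False
      then have "s = 1" by (cases s) simp_all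
      then have "c * (x * c * m) * c = 0"
        using x m c by (intro zero) (simp_all add: graded_ideal_mult[OF I(1)] A_intros)
      then have "c * (x * c * m) * c * x * c = 0" by simp
      then show ?thesis by (simp only: mult.assoc)
    qed
    then have "c * x * c = 0 \<or> c * x * c = 0" by (rule sandwich_zero[OF I y y])
    then show ?thesis by simp
  qed
  have "c * m * c = 0" if m: "m \<in> I" "m \<in> A s" for m s
    using m zero[of m] cxc[of m] by (cases s) simp_all
  then have "c = 0 \<or> c = 0" by (rule sandwich_zero[OF I c c])
  then show ?thesis by simp
qed

text \<open>Right multiples come from the Leibniz rule: \<open>[l, k] a\<close> is
  \<open>[l, k a]\<close> up to a signed \<open>k [l, a]\<close>. Left multiples come from expanding
  \<open>[b, [l, k]]\<close> by Jacobi, where \<open>[b, l]\<close> and \<open>[b, k]\<close> lie in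
  \<open>L\<close> again and the right-multiple case applies to them.\<close>

lemma bracket_sandwich_in:
  assumes L: "lie_ideal L" and S: "subspace S" "L \<subseteq> S"
    and LL: "\<And>l k i j. l \<in> L \<Longrightarrow> k \<in> L \<Longrightarrow> l \<in> A i \<Longrightarrow> k \<in> A j \<Longrightarrow> l * k \<in> S"
    and l: "l \<in> L" "l \<in> A i" and k: "k \<in> L" "k \<in> A j" and a: "a \<in> A s" and b: "b \<in> A t"
  shows "b * superbracket l k * a \<in> S"
proof -
  have right: "superbracket l k * a \<in> S"
    if "l \<in> L" "l \<in> A i" "k \<in> L" "k \<in> A j" "a \<in> A s" for l k a i j s
  proof -
    have "superbracket l (k * a) \<in> S" "k * superbracket l a \<in> S"
      using that lie_ideal_bracket[OF L] S(2) LL A_bracket by blast+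
    moreover have "superbracket l k * a =
        superbracket l (k * a) - koszul i j (k * superbracket l a)"
      using bracket_mult_right[OF that(2,4,5)] by simp
    ultimately show ?thesis using subspace_koszul[OF S(1)] subspace_diff[OF S(1)] by simp
  qed
  have "superbracket b l \<in> L" "superbracket b l \<in> A (t + i)"
      "superbracket b k \<in> L" "superbracket b k \<in> A (t + j)"
    using lie_ideal_bracket'[OF L] l k b A_bracket by blast+
  then have "superbracket (superbracket b l) k * a \<in> S" "superbracket l (superbracket b k) * a \<in> S"
    using right l k a by blast+
  moreover have "superbracket l k * (b * a) \<in> S"
    by (rule right[OF l k A_mult[OF b a]])
  moreover have "b * superbracket l k * a = superbracket (superbracket b l) k * a
      + koszul t i (superbracket l (superbracket b k) * a)
      + koszul t (i + j) (superbracket l k * (b * a))"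
    using bracket_jacobi[OF b l(2) k(2)] bracket_hom[OF b A_bracket[OF l(2) k(2)]]
    by (simp add: koszul_def algebra_simps split: if_splits)
  ultimately show ?thesis
    using subspace_koszul[OF S(1)] subspace_add[OF S(1)] by simp
qed

text \<open>Both properties of the ideal are instances of \<open>bracket_sandwich_in\<close>. For
  the brackets, \<open>S\<close> is the set \<open>T\<close> of all \<open>t\<close> with
  \<open>[t, A]\<close> inside \<open>L\<close>; it contains the products of homogeneous elements of
  \<open>L\<close> by the cyclic identity. The last clause expresses that the ideal lies in the span
  of \<open>L\<close> and \<open>L L\<close>.\<close>

lemma lie_ideal_contains_ideal_brackets:
  assumes L: "lie_ideal L"
    and l: "l \<in> L" "l \<in> A i" and k: "k \<in> L" "k \<in> A j" and nz: "superbracket l k \<noteq> 0"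
  obtains M where "graded_ideal M" "M \<noteq> {0}" "\<And>m a. m \<in> M \<Longrightarrow> superbracket m a \<in> L"
    "\<And>S. subspace S \<Longrightarrow> L \<subseteq> S \<Longrightarrow>
      (\<And>l k i j. l \<in> L \<Longrightarrow> k \<in> L \<Longrightarrow> l \<in> A i \<Longrightarrow> k \<in> A j \<Longrightarrow> l * k \<in> S) \<Longrightarrow> M \<subseteq> S"
proof -
  let ?p = "superbracket l k"
  let ?G = "{i * ?p * j | i j s t. i \<in> UNIV \<inter> A s \<and> j \<in> UNIV \<inter> A t}"
  let ?M = "span ?G"
  have p: "?p \<in> A (i + j)" by (rule A_bracket[OF l(2) k(2)])
  have sub: "?M \<subseteq> S" if S: "subspace S" "L \<subseteq> S"
    and LL: "\<And>l k i j. l \<in> L \<Longrightarrow> k \<in> L \<Longrightarrow> l \<in> A i \<Longrightarrow> k \<in> A j \<Longrightarrow> l * k \<in> S" for S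
  proof (rule span_minimal[OF _ S(1)])
    show "?G \<subseteq> S"
    proof
      fix x assume "x \<in> ?G"
      then obtain b a s t where x: "x = b * ?p * a" "b \<in> A s" "a \<in> A t" by auto
      show "x \<in> S" unfolding x(1) by (rule bracket_sandwich_in[OF L S LL l k x(3,2)])
    qed
  qed
  define T where "T = {t. \<forall>a. superbracket t a \<in> L}"
  have Lsub: "subspace L" using L by (simp add: lie_ideal_def graded_submodule_def)
  have "subspace T"
    by (rule subspaceI)
       (use Lsub in \<open>simp_all add: T_def bracket_add_left bracket_scale_left subspace_add
         subspace_scale subspace_0 bracket_even_left\<close>)
  moreover have "L \<subseteq> T" using lie_ideal_bracket[OF L] by (auto simp: T_def)
  moreover have "x * y \<in> T" if "x \<in> L" "y \<in> L" "x \<in> A i" "y \<in> A j" for x y i j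
    unfolding T_def
  proof (intro CollectI allI)
    fix a
    have "superbracket (x * y) a \<in> L" if a: "a \<in> A k" for a k
    proof -
      have "superbracket x (y * a) \<in> L" "superbracket y (a * x) \<in> L"
        using lie_ideal_bracket[OF L] \<open>x \<in> L\<close> \<open>y \<in> L\<close> by blast+
      then show ?thesis
        unfolding bracket_mult_left[OF \<open>x \<in> A i\<close> \<open>y \<in> A j\<close> a]
        using subspace_koszul[OF Lsub] subspace_add[OF Lsub] by blast
    qed
    then have "superbracket (x * y) (part 0 a) + superbracket (x * y) (part 1 a) \<in> L"
      using subspace_add[OF Lsub] part_in by blast
    then show "superbracket (x * y) a \<in> L"
      by (simp only: bracket_add_right[symmetric] part_add_eq)
  qed
  ultimately have "?M \<subseteq> T" by (rule sub)
  then show thesis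
    using that[OF sandwich_ideal[OF graded_ideal_UNIV p]
        sandwich_ideal_nonzero[OF graded_ideal_UNIV UNIV_nonzero p nz] _ sub]
    unfolding T_def by blast
qed

end


section \<open>Subalgebras invariant under a Lie ideal\<close>

text \<open>For even \<open>w\<close> this agrees with the superbracket, and it is a derivation
  without signs.\<close>

definition ad :: "'a::ring \<Rightarrow> 'a \<Rightarrow> 'a" where
  "ad w x = w * x - x * w"

lemma ad_mult: "ad w (x * y) = ad w x * y + x * ad w y"
  and ad_add: "ad w (x + y) = ad w x + ad w y"
  and ad_diff: "ad w (x - y) = ad w x - ad w y"
  and ad_self: "ad w w = 0"
  by (simp_all add: ad_def algebra_simps)

text \<open>The remaining case: \<open>L\<close> has a nonzero bracket, which provides
  \<open>M\<close>, and \<open>W\<close> contains no nonzero ideal. \<open>M_sub\<close> serves as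
  an induction principle for membership of all elements of \<open>M\<close> in a subspace.\<close>

locale nondense_invariant = prime_superalg scale A
  for scale :: "'r::comm_ring_1 \<Rightarrow> 'a::ring \<Rightarrow> 'a" and A +
  fixes L W M :: "'a set"
  assumes L: "lie_ideal L"
    and W: "graded_subalgebra W"
    and WL: "w \<in> W \<Longrightarrow> l \<in> L \<Longrightarrow> superbracket w l \<in> W"
    and nondense: "\<not> dense_in W"
    and M: "graded_ideal M" "M \<noteq> {0}"
    and bracket_M: "m \<in> M \<Longrightarrow> superbracket m a \<in> L"
    and M_sub: "subspace S \<Longrightarrow> L \<subseteq> S \<Longrightarrow>
      (\<And>l k i j. l \<in> L \<Longrightarrow> k \<in> L \<Longrightarrow> l \<in> A i \<Longrightarrow> k \<in> A j \<Longrightarrow> l * k \<in> S) \<Longrightarrow> M \<subseteq> S"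
begin

lemma W_mod: "graded_submodule W"
  and W_mult: "x \<in> W \<Longrightarrow> y \<in> W \<Longrightarrow> x * y \<in> W"
  using W by (simp_all add: graded_subalgebra_def)

lemma W_sub: "subspace W" and L_sub: "subspace L" and M_sub': "subspace M"
  using W_mod L M(1) by (simp_all add: lie_ideal_def graded_ideal_def graded_submodule_def)

lemmas W_add = subspace_add[OF W_sub] and W_diff = subspace_diff[OF W_sub]
  and W_koszul = subspace_koszul[OF W_sub]
lemmas M_multL = graded_ideal_mult(1)[OF M(1)] and M_multR = graded_ideal_mult(2)[OF M(1)]
lemmas W_part = graded_submodule_part[OF W_mod]
lemmas M_part = graded_ideal_part[OF M(1)]
lemmas L_part = graded_submodule_part[OF lie_ideal_submodule[OF L]]

lemma ad_M_in_M: "m \<in> M \<Longrightarrow> ad w m \<in> M"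
  by (simp add: ad_def subspace_diff[OF M_sub'] M_multL M_multR)

lemma A_ad: "w \<in> A 0 \<Longrightarrow> x \<in> A i \<Longrightarrow> ad w x \<in> A i"
  unfolding ad_def by (cases i) (simp_all add: A_intros)

lemma ad_M_in_L:
  assumes "m \<in> M" "w \<in> A 0"
  shows "ad w m \<in> L"
proof -
  have "superbracket m w = - ad w m"
    using bracket_even_right[OF assms(2)] by (simp add: ad_def)
  then show ?thesis using subspace_neg[OF L_sub bracket_M[OF assms(1)], of w] by simp
qed

lemma ad_L_in_W: "w \<in> W \<Longrightarrow> w \<in> A 0 \<Longrightarrow> l \<in> L \<Longrightarrow> ad w l \<in> W"
  using WL[of w l] by (simp add: bracket_even_left ad_def)

lemma bracket_M_even: "m \<in> M \<Longrightarrow> a \<in> A 0 \<Longrightarrow> m * a - a * m \<in> L"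
  using bracket_M[of m a] by (simp add: bracket_even_right)

lemma bracket_M_odd: "m \<in> M \<Longrightarrow> m \<in> A 1 \<Longrightarrow> a \<in> A 1 \<Longrightarrow> m * a + a * m \<in> L"
  using bracket_M[of m a] by (simp add: bracket_odd)

text \<open>If \<open>y M\<close> lies in \<open>W\<close> and \<open>l\<close> in \<open>L\<close>,
  then bracketing \<open>y m\<close> with \<open>l\<close> and removing \<open>y (m l)\<close>
  leaves \<open>l y m\<close> in \<open>W\<close>. So \<open>L\<close> can be multiplied on from the
  left repeatedly, and \<open>M_sub\<close> carries this over to \<open>M\<close>, giving
  \<open>M c M\<close> inside \<open>W\<close>.\<close>

lemma right_absorbing_zero:
  assumes c: "c \<in> W" "c \<in> A k" and cM: "\<And>m. m \<in> M \<Longrightarrow> c * m \<in> W"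
  shows "c = 0"
proof (rule ccontr)
  assume c0: "c \<noteq> 0"
  have step: "l * y * m \<in> W"
    if y: "y \<in> A i" "\<And>m. m \<in> M \<Longrightarrow> y * m \<in> W" and l: "l \<in> L" and m: "m \<in> M" for l y m i
  proof -
    have hom: "l * y * m \<in> W" if l: "l \<in> L" "l \<in> A j" and m: "m \<in> M" "m \<in> A s" for l m j s
    proof -
      have ym: "y * m \<in> A (i + s)" using y(1) m(2) by (rule A_mult)
      have "superbracket (y * m) l \<in> W" by (rule WL[OF y(2)[OF m(1)] l(1)])
      then have "y * m * l - koszul (i + s) j (l * (y * m)) \<in> W"
        unfolding bracket_hom[OF ym l(2)] .
      moreover have "y * (m * l) \<in> W" by (rule y(2)) (rule M_multR[OF m(1)])
      ultimately have "y * (m * l) - (y * m * l - koszul (i + s) j (l * (y * m))) \<in> W"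
        by (blast intro: W_diff)
      then have "koszul (i + s) j (l * (y * m)) \<in> W" by (simp add: mult.assoc)
      then have "koszul (i + s) j (koszul (i + s) j (l * (y * m))) \<in> W" by (rule W_koszul)
      then show ?thesis by (simp add: mult.assoc)
    qed
    have "part a l * y * m \<in> W" for a
    proof -
      have "part a l * y * part 0 m + part a l * y * part 1 m \<in> W"
        by (intro W_add hom[OF L_part[OF l] part_in M_part[OF m] part_in])
      then show ?thesis by (simp only: distrib_left[symmetric] part_add_eq)
    qed
    then have "part 0 l * y * m + part 1 l * y * m \<in> W" by (blast intro: W_add)
    then show ?thesis by (simp only: distrib_right[symmetric] part_add_eq)
  qed
  \<comment> \<open>The \<open>x\<close> with \<open>x c M \<subseteq> W\<close> are stable under left multiplication by \<open>L\<close>.\<close>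
  have "M \<subseteq> {x. \<forall>m\<in>M. x * c * m \<in> W}"
  proof (rule M_sub)
    show "subspace {x. \<forall>m\<in>M. x * c * m \<in> W}"
      by (rule subspaceI)
         (simp_all add: distrib_right W_add subspace_0[OF W_sub] subspace_scale[OF W_sub]
           flip: scale_mult_left)
    show "L \<subseteq> {x. \<forall>m\<in>M. x * c * m \<in> W}" using step[OF c(2) cM] by blast
    fix l k i j assume l: "l \<in> L" "k \<in> L" "l \<in> A i" "k \<in> A j"
    have "l * (k * c) * m \<in> W" if "m \<in> M" for m
      using step[OF A_mult[OF l(4) c(2)] _ l(1) that] step[OF c(2) cM l(2)] by blast
    then show "l * k \<in> {x. \<forall>m\<in>M. x * c * m \<in> W}" by (simp add: mult.assoc)
  qed
  then have McM: "x * c * y \<in> W" if "x \<in> M" "y \<in> M" for x y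
    using that by blast
  let ?I = "span {i * c * j | i j s t. i \<in> M \<inter> A s \<and> j \<in> M \<inter> A t}"
  have "?I \<subseteq> W" by (rule span_minimal[OF _ W_sub]) (use McM in blast)
  then have "?I \<subseteq> graded_subalgebra hull W" using hull_subset[of W graded_subalgebra] by blast
  then have "dense_in W"
    using sandwich_ideal[OF M(1) c(2)] sandwich_ideal_nonzero[OF M c(2) c0]
    unfolding dense_in_def by blast
  then show False using nondense by simp
qed

text \<open>Put \<open>x = ad w m\<close>. Since \<open>w x = ad w (w m)\<close> also lies in
  \<open>L\<close>, both \<open>w [v, x]\<close> and \<open>[v, w x]\<close> lie in
  \<open>W\<close>; the terms with \<open>v\<close> on the right cancel in their difference.\<close>

lemma ad_W_times_ad_M:
  assumes w: "w \<in> W" "w \<in> A 0" and v: "v \<in> W" "v \<in> A j" and m: "m \<in> M"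
  shows "ad w v * ad w m \<in> W"
proof -
  have hom: "ad w v * ad w m \<in> W" if m: "m \<in> M" "m \<in> A k" for m k
  proof -
    have adm: "ad w m \<in> A k" using A_ad[OF w(2) m(2)] .
    have wadm: "w * ad w m \<in> A k" using w(2) adm by (cases k) (simp_all add: A_intros)
    have "w * ad w m \<in> L"
      using ad_M_in_L[OF M_multL[OF m(1), of w] w(2)] by (simp add: ad_mult ad_self)
    then have "superbracket v (w * ad w m) \<in> W" by (rule WL[OF v(1)])
    moreover have "w * superbracket v (ad w m) \<in> W"
      by (rule W_mult[OF w(1) WL[OF v(1) ad_M_in_L[OF m(1) w(2)]]])
    ultimately have "w * superbracket v (ad w m) - superbracket v (w * ad w m) \<in> W"
      by (blast intro: W_diff)
    moreover have "w * superbracket v (ad w m) - superbracket v (w * ad w m) = ad w v * ad w m"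
      unfolding bracket_hom[OF v(2) adm] bracket_hom[OF v(2) wadm] ad_def[of w v]
      by (simp add: koszul_def algebra_simps)
    ultimately show ?thesis by simp
  qed
  have "ad w v * ad w (part 0 m) + ad w v * ad w (part 1 m) \<in> W"
    by (intro W_add hom[OF M_part[OF m] part_in])
  then show ?thesis by (simp only: distrib_left[symmetric] ad_add[symmetric] part_add_eq)
qed

lemma ad_W_in_W: "w \<in> W \<Longrightarrow> x \<in> W \<Longrightarrow> ad w x \<in> W"
  unfolding ad_def by (blast intro: W_diff W_mult)

text \<open>In the expansion of \<open>ad w (ad w (v m))\<close> every term except
  \<open>ad w (ad w v) * m\<close> is known to lie in \<open>W\<close>, so
  \<open>ad w (ad w v)\<close> absorbs \<open>M\<close> and vanishes.\<close>

lemma ad_ad_W_zero: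
  assumes w: "w \<in> W" "w \<in> A 0" and v: "v \<in> W"
  shows "ad w (ad w v) = 0"
proof -
  have hom: "ad w (ad w v) = 0" if v: "v \<in> W" "v \<in> A j" for v j
  proof (rule right_absorbing_zero)
    show "ad w (ad w v) * m \<in> W" if m: "m \<in> M" for m
    proof -
      have "ad w (ad w (v * m)) \<in> W"
        by (rule ad_L_in_W[OF w ad_M_in_L[OF M_multL[OF m] w(2)]])
      moreover have "v * ad w (ad w m) \<in> W"
        by (rule W_mult[OF v(1) ad_L_in_W[OF w ad_M_in_L[OF m w(2)]]])
      moreover have "ad w v * ad w m \<in> W" by (rule ad_W_times_ad_M[OF w v m])
      ultimately have "ad w (ad w (v * m)) - v * ad w (ad w m) - ad w v * ad w m - ad w v * ad w m \<in> W"
        by (blast intro: W_diff)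
      then show ?thesis by (simp add: ad_mult ad_add algebra_simps)
    qed
    show "ad w (ad w v) \<in> W" by (intro ad_W_in_W w v)
    show "ad w (ad w v) \<in> A j" by (intro A_ad w v)
  qed
  have "ad w (ad w (part 0 v + part 1 v)) = 0"
    by (simp only: ad_add hom[OF W_part[OF v] part_in] add_0)
  then show ?thesis by (simp only: part_add_eq)
qed

text \<open>The square of \<open>ad w\<close> kills \<open>x\<close>, \<open>y\<close> and
  \<open>x y\<close>, and its value on the product is twice the claimed one.\<close>

lemma ad_W_times_ad_W:
  assumes w: "w \<in> W" "w \<in> A 0" and x: "x \<in> W" and y: "y \<in> W"
  shows "ad w x * ad w y = 0"
proof -
  have "ad w (ad w (x * y)) = ad w x * ad w y + ad w x * ad w y"
    using ad_ad_W_zero[OF w x] ad_ad_W_zero[OF w y] by (simp add: ad_mult ad_add)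
  then show ?thesis
    using ad_ad_W_zero[OF w W_mult[OF x y]] double_zero[of "ad w x * ad w y"] by simp
qed

text \<open>Replace \<open>y\<close> by \<open>s y\<close> in \<open>ad_W_times_ad_W\<close> and
  expand.\<close>

lemma ad_W_sandwich_W:
  assumes w: "w \<in> W" "w \<in> A 0" and x: "x \<in> W" and s: "s \<in> W" and y: "y \<in> W"
  shows "ad w x * s * ad w y = 0"
proof -
  have "ad w x * ad w (s * y) = 0" by (rule ad_W_times_ad_W[OF w x W_mult[OF s y]])
  moreover have "ad w x * ad w (s * y) = ad w x * ad w s * y + ad w x * s * ad w y"
    by (simp add: ad_mult algebra_simps)
  ultimately show ?thesis using ad_W_times_ad_W[OF w x s] by simp
qed

text \<open>Replace \<open>m\<close> by \<open>m y\<close> in \<open>ad_W_times_ad_M\<close>; the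
  unwanted term ends in the factor \<open>y\<close> from \<open>W\<close>.\<close>

lemma ad_W_sandwich_M:
  assumes w: "w \<in> W" "w \<in> A 0" and v: "v \<in> W" "v \<in> A j" and y: "y \<in> W" and m: "m \<in> M"
  shows "ad w v * m * ad w y \<in> W"
proof -
  have "ad w v * ad w (m * y) - ad w v * ad w m * y \<in> W"
    by (intro W_diff W_mult ad_W_times_ad_M[OF w v] M_multR m y)
  then show ?thesis by (simp add: ad_mult algebra_simps)
qed

text \<open>Bracketing \<open>p M p \<subseteq> W\<close> twice with \<open>l\<close> and sandwiching the result between two factors
  \<open>p\<close> leaves only the middle term, because \<open>p W p = 0\<close>.\<close>

lemma ad_W_sandwich_L_even:
  assumes w: "w \<in> W" "w \<in> A 0" and v: "v \<in> W" "v \<in> A j" and l: "l \<in> L" "l \<in> A 0"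
  shows "ad w v * l * ad w v = 0"
proof -
  let ?p = "ad w v"
  have p: "?p \<in> A j" by (rule A_ad[OF w(2) v(2)])
  have plp: "?p * l * ?p \<in> A 0" using A_mult[OF A_mult[OF p l(2)] p] by (cases j) simp_all
  have pp: "?p * ?p = 0" by (rule ad_W_times_ad_W[OF w v(1) v(1)])
  have "(?p * l * ?p) * m * (?p * l * ?p) = 0" if m: "m \<in> M" for m
  proof -
    define q where "q = ?p * m * ?p"
    have q: "q \<in> W" unfolding q_def by (rule ad_W_sandwich_M[OF w v v(1) m])
    have pq: "?p * (q * x) = 0" and qp: "q * ?p = 0" for x
      using pp by (simp_all add: q_def mult.assoc, simp_all add: mult.assoc[symmetric])
    have br: "x * l - l * x \<in> W" if "x \<in> W" for x
      using WL[OF that l(1)] bracket_even_right[OF l(2), of x] by simp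
    have "?p * ((q * l - l * q) * l - l * (q * l - l * q)) * ?p = 0"
      by (rule ad_W_sandwich_W[OF w v(1) br[OF br[OF q]] v(1)])
    moreover have "?p * ((q * l - l * q) * l - l * (q * l - l * q)) * ?p =
        - (?p * l * q * l * ?p + ?p * l * q * l * ?p)"
      by (simp add: right_diff_distrib left_diff_distrib mult.assoc pq qp)
    ultimately have "?p * l * q * l * ?p + ?p * l * q * l * ?p = 0"
      by (simp only: neg_equal_0_iff_equal)
    then have "?p * l * q * l * ?p = 0" by (rule double_zero)
    then show ?thesis by (simp add: q_def mult.assoc)
  qed
  then have "?p * l * ?p = 0 \<or> ?p * l * ?p = 0" by (rule sandwich_zero[OF M plp plp])
  then show ?thesis by simp
qed

text \<open>The identity \<open>p l p = 0\<close> is known only for even \<open>l\<close> in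
  \<open>L\<close>. It is first applied to brackets of \<open>M\<close> with \<open>A p\<close>,
  which frees the middle factors from \<open>L\<close>, and then the parity restriction is
  removed.\<close>

lemma ad_W_even_even:
  assumes w: "w \<in> W" "w \<in> A 0" and v: "v \<in> W" "v \<in> A 0"
  shows "ad w v = 0"
proof (rule ccontr)
  let ?p = "ad w v"
  assume nz: "?p \<noteq> 0"
  have p: "?p \<in> A 0" by (rule A_ad[OF w(2) v(2)])
  have pp: "?p * ?p = 0" by (rule ad_W_times_ad_W[OF w v(1) v(1)])
  then have pp': "?p * (?p * x) = 0" for x by (simp add: mult.assoc[symmetric])
  note plp = ad_W_sandwich_L_even[OF w v]
  \<comment> \<open>Take \<open>l = [m, b p]\<close>, which is even because the two degrees agree.
    The term \<open>m b p\<close> disappears against the outer \<open>p\<close>, as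
    \<open>p p = 0\<close>.\<close>
  have same: "?p * (b * (?p * (m * ?p))) = 0" if b: "b \<in> A i" and m: "m \<in> M" "m \<in> A i" for b m i
  proof (cases "i = 0")
    case True
    have bp: "b * ?p \<in> A 0" using A_mult[OF b p] True by simp
    have "?p * (m * (b * ?p) - b * ?p * m) * ?p = 0"
      by (rule plp[OF bracket_M_even[OF m(1) bp]]) (use True m(2) bp in \<open>simp add: A_intros\<close>)
    then show ?thesis by (simp add: algebra_simps pp pp')
  next
    case False
    then have i: "i = 1" by (cases i) simp_all
    have bp: "b * ?p \<in> A 1" using A_mult[OF b p] i by simp
    have m1: "m \<in> A 1" using m(2) i by simp
    have "?p * (m * (b * ?p) + b * ?p * m) * ?p = 0"
      by (rule plp[OF bracket_M_odd[OF m(1) m1 bp]]) (use m1 bp in \<open>simp add: A_intros\<close>)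
    then show ?thesis by (simp add: algebra_simps pp pp')
  qed
  have pbpmp: "?p * b * ?p * m * ?p = 0" if b: "b \<in> M" "b \<in> A s" and m: "m \<in> M" "m \<in> A t" for b m s t
  proof -
    let ?y = "?p * b * ?p * m * ?p"
    have y: "?y \<in> A (0 + s + 0 + t + 0)" by (intro A_mult p b m)
    \<comment> \<open>Among the degrees of \<open>b\<close>, \<open>m\<close> and \<open>c\<close>
      two coincide, and in each case \<open>?y c ?y\<close> contains a factor covered by
      \<open>same\<close>.\<close>
    have "?y * c * ?y = 0" if c: "c \<in> M" "c \<in> A r" for c r
    proof (cases "r = t")
      case True
      then have "?p * (m * (?p * (c * ?p))) = 0" using same[OF m(2) c(1)] c(2) by simp
      then have "?p * b * (?p * (m * (?p * (c * ?p)))) * b * ?p * m * ?p = 0" by simp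
      then show ?thesis by (simp only: mult.assoc)
    next
      case rt: False
      show ?thesis
      proof (cases "s = t")
        case True
        then show ?thesis using same[OF b(2) m(1)] m(2) by (simp add: mult.assoc)
      next
        case False
        then have "r = s" using rt by (cases r; cases s; cases t) simp_all
        then have "?p * (c * (?p * (b * ?p))) = 0" using same[OF c(2) b(1)] b(2) by simp
        then have "?p * b * ?p * m * (?p * (c * (?p * (b * ?p)))) * m * ?p = 0" by simp
        then show ?thesis by (simp only: mult.assoc)
      qed
    qed
    then have "?y = 0 \<or> ?y = 0" by (rule sandwich_zero[OF M y y])
    then show ?thesis by simp
  qed
  have "?p * m * ?p = 0" if m: "m \<in> M" "m \<in> A t" for m t
  proof -
    have pmp: "?p * m * ?p \<in> A (0 + t + 0)" by (intro A_mult p m)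
    have "?p * m * ?p * c * ?p = 0" if c: "c \<in> M" "c \<in> A r" for c r by (rule pbpmp[OF m c])
    then have "?p * m * ?p = 0 \<or> ?p = 0" by (rule sandwich_zero[OF M pmp p])
    then show ?thesis using nz by simp
  qed
  then have "?p = 0 \<or> ?p = 0" by (rule sandwich_zero[OF M p p])
  then show False using nz by simp
qed

text \<open>On the even part \<open>N\<close> of \<open>M\<close> the derivation \<open>D\<close>
  satisfies \<open>D (D (D x)) = 0\<close> and the quadratic identity \<open>i\<close>. Consequences
  of \<open>i\<close> under products and under \<open>D\<close> give first
  \<open>D (D x) N D (D x) = 0\<close> and then \<open>D x N D x = 0\<close>.\<close>

lemma ad_even_M_even_zero:
  assumes w: "w \<in> W" "w \<in> A 0" and m: "m \<in> M" "m \<in> A 0"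
  shows "ad w m = 0"
proof -
  define D where "D = ad w"
  have mult: "D (x * y) = D x * y + x * D y" and addD: "D (x + y) = D x + D y" for x y
    unfolding D_def by (fact ad_mult, fact ad_add)
  define N where "N = M \<inter> A 0"
  have ND: "D x \<in> N" if "x \<in> N" for x
    using that A_ad[OF w(2)] ad_M_in_M by (simp add: N_def D_def)
  have NN: "x * y \<in> N" if "x \<in> N" "y \<in> N" for x y
    using that M_multL by (simp add: N_def A_intros)
  \<comment> \<open>\<open>D l\<close> is an even element of \<open>W\<close>, and even elements of
    \<open>W\<close> commute with \<open>w\<close>.\<close>
  have DDL: "D (D l) = 0" if "l \<in> L" "l \<in> A 0" for l
    unfolding D_def
    by (rule ad_W_even_even[OF w ad_L_in_W[OF w that(1)] A_ad[OF w(2) that(2)]])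
  have D3: "D (D (D x)) = 0" if x: "x \<in> N" for x
  proof (rule DDL)
    show "D x \<in> L" unfolding D_def using x ad_M_in_L[OF _ w(2)] by (simp add: N_def)
    show "D x \<in> A 0" using ND[OF x] by (simp add: N_def)
  qed
  \<comment> \<open>\<open>D x * y\<close> is a combination of the commutators of \<open>x\<close>
    with \<open>y\<close> and with \<open>w y\<close>, the former multiplied by \<open>w\<close>.
    Both commutators lie in \<open>L\<close>, and \<open>D\<close> commutes with left multiplication
    by \<open>w\<close>, so \<open>D (D (D x * y)) = 0\<close>; expanding with
    \<open>D (D (D x)) = 0\<close> gives the identity.\<close>
  have i: "D (D x) * D y + D (D x) * D y + D x * D (D y) = 0" if x: "x \<in> N" and y: "y \<in> N" for x y
  proof -
    have x': "x \<in> M" "x \<in> A 0" and y': "y \<in> M" "y \<in> A 0" using x y by (simp_all add: N_def)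
    have wy: "w * y \<in> A 0" using w(2) y' by (simp add: A_intros)
    have "D (D (x * (w * y) - w * y * x)) = 0"
      using x' wy by (intro DDL bracket_M_even) (simp_all add: A_intros)
    moreover have "D (D (x * y - y * x)) = 0"
      using x' y' by (intro DDL bracket_M_even) (simp_all add: A_intros)
    moreover have "x * (w * y) - w * y * x = w * (x * y - y * x) - D x * y"
      by (simp add: D_def ad_def algebra_simps)
    moreover have "D (u - v) = D u - D v" for u v by (simp add: D_def ad_diff)
    moreover have "D (w * u) = w * D u" for u by (simp add: D_def ad_mult ad_self)
    ultimately have "D (D (D x * y)) = 0" by simp
    then show ?thesis using D3[OF x] by (simp add: mult addD algebra_simps)
  qed
  \<comment> \<open>Replace \<open>x\<close> by \<open>D x\<close> in \<open>i\<close>.\<close>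
  have ii: "D (D x) * D (D y) = 0" if x: "x \<in> N" and y: "y \<in> N" for x y
    using i[OF ND[OF x] y] D3[OF x] by simp
  \<comment> \<open>This is \<open>i\<close> for \<open>x\<close> and \<open>a b\<close>, minus
    \<open>i\<close> for \<open>x\<close> and \<open>a\<close> multiplied by
    \<open>b\<close>.\<close>
  have iii: "D (D x) * a * D b + D (D x) * a * D b + D x * D a * D b + D x * D a * D b
      + D x * a * D (D b) = 0" if x: "x \<in> N" and a: "a \<in> N" and b: "b \<in> N" for x a b
  proof -
    have "(D (D x) * D a + D (D x) * D a + D x * D (D a)) * b = 0" using i[OF x a] by simp
    then show ?thesis using i[OF x NN[OF a b]] by (simp add: mult addD algebra_simps)
  qed
  \<comment> \<open>\<open>iii\<close> with \<open>D a\<close> for \<open>a\<close> reads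
    \<open>2 P + 2 Q + R = 0\<close>, and \<open>D x\<close> times \<open>i\<close> reads
    \<open>2 Q + R = 0\<close>.\<close>
  have xab: "D (D x) * D a * D b = 0" if x: "x \<in> N" and a: "a \<in> N" and b: "b \<in> N" for x a b
  proof -
    define P Q R where "P = D (D x) * D a * D b" and "Q = D x * D (D a) * D b"
      and "R = D x * D a * D (D b)"
    have "D x * (D (D a) * D b + D (D a) * D b + D a * D (D b)) = 0" using i[OF a b] by simp
    then have "Q + Q + R = 0" by (simp add: Q_def R_def algebra_simps)
    moreover have "P + P + (Q + Q + R) = 0"
      using iii[OF x ND[OF a] b] by (simp add: P_def Q_def R_def algebra_simps)
    ultimately have "P + P = 0" by simp
    then show ?thesis unfolding P_def by (rule double_zero)
  qed
  \<comment> \<open>In \<open>iii\<close> with \<open>D x\<close> for \<open>x\<close> and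
    \<open>x\<close> for \<open>b\<close>, the first pair of terms contains
    \<open>D (D (D x))\<close> and the second pair vanishes by \<open>xab\<close>.\<close>
  have "D (D x) * a * D (D x) = 0" if x: "x \<in> N" and a: "a \<in> N" for x a
    using iii[OF ND[OF x] a x] D3[OF x] xab[OF x a x] by simp
  then have DD: "D (D x) = 0" if x: "x \<in> N" for x
    using that ND[OF ND[OF that]] by (intro even_sandwich_zero[OF M, of "D (D x)"]) (simp_all add: N_def)
  have DxDy: "D x * D y = 0" if x: "x \<in> N" and y: "y \<in> N" for x y
    using DD[OF NN[OF x y]] DD[OF x] DD[OF y] double_zero[of "D x * D y"] by (simp add: mult addD)
  have mN: "m \<in> N" using m by (simp add: N_def)
  have "D m * a * D m = 0" if a: "a \<in> N" for a
    using DxDy[OF mN NN[OF a mN]] DxDy[OF mN a]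
    by (simp add: mult distrib_left mult.assoc[symmetric])
  then have "D m = 0"
    using ND[OF mN] by (intro even_sandwich_zero[OF M, of "D m"]) (simp_all add: N_def)
  then show ?thesis by (simp add: D_def)
qed

text \<open>Since \<open>D\<close> kills the even part of \<open>M\<close>, it can be moved across a
  product of two odd elements at the cost of a sign and past even factors freely. Moving it in
  \<open>D (D x) * D (D y)\<close> collects four copies of \<open>D\<close> on \<open>x\<close>, and
  four copies give zero because two of them already lead into \<open>W\<close>.\<close>

lemma ad_even_M_odd_zero:
  assumes w: "w \<in> W" "w \<in> A 0" and m: "m \<in> M" "m \<in> A 1"
  shows "ad w m = 0"
proof -
  define D where "D = ad w"
  have mult: "D (x * y) = D x * y + x * D y" and addD: "D (x + y) = D x + D y" for x y
    unfolding D_def by (fact ad_mult, fact ad_add)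
  define N where "N = M \<inter> A 1"
  have ND: "D x \<in> N" if "x \<in> N" for x
    using that A_ad[OF w(2)] ad_M_in_M by (simp add: N_def D_def)
  have D0: "D b = 0" if "b \<in> M" "b \<in> A 0" for b
    unfolding D_def by (rule ad_even_M_even_zero[OF w that])
  have xy: "D x * y = - (x * D y)" if "x \<in> N" "y \<in> N" for x y
  proof -
    have "D (x * y) = 0" using that M_multL by (intro D0) (simp_all add: N_def A_intros)
    then show ?thesis by (simp add: mult eq_neg_iff_add_eq_0)
  qed
  have D4: "D (D (D (D x))) = 0" if x: "x \<in> N" for x
    unfolding D_def
    by (intro ad_ad_W_zero[OF w] ad_L_in_W[OF w] ad_M_in_L[OF _ w(2)]) (use x N_def in simp)
  have even: "D x * b = D (x * b)" "x * b \<in> N" if "x \<in> N" "b \<in> M" "b \<in> A 0" for x b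
    using D0[OF that(2,3)] that M_multL by (simp_all add: mult N_def A_intros)
  have DDxy: "D (D x) * D (D y) = 0" if x: "x \<in> N" and y: "y \<in> N" for x y
  proof -
    have "D (D x) * D (D y) = - (D (D (D x)) * D y)"
      using xy[OF ND[OF ND[OF x]] ND[OF y]] by simp
    also have "\<dots> = D (D (D (D x))) * y"
      using xy[OF ND[OF ND[OF ND[OF x]]] y] by simp
    finally show ?thesis using D4[OF x] by simp
  qed
  have DD: "D (D x) = 0" if x: "x \<in> N" for x
  proof -
    have h: "D (D x) \<in> A 1" using ND[OF ND[OF x]] by (simp add: N_def)
    have "D (D x) * b * D (D x) = 0" if b: "b \<in> M" "b \<in> A s" for b s
    proof (cases "s = 0")
      case True
      then have b0: "b \<in> A 0" using b by simp
      have "D (D x) * b = D (D (x * b))"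
        using even[OF ND[OF x] b(1) b0] even[OF x b(1) b0] by simp
      then show ?thesis using DDxy[OF even(2)[OF x b(1) b0] x] by simp
    next
      case False
      then have bN: "b \<in> N" using b by (cases s) (simp_all add: N_def)
      have "D (D x) * b = x * D (D b)"
        using xy[OF ND[OF x] bN] xy[OF x ND[OF bN]] by simp
      then show ?thesis using DDxy[OF bN x] by (simp add: mult.assoc)
    qed
    then have "D (D x) = 0 \<or> D (D x) = 0" by (rule sandwich_zero[OF M h h])
    then show ?thesis by simp
  qed
  have DxDy: "D x * D y = 0" if x: "x \<in> N" and y: "y \<in> N" for x y
    using xy[OF ND[OF x] y] DD[OF x] by simp
  have mN: "m \<in> N" using m by (simp add: N_def)
  have h: "D m \<in> A 1" using ND[OF mN] by (simp add: N_def)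
  have "D m * b * D m = 0" if b: "b \<in> M" "b \<in> A s" for b s
  proof (cases "s = 0")
    case True
    then have b0: "b \<in> A 0" using b by simp
    show ?thesis using even[OF mN b(1) b0] DxDy[OF _ mN] by simp
  next
    case False
    then have bN: "b \<in> N" using b by (cases s) (simp_all add: N_def)
    show ?thesis using xy[OF mN bN] DxDy[OF bN mN] by (simp add: mult.assoc)
  qed
  then have "D m = 0 \<or> D m = 0" by (rule sandwich_zero[OF M h h])
  then show ?thesis by (simp add: D_def)
qed

lemma W_even_central:
  assumes w: "w \<in> W" "w \<in> A 0"
  shows "w \<in> even_center"
proof (rule commute_ideal_central[OF M w(2)])
  fix m assume m: "m \<in> M"
  have "ad w (part 0 m + part 1 m) = 0"
    using ad_even_M_even_zero[OF w M_part[OF m] part_in] ad_even_M_odd_zero[OF w M_part[OF m] part_in]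
    by (simp only: ad_add add_0)
  then show "w * m = m * w" by (simp only: part_add_eq) (simp add: ad_def)
qed

end


section \<open>Elements generating a Clifford superalgebra\<close>

context superalgebra
begin

text \<open>For \<open>n = 1\<close> only the generator \<open>u\<close> is used and \<open>x\<close> is zero.\<close>

definition clifford_frame :: "nat \<Rightarrow> 'a \<Rightarrow> 'a \<Rightarrow> bool" where
  "clifford_frame n u x \<longleftrightarrow> u \<in> A 1 \<and> x \<in> A 1 \<and> u * x + x * u = 0 \<and>
    u * u \<in> even_center \<and> u * u \<noteq> 0 \<and> x * x \<in> even_center \<and>
    (n = 1 \<and> x = 0 \<or> n = 2 \<and> x * x \<noteq> 0) \<and>
    (\<forall>a\<in>A 0. \<exists>z\<in>even_center - {0}. \<exists>c\<in>even_center. \<exists>d\<in>even_center. z * a = c + d * (u * x)) \<and>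
    (\<forall>a\<in>A 1. \<exists>z\<in>even_center - {0}. \<exists>c\<in>even_center. \<exists>d\<in>even_center. z * a = c * u + d * x)"

end

context prime_superalg
begin

lemma even_center_halve: "z + z \<in> even_center \<Longrightarrow> z \<in> even_center"
proof (rule even_centerI)
  assume z: "z + z \<in> even_center"
  show "z \<in> A 0" by (rule subspace_halve[OF subspace_A even_center_even[OF z]])
  fix a
  have "(z * a - a * z) + (z * a - a * z) = 0"
    using even_center_commute[OF z, of a] by (simp add: algebra_simps)
  then have "z * a - a * z = 0" by (rule double_zero)
  then show "z * a = a * z" by simp
qed

text \<open>\<open>l\<close> pairs centrally with \<open>u\<close> but need not square to zero. Its
  replacement \<open>l u l\<close> does, because \<open>u l l u = (z - l u) (z - u l) = 0\<close>,
  and \<open>u l u = z u\<close> makes the new pairing \<open>z z\<close>.\<close>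

lemma hyperbolic_partner:
  assumes u: "u \<in> A 1" "u * u = 0" and l: "l \<in> A 1" and z: "u * l + l * u = z" "z \<in> even_center"
  shows "l * u * l \<in> A 1" "(l * u * l) * (l * u * l) = 0"
    and "u * (l * u * l) + (l * u * l) * u = z * z"
proof -
  note comm = even_center_commute[OF z(2)]
  show "l * u * l \<in> A 1" using u l by (simp add: A_intros)
  have lu: "l * u = z - u * l" and ul: "u * l = z - l * u" using z(1) by (auto simp: algebra_simps)
  have ulu: "u * l * u = z * u"
    unfolding ul using u(2) by (simp add: left_diff_distrib mult.assoc)
  have "u * (l * u * l) + (l * u * l) * u = (u * l * u) * l + l * (u * l * u)"
    by (simp add: mult.assoc)
  also have "\<dots> = z * (u * l + l * u)"
    unfolding ulu using even_center_left_commute[OF z(2), of l u] by (simp add: distrib_left mult.assoc)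
  finally show "u * (l * u * l) + (l * u * l) * u = z * z" using z(1) by simp
  have "u * l * (l * u) = (z - l * u) * (z - u * l)" by (rule arg_cong2[OF ul lu, of "(*)"])
  also have "\<dots> = z * z - z * (u * l + l * u) + l * (u * u) * l"
    using comm[of "l * u"] by (simp add: algebra_simps)
  also have "\<dots> = 0" using z(1) u(2) by simp
  finally have "l * (u * l * (l * u)) * l = 0" by simp
  then show "(l * u * l) * (l * u * l) = 0" by (simp only: mult.assoc)
qed

text \<open>With \<open>z = 1\<close> the elements \<open>u v\<close> and \<open>v u\<close> are complementary idempotents, and the claim
  is that the four Peirce components of \<open>A\<close> are spanned by \<open>u v\<close>, \<open>u\<close>, \<open>v\<close> and \<open>v u\<close>.\<close>

lemma hyperbolic_frame:
  assumes u: "u \<in> A 1" "u * u = 0" and v: "v \<in> A 1" "v * v = 0"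
    and z: "u * v + v * u = z" "z \<in> even_center" "z \<noteq> 0"
    and even: "\<And>a. a \<in> A 0 \<Longrightarrow> u * a * u = 0"
    and odd: "\<And>a. a \<in> A 1 \<Longrightarrow> \<exists>c\<in>even_center. z * (u * a * u) = c * u"
  shows "clifford_frame 2 (u + v) (u - v)"
proof -
  note comm = even_center_commute[OF z(2)] and lcomm = even_center_left_commute[OF z(2), of v]
  have vu: "v * u = z - u * v" using z(1) by (auto simp: algebra_simps)
  \<comment> \<open>The factor \<open>z * (z * z)\<close> clears the denominators of the Peirce
    decomposition and of \<open>odd\<close>; the doubling comes from rewriting \<open>u v\<close>
    and \<open>v u\<close> through their sum and difference.\<close>
  define t where "t = z * (z * z) + z * (z * z)"
  have zzz: "z * (z * z) \<in> even_center" "z * (z * z) \<noteq> 0"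
    using z even_center_mult even_center_mult_nonzero by blast+
  then have t: "t \<in> even_center - {0}"
    using even_center_add[OF zzz(1) zzz(1)] double_zero[of "z * (z * z)"] by (auto simp: t_def)
  \<comment> \<open>The Peirce decomposition for the complementary quasi-idempotents
    \<open>u v\<close> and \<open>v u\<close>, whose sum is \<open>z\<close> instead of 1.\<close>
  have expand: "z * (z * a) = u * v * a * u * v + u * v * a * v * u + v * u * a * u * v + v * u * a * v * u"
    for a
  proof -
    have "z * (z * a) = z * a * z" using comm[of "z * a"] by simp
    also have "\<dots> = (u * v + v * u) * a * (u * v + v * u)" using z(1) by simp
    finally show ?thesis by (simp add: algebra_simps)
  qed
  \<comment> \<open>The hyperbolic pair is turned into an orthogonal basis with values
    \<open>z\<close> and \<open>- z\<close>.\<close>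
  have uuvv: "(u + v) * (u + v) = z" "(u - v) * (u - v) = - z" "(u + v) * (u - v) = v * u - u * v"
    using z(1) u(2) v(2) by (auto simp: algebra_simps)
  have a0: "\<exists>z\<in>even_center - {0}. \<exists>c\<in>even_center. \<exists>d\<in>even_center. z * a = c + d * ((u + v) * (u - v))"
    if a: "a \<in> A 0" for a
  proof -
    obtain c where c: "c \<in> even_center" "z * (u * (v * a) * u) = c * u"
      using odd[of "v * a"] v(1) a by (auto simp: A_intros)
    obtain d where d: "d \<in> even_center" "z * (u * (a * v) * u) = d * u"
      using odd[of "a * v"] v(1) a by (auto simp: A_intros)
    have "u * (v * a * v) * u = 0" using v(1) a by (intro even) (simp add: A_intros)
    then have e: "u * v * a * v * u = 0" by (simp add: mult.assoc)
    have e': "v * u * a * u * v = 0"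
    proof -
      have "v * (u * a * u) * v = 0" using even[OF a] by simp
      then show ?thesis by (simp only: mult.assoc)
    qed
    have "z * (z * (z * a)) = z * (u * (v * a) * u) * v + v * (z * (u * (a * v) * u))"
      unfolding expand e e' by (simp add: distrib_left mult.assoc lcomm)
    also have "\<dots> = c * (u * v) + d * (v * u)"
      unfolding c d by (simp add: mult.assoc even_center_left_commute[OF d(1), of v])
    finally have "t * a = c * (u * v) + d * (v * u) + (c * (u * v) + d * (v * u))"
      by (simp add: t_def distrib_right mult.assoc)
    also have "\<dots> = (c + d) * z + (d - c) * ((u + v) * (u - v))"
      unfolding uuvv z(1)[symmetric] by (simp add: algebra_simps)
    finally show ?thesis
      using t even_center_mult[OF even_center_add[OF c(1) d(1)] z(2)] even_center_diff[OF d(1) c(1)] by blast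
  qed
  have a1: "\<exists>z\<in>even_center - {0}. \<exists>c\<in>even_center. \<exists>d\<in>even_center. z * a = c * (u + v) + d * (u - v)"
    if a: "a \<in> A 1" for a
  proof -
    obtain c where c: "c \<in> even_center" "z * (u * (v * a * v) * u) = c * u"
      using odd[of "v * a * v"] v(1) a by (auto simp: A_intros)
    obtain d where d: "d \<in> even_center" "z * (u * a * u) = d * u"
      using odd[OF a] by auto
    have e: "u * v * a * u * v = 0"
    proof -
      have "u * (v * a) * u * v = 0" using even[of "v * a"] v(1) a by (simp add: A_intros)
      then show ?thesis by (simp only: mult.assoc)
    qed
    have e': "v * u * a * v * u = 0"
    proof -
      have "v * (u * (a * v) * u) = 0" using even[of "a * v"] v(1) a by (simp add: A_intros)
      then show ?thesis by (simp only: mult.assoc)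
    qed
    have vuv: "v * u * v = z * v" unfolding vu using v(2) by (simp add: left_diff_distrib mult.assoc)
    define f where "f = d * z"
    have f: "f \<in> even_center" unfolding f_def by (rule even_center_mult[OF d(1) z(2)])
    have "z * (z * (z * a)) = z * (u * (v * a * v) * u) + v * (z * (u * a * u)) * v"
      unfolding expand e e' by (simp add: distrib_left mult.assoc lcomm)
    also have "\<dots> = c * u + d * (v * u * v)"
      unfolding c d by (simp add: mult.assoc even_center_left_commute[OF d(1), of v])
    also have "\<dots> = c * u + f * v" unfolding vuv f_def by (simp add: mult.assoc)
    finally have "t * a = c * u + f * v + (c * u + f * v)"
      by (simp add: t_def distrib_right mult.assoc)
    also have "\<dots> = (c + f) * (u + v) + (c - f) * (u - v)"
      by (simp add: algebra_simps)
    finally show ?thesis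
      using t even_center_add[OF c(1) f] even_center_diff[OF c(1) f] by blast
  qed
  have "- z \<in> even_center" "- z \<noteq> 0" using even_center_neg[OF z(2)] z(3) by simp_all
  moreover have "(u + v) * (u - v) + (u - v) * (u + v) = 0"
    using u(2) v(2) by (simp add: algebra_simps)
  ultimately show ?thesis
    unfolding clifford_frame_def uuvv(1,2) using u(1) v(1) z a0 a1 by (simp add: A_intros)
qed

text \<open>For even \<open>b\<close> the commutator of \<open>t\<close> and \<open>b\<close> kills
  every odd element, since \<open>t\<close> anticommutes with both \<open>a\<close> and
  \<open>b a\<close>; a nonzero odd \<open>y\<close> then forces it to vanish. So \<open>t\<close>
  commutes or anticommutes with every homogeneous \<open>i\<close>, and \<open>t i t = 0\<close> by
  \<open>t t = 0\<close>.\<close>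

lemma anticommuting_odd_zero:
  assumes t: "t \<in> A 1" "t * t = 0" and anti: "\<And>a. a \<in> A 1 \<Longrightarrow> t * a + a * t = 0"
  shows "t = 0"
proof -
  have ta: "t * a = - (a * t)" if "a \<in> A 1" for a
    using anti[OF that] by (simp add: eq_neg_iff_add_eq_0)
  obtain y where y: "y \<in> A 1" "y \<noteq> 0" using nontriv A_zero[of 1] unfolding nontrivial_def by auto
  have tb: "t * b = b * t" if b: "b \<in> A 0" for b
  proof -
    let ?c = "t * b - b * t"
    have c: "?c \<in> A 1" using t(1) b by (simp add: A_intros)
    have c1: "?c * a = 0" if a: "a \<in> A 1" for a
      using ta[OF A_mult_even_odd[OF b a]] ta[OF a] by (simp add: algebra_simps)
    have "?c * i * y = 0" if "i \<in> A s" for i s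
    proof (cases "s = 0")
      case True
      then show ?thesis using c1[of "i * y"] that y by (simp only: mult.assoc A_mult_even_odd)
    next
      case False
      then show ?thesis using c1[of i] that by (cases s) simp_all
    qed
    then have "?c = 0 \<or> y = 0" by (rule sandwich_zero[OF graded_ideal_UNIV UNIV_nonzero c y(1)])
    then show ?thesis using y(2) by simp
  qed
  have "t * i * t = 0" if "i \<in> A s" for i s
  proof (cases "s = 0")
    case True
    then show ?thesis using tb[of i] that t(2) by (simp add: mult.assoc)
  next
    case False
    then have "i \<in> A 1" using that by (cases s) simp_all
    then show ?thesis using ta[of i] t(2) by (simp add: mult.assoc)
  qed
  then have "t = 0 \<or> t = 0" by (rule sandwich_zero[OF graded_ideal_UNIV UNIV_nonzero t(1) t(1)])
  then show ?thesis by simp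
qed

text \<open>An even \<open>t\<close> in \<open>L\<close> satisfies \<open>[t, [t, a]] = 0\<close>,
  and the product rule makes it central. A nonzero odd \<open>t\<close> in \<open>L\<close> squares
  to zero and has central brackets with odd elements, not all zero by
  \<open>anticommuting_odd_zero\<close>; thus it has a hyperbolic partner.\<close>

lemma abelian_lie_ideal:
  assumes L: "lie_ideal L"
    and abel: "\<And>l k i j. l \<in> L \<Longrightarrow> k \<in> L \<Longrightarrow> l \<in> A i \<Longrightarrow> k \<in> A j \<Longrightarrow> superbracket l k = 0"
  shows "L \<subseteq> even_center \<or> (\<exists>u x. clifford_frame 2 u x)"
proof -
  have even: "t \<in> even_center" if t: "t \<in> L" "t \<in> A 0" for t
  proof (rule even_centerI_hom[OF t(2)])
    have sq: "ad t (ad t a) = 0" if a: "a \<in> A i" for a i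
      using abel[OF t(1) lie_ideal_bracket[OF L t(1), of a] t(2) A_bracket[OF t(2) a]]
      by (simp add: bracket_even_left[OF t(2)] ad_def)
    have prod: "ad t a * ad t b = 0" if "a \<in> A i" "b \<in> A j" for a b i j
    proof (rule double_zero)
      show "ad t a * ad t b + ad t a * ad t b = 0"
        using sq[OF A_mult[OF that]] sq[OF that(1)] sq[OF that(2)] by (simp add: ad_mult ad_add)
    qed
    have zero: "ad t a = 0" if a: "a \<in> A i" for a i
    proof -
      have h: "ad t a \<in> A i"
        unfolding ad_def using A_mult[OF t(2) a] A_mult[OF a t(2)] by (cases i) (simp_all add: A_diff)
      have "ad t a * c * ad t a = 0" if c: "c \<in> A s" for c s
      proof -
        have "ad t a * ad t (c * a) = ad t a * ad t c * a + ad t a * c * ad t a"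
          by (simp add: ad_mult algebra_simps)
        then show ?thesis using prod[OF a A_mult[OF c a]] prod[OF a c] by simp
      qed
      then have "ad t a = 0 \<or> ad t a = 0"
        by (rule sandwich_zero[OF graded_ideal_UNIV UNIV_nonzero h h])
      then show ?thesis by simp
    qed
    show "t * a = a * t" if "a \<in> A 0" for a using zero[OF that] by (simp add: ad_def)
    show "t * a = a * t" if "a \<in> A 1" for a using zero[OF that] by (simp add: ad_def)
  qed
  show ?thesis
  proof (cases "\<forall>t\<in>L. t \<in> A 1 \<longrightarrow> t = 0")
    case True
    have "l \<in> even_center" if l: "l \<in> L" for l
    proof -
      note lp = graded_submodule_part[OF lie_ideal_submodule[OF L] l]
      have "part 1 l = 0" using True lp part_in by blast
      then have "part 0 l = l" using part_add_eq[of l] by simp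
      then show ?thesis using even[OF lp[of 0] part_in] by simp
    qed
    then show ?thesis by blast
  next
    case False
    then obtain t where t: "t \<in> L" "t \<in> A 1" "t \<noteq> 0" by blast
    have "t * t + t * t = 0" using abel[OF t(1,1,2,2)] by (simp add: bracket_odd t)
    then have tt: "t * t = 0" by (rule double_zero)
    have anti: "t * a + a * t \<in> even_center" if "a \<in> A 1" for a
      using even[OF lie_ideal_bracket[OF L t(1), of a]] that t(2) by (simp add: bracket_odd A_intros)
    obtain a where a: "a \<in> A 1" "t * a + a * t \<noteq> 0"
      using anticommuting_odd_zero[OF t(2) tt] t(3) by blast
    define z where "z = t * a + a * t"
    have z: "z \<in> even_center" "z \<noteq> 0" using a anti z_def by simp_all
    note p = hyperbolic_partner[OF t(2) tt a(1) z_def[symmetric] z(1)]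
    have zz: "z * z \<in> even_center" "z * z \<noteq> 0"
      using z even_center_mult even_center_mult_nonzero by blast+
    have "clifford_frame 2 (t + a * t * a) (t - a * t * a)"
    proof (rule hyperbolic_frame[OF t(2) tt p(1,2,3) zz])
      fix b assume b: "b \<in> A 0"
      \<comment> \<open>The bracket of \<open>t\<close> with the odd element \<open>b t\<close> is
        \<open>t b t\<close>, a central element whose square contains \<open>t t\<close>.\<close>
      have "t * (b * t) + b * t * t \<in> even_center"
        using b t(2) by (intro anti) (simp add: A_intros)
      then have c: "t * b * t \<in> even_center" using tt by (simp add: mult.assoc)
      have "t * b * (t * t) * b * t = 0" using tt by simp
      then have "t * b * t * (t * b * t) = 0" by (simp only: mult.assoc)
      then show "t * b * t = 0" using even_center_mult_nonzero[OF c c] by blast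
    next
      fix b assume b: "b \<in> A 1"
      have "t * b * t = (t * b + b * t) * t" using tt by (simp add: distrib_right mult.assoc)
      then have "z * z * (t * b * t) = (z * z * (t * b + b * t)) * t" by (simp add: mult.assoc)
      then show "\<exists>c\<in>even_center. z * z * (t * b * t) = c * t"
        using even_center_mult[OF zz(1) anti[OF b]] by blast
    qed
    then show ?thesis by blast
  qed
qed

end


section \<open>Odd elements of a non-dense invariant subalgebra\<close>

context nondense_invariant
begin

text \<open>An odd element of \<open>M\<close> becomes even on multiplication by \<open>u\<close>
  and stays nonzero because \<open>u u\<close> is regular.\<close>

lemma exists_even_in_M:
  assumes u: "u \<in> A 1" and nz: "u * u \<in> even_center" "u * u \<noteq> 0"
  obtains m where "m \<in> M" "m \<in> A 0" "m \<noteq> 0"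
proof -
  obtain x where x: "x \<in> M" "x \<noteq> 0" using M subspace_0[OF M_sub'] by blast
  show thesis
  proof (cases "part 0 x = 0")
    case True
    then have p: "part 1 x \<noteq> 0" using part_add_eq[of x] x(2) by auto
    have "u * u * part 1 x \<noteq> 0" using even_center_mult_zero[OF nz] p by blast
    then have "u * part 1 x \<noteq> 0" by (simp add: mult.assoc) (metis mult_zero_right)
    then show thesis using that[of "u * part 1 x"] M_multL[OF M_part[OF x(1)]] u by (simp add: A_intros)
  next
    case False
    then show thesis using that[of "part 0 x"] M_part[OF x(1)] by simp
  qed
qed

lemma bracket_M_even_odd:
  assumes "m \<in> M" "m \<in> A 0"
  shows "m * a - a * m \<in> L"
  using bracket_M[OF assms(1), of a] bracket_even_left[OF assms(2)] by simp

lemma odd_bracket_L_odd: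
  assumes u: "u \<in> W" "u \<in> A 1" and l: "l \<in> L" "l \<in> A 1"
  shows "u * l + l * u \<in> even_center"
proof (rule W_even_central)
  show "u * l + l * u \<in> W" using WL[OF u(1) l(1)] by (simp add: bracket_odd u l)
qed (use u l in \<open>simp add: A_intros\<close>)

lemma odd_commutator_L_even:
  assumes u: "u \<in> W" "u \<in> A 1" and l: "l \<in> L" "l \<in> A 0"
  shows "u * l - l * u \<in> W" "u * l - l * u \<in> A 1"
  using WL[OF u(1) l(1)] u l by (simp_all add: bracket_even_right A_intros)

lemma W_odd_mult:
  assumes "u \<in> W" "u \<in> A 1" "v \<in> W" "v \<in> A 1"
  shows "u * v \<in> even_center"
  by (rule W_even_central) (use assms in \<open>simp_all add: A_intros W_mult\<close>)

text \<open>Up to the factor \<open>2 z\<close>, an odd element of \<open>M\<close> is a central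
  multiple of \<open>u\<close> plus an element of \<open>N\<close>, the elements anticommuting with
  \<open>u\<close>. Products of two elements of \<open>N\<close> commute with \<open>u\<close> and
  hence are central, so once some \<open>x\<close> in \<open>N\<close> has nonzero square,
  \<open>N\<close> is spanned by \<open>x\<close> up to denominators.\<close>

lemma regular_odd_frame:
  assumes u: "u \<in> W" "u \<in> A 1" and nz: "u * u \<noteq> 0"
  shows "\<exists>n x. clifford_frame n u x"
proof -
  define z where "z = u * u"
  have z: "z \<in> even_center" "z \<noteq> 0" using W_odd_mult[OF u u] nz by (simp_all add: z_def)
  have uu: "u * u = z" and uu': "u * (u * a) = z * a" for a
    by (simp_all add: z_def mult.assoc)
  note comm = even_center_commute[OF z(1)] and cancel = even_center_cancel[OF z]
  have az: "a * z = z * a" for a by (simp add: comm)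
  have uz: "u * (z * a) = z * (u * a)" for a by (rule even_center_left_commute[OF z(1)])
  \<comment> \<open>The commutator \<open>?v\<close> of \<open>u\<close> and \<open>l\<close>
    anticommutes with \<open>u\<close> because \<open>u u\<close> is central, while
    \<open>u ?v\<close> is central as a product of odd elements of \<open>W\<close>. Comparing gives
    \<open>2 z ?v = 0\<close>.\<close>
  have commL: "u * l = l * u" if l: "l \<in> L" "l \<in> A 0" for l
  proof -
    let ?v = "u * l - l * u"
    have "u * ?v \<in> even_center" by (rule W_odd_mult[OF u odd_commutator_L_even[OF u l]])
    then have "u * ?v * u = u * (u * ?v)" by (rule even_center_commute)
    then have "z * ?v + z * ?v = 0"
      using comm[of l] by (simp add: uu' algebra_simps) (metis uu uu' az mult.assoc add_diff_cancel diff_self)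
    then have "z * ?v = 0" by (rule double_zero)
    then have "?v = 0" by (rule even_center_mult_zero[OF z])
    then show ?thesis by simp
  qed
  have central: "n \<in> even_center" if n: "n \<in> M" "n \<in> A 0" "u * n = n * u" for n
  proof -
    have g: "u * (a * n - n * a) = (a * n - n * a) * u" "u * (a * n - n * a) \<in> even_center"
      if a: "a \<in> A 1" for a
    proof -
      let ?g = "a * n - n * a"
      have nu: "n * u \<in> M" "n * u \<in> A 1" using n u by (simp_all add: M_multR A_intros)
      have "n * u * a + a * (n * u) \<in> L" by (rule bracket_M_odd[OF nu a])
      then have k: "u * (n * u * a + a * (n * u)) = (n * u * a + a * (n * u)) * u"
        using nu a by (intro commL) (simp_all add: A_intros)
      have h: "u * (n * (u * a + a * u)) = n * (u * a + a * u) * u"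
      proof -
        have "u * (n * (u * a + a * u)) = n * (u * (u * a + a * u))"
          using n(3) by (simp flip: mult.assoc)
        also have "u * (u * a + a * u) = (u * a + a * u) * u"
          using az[of a] by (simp add: distrib_left distrib_right uu' mult.assoc uu)
        finally show ?thesis by (simp add: mult.assoc)
      qed
      \<comment> \<open>Both terms on the right commute with \<open>u\<close>: the first is an even
        element of \<open>L\<close>, the second is \<open>h\<close>. So \<open>u\<close> commutes
        with \<open>?g u\<close>, and cancelling \<open>z\<close> gives the same for
        \<open>?g\<close>.\<close>
      have gu: "?g * u = (n * u * a + a * (n * u)) - n * (u * a + a * u)"
        by (simp add: algebra_simps)
      have "u * (?g * u) = ?g * u * u" unfolding gu by (simp only: right_diff_distrib left_diff_distrib k h)
      then have "u * (u * (?g * u)) = u * (?g * z)" by (simp add: mult.assoc uu)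
      then have "z * (?g * u) = z * (u * ?g)" by (simp only: uu' az uz)
      then have eq: "?g * u = u * ?g" by (rule cancel)
      then show "u * ?g = ?g * u" by simp
      have "n * a - a * n \<in> L" by (rule bracket_M_even_odd[OF n(1,2)])
      then have "?g \<in> L" using subspace_neg[OF L_sub] by fastforce
      then have "u * ?g + ?g * u \<in> even_center"
        using a n by (intro odd_bracket_L_odd[OF u]) (simp_all add: A_intros)
      then have "u * ?g + u * ?g \<in> even_center" using eq by simp
      then show "u * ?g \<in> even_center" by (rule even_center_halve)
    qed
    \<comment> \<open>Apply \<open>g\<close> to the odd element \<open>u b\<close>; the factor
      \<open>u u = z\<close> brings it back to \<open>b\<close>.\<close>
    have d: "z * (b * n - n * b) \<in> even_center" if b: "b \<in> A 0" for b
    proof -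
      have "u * (u * b * n - n * (u * b)) \<in> even_center"
        using b u by (intro g) (simp add: A_intros)
      moreover have "n * (u * b) = u * (n * b)" using n(3) by (simp flip: mult.assoc)
      ultimately show ?thesis
        by (simp add: mult.assoc right_diff_distrib uu')
    qed
    have even: "b * n = n * b" if b: "b \<in> A 0" for b
    proof (rule ccontr)
      assume ne: "b * n \<noteq> n * b"
      let ?e = "z * (b * n - n * b)"
      have e: "?e \<in> even_center" "?e \<noteq> 0"
        using d[OF b] even_center_mult_zero[OF z, of "b * n - n * b"] ne by auto
      \<comment> \<open>Replacing \<open>b\<close> by \<open>n b\<close> multiplies the commutator
        by \<open>n\<close>. Thus \<open>n\<close> times the nonzero central \<open>?e\<close> is
        central, and so is \<open>n\<close>.\<close>
      have "z * (n * b * n - n * (n * b)) \<in> even_center"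
        using b n(2) by (intro d) (simp add: A_intros)
      also have "z * (n * b * n - n * (n * b)) = n * ?e"
        using even_center_left_commute[OF z(1), of n] by (simp add: right_diff_distrib mult.assoc)
      finally have "?e * n \<in> even_center" by (simp only: even_center_commute[OF e(1), of n])
      then have "n \<in> even_center" by (rule even_center_of_multiple[OF e _ n(2)])
      then show False using ne even_center_commute by metis
    qed
    have odd: "a * n = n * a" if a: "a \<in> A 1" for a
    proof -
      have "u * a * n = n * (u * a)" using u(2) a by (intro even) (simp add: A_intros)
      also have "\<dots> = u * (n * a)" using n(3) by (simp flip: mult.assoc)
      finally have "z * (a * n) = z * (n * a)" by (metis uu' mult.assoc)
      then show ?thesis by (rule cancel)
    qed
    show ?thesis by (rule even_centerI_hom[OF n(2)]) (use even odd in auto)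
  qed
  have anti_central: "u * m + m * u \<in> even_center" if m: "m \<in> M" "m \<in> A 1" for m
  proof -
    have "z * (u * m + m * u) \<in> even_center"
    proof (rule central)
      show "u * (z * (u * m + m * u)) = z * (u * m + m * u) * u"
        using az[of m] by (simp add: distrib_left distrib_right uz uu uu' mult.assoc)
    qed (use m u z in \<open>simp_all add: distrib_left subspace_add[OF M_sub'] M_multL M_multR A_intros
        even_center_even\<close>)
    then show ?thesis
      by (rule even_center_of_multiple[OF z]) (use m u in \<open>simp add: A_intros\<close>)
  qed
  define N where "N = {x \<in> M \<inter> A 1. u * x = - (x * u)}"
  have N_mult: "x * y \<in> even_center" if x: "x \<in> N" and y: "y \<in> N" for x y
  proof (rule central)
    have "u * (x * y) = - (x * (u * y))" using x by (simp add: N_def flip: mult.assoc)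
    also have "\<dots> = x * y * u" using y by (simp add: N_def mult.assoc)
    finally show "u * (x * y) = x * y * u" .
  qed (use x y in \<open>simp_all add: N_def M_multL A_intros\<close>)
  \<comment> \<open>An average of \<open>m\<close> and its conjugate by \<open>u\<close>, with
    \<open>z\<close> in place of the inverse of \<open>u\<close>: the two sides
    \<open>z m - u m u\<close> and \<open>z m + u m u\<close> anticommute and commute with
    \<open>u\<close>, and the latter is the central element \<open>u m + m u\<close> times
    \<open>u\<close>.\<close>
  have decomp: "\<exists>c\<in>even_center. \<exists>y\<in>N. z * m + z * m = c * u + y" if m: "m \<in> M" "m \<in> A 1" for m
  proof (intro bexI)
    show "u * m + m * u \<in> even_center" by (rule anti_central[OF m])
    have "u * (z * m - u * m * u) = - ((z * m - u * m * u) * u)"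
      using az[of m] by (simp add: right_diff_distrib left_diff_distrib uz uu uu' mult.assoc)
    then show "z * m - u * m * u \<in> N"
      using m u z by (simp add: N_def subspace_diff[OF M_sub'] M_multL M_multR A_intros
          even_center_even)
    show "z * m + z * m = (u * m + m * u) * u + (z * m - u * m * u)"
      using az[of m] by (simp add: distrib_right uu mult.assoc)
  qed
  obtain m0 where m0: "m0 \<in> M" "m0 \<in> A 0" "m0 \<noteq> 0"
    using exists_even_in_M[OF u(2)] z uu by metis
  define zz where "zz = z + z"
  have zz: "zz \<in> even_center" "zz \<noteq> 0"
    using even_center_add[OF z(1) z(1)] double_zero[of z] z(2) by (auto simp: zz_def)
  have zza: "zz * a = z * a + z * a" for a by (simp add: zz_def distrib_right)
  show ?thesis
  proof (cases "N \<subseteq> {0}")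
    case True
    have M1: "\<exists>c\<in>even_center. zz * m = c * u" if m: "m \<in> M" "m \<in> A 1" for m
      using decomp[OF m] True zza by (metis add.right_neutral singletonD subsetD)
    have M0: "zz * m \<in> even_center" if m: "m \<in> M" "m \<in> A 0" for m
    proof -
      obtain c where c: "c \<in> even_center" "zz * (u * m) = c * u"
        using M1[of "u * m"] m u by (auto simp: M_multL A_intros)
      have "z * (zz * m) = u * (zz * (u * m))"
        by (simp add: uu' even_center_left_commute[OF zz(1), of u] even_center_left_commute[OF z(1), of zz])
      also have "\<dots> = z * c"
        using c by (simp add: even_center_left_commute[OF c(1), of u] uu az[of c])
      finally show ?thesis using c(1) cancel by metis
    qed
    \<comment> \<open>A nonzero central element inside \<open>M\<close>: multiplying by it moves any
      \<open>a\<close> into \<open>M\<close>, where coefficients are available.\<close>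
    define y where "y = zz * m0"
    have y: "y \<in> even_center" "y \<noteq> 0" "y \<in> M"
      using M0[OF m0(1,2)] even_center_mult_zero[OF zz] m0 by (auto simp: y_def M_multL)
    have zy: "zz * y \<in> even_center - {0}"
      using zz y even_center_mult even_center_mult_nonzero by simp
    have "\<exists>w\<in>even_center - {0}. \<exists>c\<in>even_center. \<exists>d\<in>even_center. w * a = c + d * (u * 0)"
      if a: "a \<in> A 0" for a
    proof (intro bexI[OF _ zy] bexI)
      show "zz * y * a = zz * (y * a) + 0 * (u * 0)" by (simp add: mult.assoc)
      show "zz * (y * a) \<in> even_center"
        using y a by (intro M0) (simp_all add: M_multR A_intros even_center_even)
    qed (rule even_center_0)
    moreover have "\<exists>w\<in>even_center - {0}. \<exists>c\<in>even_center. \<exists>d\<in>even_center. w * a = c * u + d * 0"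
      if a: "a \<in> A 1" for a
    proof -
      obtain c where "c \<in> even_center" "zz * (y * a) = c * u"
        using M1[of "y * a"] y a by (auto simp: M_multR A_intros even_center_even)
      then have "zz * y * a = c * u + 0 * 0" by (simp add: mult.assoc)
      then show ?thesis using zy \<open>c \<in> even_center\<close> even_center_0 by blast
    qed
    ultimately have "clifford_frame 1 u 0"
      unfolding clifford_frame_def using u(2) z by (simp add: uu even_center_0)
    then show ?thesis by blast
  next
    case False
    have "\<exists>x\<in>N. x * x \<noteq> 0"
    proof (rule ccontr)
      assume "\<not> ?thesis"
      then have sq: "x * x = 0" if "x \<in> N" for x using that by blast
      obtain x where x: "x \<in> N" "x \<noteq> 0" using False by blast
      then have x1: "x \<in> A 1" and ux: "u * x = - (x * u)" by (simp_all add: N_def)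
      have odd: "x * m * x = 0" if m: "m \<in> M" "m \<in> A 1" for m
      proof -
        obtain c y where cy: "c \<in> even_center" "y \<in> N" "z * m + z * m = c * u + y"
          using decomp[OF m] by blast
        \<comment> \<open>Polarization: if all squares in \<open>N\<close> vanish, its elements
          anticommute and \<open>x y x = 0\<close>. Together with \<open>x u x = 0\<close>,
          \<open>decomp\<close> yields \<open>x m x = 0\<close> for all odd \<open>m\<close> in
          \<open>M\<close>.\<close>
        have "x + y \<in> N" using x(1) cy(2) by (simp add: N_def subspace_add[OF M_sub'] A_intros algebra_simps)
        then have "(x + y) * (x + y) = 0" by (rule sq)
        then have "x * y = - (y * x)"
          using sq[OF x(1)] sq[OF cy(2)] by (simp add: algebra_simps eq_neg_iff_add_eq_0)
        then have xyx: "x * y * x = 0" using sq[OF x(1)] by (simp add: mult.assoc)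
        have "x * u = - (u * x)" using ux by simp
        then have xux: "x * u * x = 0" using sq[OF x(1)] by (simp add: mult.assoc)
        have "x * (z * m + z * m) * x = c * (x * u * x) + x * y * x"
          unfolding cy(3) by (simp add: algebra_simps even_center_left_commute[OF cy(1), of x])
        then have "z * (x * m * x) + z * (x * m * x) = 0"
          using xux xyx even_center_left_commute[OF z(1), of x] by (simp add: algebra_simps)
        then have "z * (x * m * x) = 0" by (rule double_zero)
        then show ?thesis by (rule even_center_mult_zero[OF z])
      qed
      have "x * m * x = 0" if m: "m \<in> M" "m \<in> A s" for m s
      proof (cases "s = 0")
        case True
        have "x * (u * m) * x = 0" using m True u(2) by (intro odd) (simp_all add: M_multL A_intros)
        then have "u * (x * u * m * x) = 0" by (simp add: mult.assoc)
        moreover have "x * u = - (u * x)" using ux by simp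
        ultimately have "z * (x * m * x) = 0" by (simp add: mult.assoc uu')
        then show ?thesis by (rule even_center_mult_zero[OF z])
      next
        case False
        then show ?thesis using odd[OF m(1)] m(2) by (cases s) simp_all
      qed
      then have "x = 0 \<or> x = 0" by (rule sandwich_zero[OF M x1 x1])
      then show False using x(2) by simp
    qed
    then obtain x where x: "x \<in> N" "x * x \<noteq> 0" by blast
    then have x1: "x \<in> A 1" "x \<in> M" and ux: "u * x = - (x * u)" by (simp_all add: N_def)
    \<comment> \<open>Again a nonzero central element of \<open>M\<close>, now also the square of
      the second frame vector.\<close>
    define y where "y = x * x"
    have y: "y \<in> even_center" "y \<noteq> 0" "y \<in> M"
      using N_mult[OF x(1) x(1)] x x1 by (auto simp: y_def M_multL)
    define w where "w = y * zz"
    have w: "w \<in> even_center" "w \<noteq> 0"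
      unfolding w_def using zz y even_center_mult even_center_mult_nonzero by blast+
    have M1: "\<exists>c\<in>even_center. \<exists>d\<in>even_center. w * m = c * u + d * x" if m: "m \<in> M" "m \<in> A 1" for m
    proof -
      obtain c v where cv: "c \<in> even_center" "v \<in> N" "z * m + z * m = c * u + v"
        using decomp[OF m] by blast
      have d: "x * v \<in> even_center" by (rule N_mult[OF x(1) cv(2)])
      have "w * m = y * (c * u) + y * v" by (simp add: w_def mult.assoc zza cv(3) distrib_left)
      \<comment> \<open>As \<open>x v\<close> is central, \<open>x x v = (x v) x\<close>; so
        \<open>x v\<close> is the coefficient of \<open>y v\<close> along \<open>x\<close>.\<close>
      also have "y * v = x * v * x"
        using even_center_commute[OF d, of x] by (simp add: y_def mult.assoc)
      finally have "w * m = y * c * u + x * v * x" by (simp add: mult.assoc)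
      then show ?thesis using even_center_mult[OF y(1) cv(1)] d by blast
    qed
    have M0: "\<exists>c\<in>even_center. \<exists>d\<in>even_center. z * w * m = c + d * (u * x)" if m: "m \<in> M" "m \<in> A 0" for m
    proof -
      obtain c d where cd: "c \<in> even_center" "d \<in> even_center" "w * (u * m) = c * u + d * x"
        using M1[of "u * m"] m u by (auto simp: M_multL A_intros)
      have "z * w * m = w * (u * (u * m))"
        by (simp add: uu' mult.assoc even_center_left_commute[OF w(1), of z])
      also have "\<dots> = u * (w * (u * m))" by (simp add: even_center_left_commute[OF w(1), of u])
      also have "\<dots> = z * c + d * (u * x)"
        unfolding cd(3) using even_center_left_commute[OF cd(1), of u] even_center_left_commute[OF cd(2), of u] az[of c]
        by (simp add: distrib_left uu)
      finally show ?thesis using even_center_mult[OF z(1) cd(1)] cd(2) by blast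
    qed
    have nz: "z * w * y \<in> even_center - {0}" "w * y \<in> even_center - {0}"
      using z w y even_center_mult even_center_mult_nonzero by simp_all
    have "\<exists>w\<in>even_center - {0}. \<exists>c\<in>even_center. \<exists>d\<in>even_center. w * a = c + d * (u * x)"
      if a: "a \<in> A 0" for a
    proof -
      have "\<exists>c\<in>even_center. \<exists>d\<in>even_center. z * w * (y * a) = c + d * (u * x)"
        using y a by (intro M0) (simp_all add: M_multR A_intros even_center_even)
      then show ?thesis using nz(1) by (metis mult.assoc)
    qed
    moreover have "\<exists>w\<in>even_center - {0}. \<exists>c\<in>even_center. \<exists>d\<in>even_center. w * a = c * u + d * x"
      if a: "a \<in> A 1" for a
    proof -
      have "\<exists>c\<in>even_center. \<exists>d\<in>even_center. w * (y * a) = c * u + d * x"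
        using y a by (intro M1) (simp_all add: M_multR A_intros even_center_even)
      then show ?thesis using nz(2) by (metis mult.assoc)
    qed
    ultimately have "clifford_frame 2 u x"
      unfolding clifford_frame_def using u(2) z x1 ux y uu by (simp add: y_def)
    then show ?thesis by blast
  qed
qed

text \<open>Polarizing \<open>v v = 0\<close> on the odd part of \<open>W\<close> gives
  \<open>u l u = 0\<close> for even \<open>l\<close> in \<open>L\<close>, while \<open>u l u\<close>
  is a central multiple of \<open>u\<close> for odd \<open>l\<close> in \<open>L\<close>. These are
  the hypotheses of \<open>hyperbolic_frame\<close> for \<open>L\<close> only; a partner
  \<open>v\<close> chosen in \<open>M\<close> transfers them to all of \<open>A\<close>.\<close>

lemma nilpotent_odd_frame:
  assumes sq: "\<And>v. v \<in> W \<Longrightarrow> v \<in> A 1 \<Longrightarrow> v * v = 0"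
    and u: "u \<in> W" "u \<in> A 1" "u \<noteq> 0"
  shows "\<exists>v x. clifford_frame 2 v x"
proof -
  have uu: "u * u = 0" by (rule sq[OF u(1,2)])
  then have uu': "u * (u * a) = 0" for a by (simp flip: mult.assoc)
  \<comment> \<open>\<open>u v\<close> is central, and polarization makes \<open>u\<close> and
    \<open>v\<close> anticommute, so the square of \<open>u v\<close> contains
    \<open>u u = 0\<close>.\<close>
  have uv: "u * v = 0" if v: "v \<in> W" "v \<in> A 1" for v
  proof -
    have c: "u * v \<in> even_center" by (rule W_odd_mult[OF u(1,2) v])
    have "(u + v) * (u + v) = 0" using u v by (intro sq) (simp_all add: W_add A_intros)
    then have "u * v = - (v * u)" using uu sq[OF v] by (simp add: algebra_simps eq_neg_iff_add_eq_0)
    then have "u * v * (u * v) = - (v * (u * (u * v)))" by (simp add: mult.assoc)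
    then have "u * v * (u * v) = 0" using uu' by simp
    then show ?thesis using even_center_mult_nonzero[OF c c] by blast
  qed
  have even: "u * l * u = 0" if l: "l \<in> L" "l \<in> A 0" for l
  proof -
    have "u * (u * l - l * u) = 0" by (rule uv[OF odd_commutator_L_even[OF u(1,2) l]])
    then show ?thesis by (simp add: right_diff_distrib uu' mult.assoc)
  qed
  have odd: "u * l * u = (u * l + l * u) * u" for l
    using uu by (simp add: distrib_right mult.assoc)
  have "\<exists>l\<in>L \<inter> M \<inter> A 1. u * l + l * u \<noteq> 0"
  proof (rule ccontr)
    assume "\<not> ?thesis"
    then have anti: "u * l + l * u = 0" if "l \<in> L" "l \<in> M" "l \<in> A 1" for l using that by blast
    have ulu: "u * l * u = 0" if l: "l \<in> L" "l \<in> M" "l \<in> A i" for l i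
      using even[of l] anti[of l] odd[of l] l by (cases i) auto
    \<comment> \<open>Insert \<open>l = [m, b u]\<close> into \<open>u l u = 0\<close>; the term
      ending in \<open>u u\<close> drops out.\<close>
    have ubumu: "u * b * u * m * u = 0" if b: "b \<in> A i" and m: "m \<in> M" "m \<in> A j" for b m i j
    proof -
      have bu: "b * u \<in> A (i + 1)" by (rule A_mult[OF b u(2)])
      have "superbracket m (b * u) \<in> M"
        unfolding bracket_hom[OF m(2) bu] using m(1)
        by (intro subspace_diff[OF M_sub'] subspace_koszul[OF M_sub'] M_multL M_multR)
      then have "u * superbracket m (b * u) * u = 0"
        by (rule ulu[OF bracket_M[OF m(1)] _ A_bracket[OF m(2) bu]])
      then show ?thesis
        unfolding bracket_hom[OF m(2) bu] by (simp add: koszul_def algebra_simps uu uu' split: if_splits)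
    qed
    have "u * b * u = 0" if b: "b \<in> M" "b \<in> A i" for b i
    proof -
      have h: "u * b * u \<in> A (1 + i + 1)" by (intro A_mult u b)
      have "u * b * u * m * u = 0" if "m \<in> M" "m \<in> A j" for m j by (rule ubumu[OF b(2) that])
      then have "u * b * u = 0 \<or> u = 0" by (rule sandwich_zero[OF M h u(2)])
      then show ?thesis using u(3) by simp
    qed
    then have "u = 0 \<or> u = 0" by (rule sandwich_zero[OF M u(2,2)])
    then show False using u(3) by simp
  qed
  then obtain l where l: "l \<in> L" "l \<in> M" "l \<in> A 1" and nz: "u * l + l * u \<noteq> 0" by blast
  define z where "z = (u * l + l * u) * (u * l + l * u)"
  define v where "v = l * u * l"
  have c: "u * l + l * u \<in> even_center" by (rule odd_bracket_L_odd[OF u(1,2) l(1,3)])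
  then have z: "z \<in> even_center" "z \<noteq> 0"
    unfolding z_def using nz even_center_mult even_center_mult_nonzero by blast+
  have v: "v \<in> A 1" "v * v = 0" "u * v + v * u = z"
    using hyperbolic_partner[OF u(2) uu l(3) refl c] by (simp_all add: v_def z_def)
  have vM: "v \<in> M" using l(2) by (simp add: v_def M_multL)
  have uvu: "u * v * u = z * u" using odd[of v] v(3) by simp
  have "clifford_frame 2 (u + v) (u - v)"
  proof (rule hyperbolic_frame[OF u(2) uu v(1,2,3) z])
    \<comment> \<open>Since \<open>v v = 0\<close>, the element \<open>v a v\<close> is the bracket
      of \<open>v\<close> in \<open>M\<close> with \<open>v a\<close>, hence an element of
      \<open>L\<close>.\<close>
    have vav: "u * (v * a * v) * u = 0" if a: "a \<in> A 0" for a
    proof (rule even)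
      have va: "v * a \<in> A 1" using v(1) a by (simp add: A_intros)
      show "v * a * v \<in> L"
        using bracket_M_odd[OF vM v(1) va] v(2) by (simp flip: mult.assoc)
      show "v * a * v \<in> A 0" using v(1) a by (simp add: A_intros)
    qed
    fix a assume a: "a \<in> A 0"
    \<comment> \<open>With \<open>u a u\<close> in place of \<open>a\<close>, both copies of
      \<open>u v u\<close> become \<open>z u\<close>, leaving \<open>z z\<close> times
      \<open>u a u\<close>.\<close>
    have "u * (v * (u * a * u) * v) * u = 0" using a u(2) by (intro vav) (simp add: A_intros)
    then have "(u * v * u) * a * (u * v * u) = 0" by (simp only: mult.assoc)
    then have "z * z * (u * a * u) = 0"
      unfolding uvu using even_center_left_commute[OF z(1), of a] even_center_left_commute[OF z(1), of u]
      by (simp add: mult.assoc)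
    then show "u * a * u = 0"
      by (rule even_center_mult_zero[rotated 2])
         (use z even_center_mult even_center_mult_nonzero in blast)+
  next
    fix a assume a: "a \<in> A 1"
    \<comment> \<open>Chosen in \<open>L\<close> so that
      \<open>u ?k u = (u v u) a u = z (u a u)\<close>; the other term ends in
      \<open>u u\<close>.\<close>
    let ?k = "v * u * a - a * (v * u)"
    have vu: "v * u \<in> M" "v * u \<in> A 0" using vM v(1) u by (simp_all add: M_multR A_intros)
    have "?k \<in> L" by (rule bracket_M_even_odd[OF vu])
    then have d: "u * ?k + ?k * u \<in> even_center"
      using vu(2) a by (intro odd_bracket_L_odd[OF u(1,2)]) (simp_all add: A_intros)
    have "z * (u * a * u) = (u * v * u) * a * u" unfolding uvu by (simp add: mult.assoc)
    also have "\<dots> = u * ?k * u" using uu by (simp add: algebra_simps)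
    also have "\<dots> = (u * ?k + ?k * u) * u" by (rule odd)
    finally show "\<exists>c\<in>even_center. z * (u * a * u) = c * u" using d by blast
  qed
  then show ?thesis by blast
qed

lemma nondense_central_or_frame: "W \<subseteq> even_center \<or> (\<exists>n u x. clifford_frame n u x)"
proof (cases "\<forall>u\<in>W. u \<in> A 1 \<longrightarrow> u = 0")
  case True
  have "w \<in> even_center" if w: "w \<in> W" for w
  proof -
    have "part 1 w = 0" using True W_part[OF w] part_in by blast
    then have "part 0 w = w" using part_add_eq[of w] by simp
    then show ?thesis using W_even_central[OF W_part[OF w, of 0] part_in] by simp
  qed
  then show ?thesis by blast
next
  case False
  then obtain u where u: "u \<in> W" "u \<in> A 1" "u \<noteq> 0" by blast
  show ?thesis
  proof (cases "\<forall>v\<in>W. v \<in> A 1 \<longrightarrow> v * v = 0")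
    case True
    then show ?thesis using nilpotent_odd_frame[OF _ u] by blast
  next
    case False
    then show ?thesis using regular_odd_frame by blast
  qed
qed

end

section \<open>Centrality, density, or a Clifford frame\<close>

context prime_superalg
begin

lemma central_or_dense_or_frame:
  assumes W: "graded_subalgebra W" and L: "lie_ideal L" and WL: "bracket_span W L \<subseteq> W"
  shows "L \<subseteq> even_center \<or> W \<subseteq> even_center \<or> dense_in W \<or> (\<exists>n u x. clifford_frame n u x)"
proof (cases "\<forall>l k i j. l \<in> L \<longrightarrow> k \<in> L \<longrightarrow> l \<in> A i \<longrightarrow> k \<in> A j \<longrightarrow> superbracket l k = 0")
  case True
  then show ?thesis using abelian_lie_ideal[OF L] by blast
next
  case False
  then obtain l k i j where lk: "l \<in> L" "l \<in> A i" "k \<in> L" "k \<in> A j" "superbracket l k \<noteq> 0" by blast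
  have WL': "superbracket w l \<in> W" if "w \<in> W" "l \<in> L" for w l
  proof -
    have "superbracket w l \<in> bracket_span W L"
      unfolding bracket_span_def by (rule span_base) (use that in blast)
    then show ?thesis using WL by blast
  qed
  show ?thesis
  proof (rule lie_ideal_contains_ideal_brackets[OF L lk])
    fix M
    assume M: "graded_ideal M" "M \<noteq> {0}" "\<And>m a. m \<in> M \<Longrightarrow> superbracket m a \<in> L"
      "\<And>S. subspace S \<Longrightarrow> L \<subseteq> S \<Longrightarrow>
        (\<And>l k i j. l \<in> L \<Longrightarrow> k \<in> L \<Longrightarrow> l \<in> A i \<Longrightarrow> k \<in> A j \<Longrightarrow> l * k \<in> S) \<Longrightarrow> M \<subseteq> S"
    show ?thesis
    proof (cases "dense_in W")
      case False
      interpret nondense_invariant scale A L W M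
        by unfold_locales (fact L W WL' False M)+
      show ?thesis using nondense_central_or_frame by blast
    qed blast
  qed
qed

end


section \<open>The central localization\<close>

context prime_superalg
begin

abbreviation denominators :: "'a set" where
  "denominators \<equiv> even_center - {0}"

lemma denominators_mult: "z \<in> denominators \<Longrightarrow> w \<in> denominators \<Longrightarrow> z * w \<in> denominators"
  using even_center_mult even_center_mult_nonzero by simp

lemma denominatorsD: "z \<in> denominators \<Longrightarrow> z \<in> even_center" "z \<in> denominators \<Longrightarrow> z \<noteq> 0"
  by simp_all

lemma central_commute: "z \<in> even_center \<Longrightarrow> w \<in> even_center \<Longrightarrow> z * w = w * z"
  and central_left_commute: "z \<in> even_center \<Longrightarrow> w \<in> even_center \<Longrightarrow> z * (w * a) = w * (z * a)"
  by (rule even_center_commute, assumption) (metis even_center_commute mult.assoc)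

text \<open>Conditional AC rewriting: factors are interchanged only when both are known to be even
  central.\<close>

lemmas central_ac = mult.assoc central_commute central_left_commute

lemma frac_self: "z \<in> denominators \<Longrightarrow> (z, a) \<in> frac z a"
  by (simp add: frac_def)

lemma frac_subset:
  assumes z: "z \<in> denominators" and w: "w \<in> denominators" and e: "w * a = z * b"
  shows "frac z a \<subseteq> frac w b"
proof
  fix p assume "p \<in> frac z a"
  then obtain t c where p: "p = (t, c)" and t: "t \<in> denominators" and tc: "t * a = z * c"
    by (auto simp: frac_def)
  note Z = denominatorsD(1)[OF z] denominatorsD(1)[OF w] denominatorsD(1)[OF t]
  have "z * (t * b) = t * (z * b)" using Z by (simp add: central_ac)
  also have "\<dots> = w * (t * a)" unfolding e[symmetric] using Z by (simp add: central_ac)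
  also have "\<dots> = z * (w * c)" unfolding tc using Z by (simp add: central_ac)
  finally have "t * b = w * c" by (rule even_center_cancel[OF denominatorsD[OF z]])
  then show "p \<in> frac w b" using t by (simp add: p frac_def)
qed

lemma frac_eq_iff:
  assumes z: "z \<in> denominators" and w: "w \<in> denominators"
  shows "frac z a = frac w b \<longleftrightarrow> w * a = z * b"
proof
  assume "frac z a = frac w b"
  then have "(z, a) \<in> frac w b" using frac_self[OF z] by blast
  then show "w * a = z * b" by (simp add: frac_def)
next
  assume "w * a = z * b"
  then show "frac z a = frac w b"
    using frac_subset[OF z w, of a b] frac_subset[OF w z, of b a] by simp
qed

text \<open>The operations are unions over all representatives. So all pairs of representatives must
  give the same class, and one pair must exist for the union to be that class and not empty.\<close>

lemma frac_add_frac: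
  assumes z: "z \<in> denominators" and w: "w \<in> denominators"
  shows "frac_add (frac z a) (frac w b) = frac (z * w) (w * a + z * b)"
proof -
  have "frac (z' * w') (w' * a' + z' * b') = frac (z * w) (w * a + z * b)"
    if "(z', a') \<in> frac z a" "(w', b') \<in> frac w b" for z' a' w' b'
  proof -
    have z': "z' \<in> denominators" "z' * a = z * a'" and w': "w' \<in> denominators" "w' * b = w * b'"
      using that by (simp_all add: frac_def)
    note Z = denominatorsD(1)[OF z] denominatorsD(1)[OF w] denominatorsD(1)[OF z'(1)] denominatorsD(1)[OF w'(1)]
    have "z * w * (w' * a' + z' * b') = w * (w' * (z * a')) + z * (z' * (w * b'))"
      using Z by (simp add: distrib_left central_ac)
    also have "\<dots> = w * (w' * (z' * a)) + z * (z' * (w' * b))" using z' w' by simp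
    also have "\<dots> = z' * w' * (w * a + z * b)" using Z by (simp add: distrib_left central_ac)
    finally show ?thesis using frac_eq_iff[OF denominators_mult[OF z'(1) w'(1)] denominators_mult[OF z w]] by simp
  qed
  then have "frac_add (frac z a) (frac w b) \<subseteq> frac (z * w) (w * a + z * b)"
    unfolding frac_add_def by auto
  moreover have "frac (z * w) (w * a + z * b) \<subseteq> frac_add (frac z a) (frac w b)"
    unfolding frac_add_def using frac_self[OF z, of a] frac_self[OF w, of b] by fastforce
  ultimately show ?thesis by (rule subset_antisym)
qed

lemma frac_mult_frac:
  assumes z: "z \<in> denominators" and w: "w \<in> denominators"
  shows "frac_mult (frac z a) (frac w b) = frac (z * w) (a * b)"
proof -
  have "frac (z' * w') (a' * b') = frac (z * w) (a * b)"
    if "(z', a') \<in> frac z a" "(w', b') \<in> frac w b" for z' a' w' b'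
  proof -
    have z': "z' \<in> denominators" "z' * a = z * a'" and w': "w' \<in> denominators" "w' * b = w * b'"
      using that by (simp_all add: frac_def)
    note Z = denominatorsD(1)[OF z] denominatorsD(1)[OF w] denominatorsD(1)[OF z'(1)] denominatorsD(1)[OF w'(1)]
    have "z * w * (a' * b') = (z * a') * (w * b')"
      using even_center_left_commute[OF Z(2), of a'] by (simp add: mult.assoc)
    also have "\<dots> = (z' * a) * (w' * b)" using z' w' by simp
    also have "\<dots> = z' * w' * (a * b)"
      using even_center_left_commute[OF Z(4), of a] by (simp add: mult.assoc)
    finally show ?thesis using frac_eq_iff[OF denominators_mult[OF z'(1) w'(1)] denominators_mult[OF z w]] by simp
  qed
  then have "frac_mult (frac z a) (frac w b) \<subseteq> frac (z * w) (a * b)"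
    unfolding frac_mult_def by auto
  moreover have "frac (z * w) (a * b) \<subseteq> frac_mult (frac z a) (frac w b)"
    unfolding frac_mult_def using frac_self[OF z, of a] frac_self[OF w, of b] by fastforce
  ultimately show ?thesis by (rule subset_antisym)
qed

lemma frac_zero_eq:
  assumes z: "z \<in> denominators"
  shows "frac_zero = frac z 0"
proof -
  have "frac w 0 = frac z 0" if "w \<in> denominators" for w using frac_eq_iff[OF that z] by simp
  then show ?thesis using z unfolding frac_zero_def by blast
qed

lemma frac_one_eq:
  assumes z: "z \<in> denominators"
  shows "frac_one = frac z z"
proof -
  have "frac w w = frac z z" if "w \<in> denominators" for w
    using frac_eq_iff[OF that z] central_commute denominatorsD(1)[OF z] denominatorsD(1)[OF that] by simp
  then show ?thesis using z unfolding frac_one_def by blast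
qed

lemma frac_in_fracs: "z \<in> denominators \<Longrightarrow> a \<in> S \<Longrightarrow> frac z a \<in> fracs S"
  by (auto simp: fracs_def)

lemma fracsE: "X \<in> fracs S \<Longrightarrow> (\<And>z a. z \<in> denominators \<Longrightarrow> a \<in> S \<Longrightarrow> X = frac z a \<Longrightarrow> P) \<Longrightarrow> P"
  by (auto simp: fracs_def)

lemma frac_add_same:
  assumes z: "z \<in> denominators"
  shows "frac_add (frac z a) (frac z b) = frac z (a + b)"
proof -
  note Z = denominatorsD(1)[OF z]
  show ?thesis
    unfolding frac_add_frac[OF z z] using frac_eq_iff[OF denominators_mult[OF z z] z]
    by (simp add: mult.assoc distrib_left)
qed

text \<open>Cross multiplication keeps the numerators in \<open>S\<close> and \<open>T\<close> only
  if these absorb denominators; this covers \<open>even_center\<close>, the components and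
  \<open>UNIV\<close>.\<close>

lemma common_denominator:
  assumes "X \<in> fracs S" "Y \<in> fracs T"
    and S: "\<And>w b. w \<in> denominators \<Longrightarrow> b \<in> S \<Longrightarrow> w * b \<in> S"
    and T: "\<And>w b. w \<in> denominators \<Longrightarrow> b \<in> T \<Longrightarrow> w * b \<in> T"
  obtains z a b where "z \<in> denominators" "a \<in> S" "b \<in> T" "X = frac z a" "Y = frac z b"
proof -
  obtain z a where z: "z \<in> denominators" "a \<in> S" "X = frac z a" using assms(1) by (rule fracsE)
  obtain w b where w: "w \<in> denominators" "b \<in> T" "Y = frac w b" using assms(2) by (rule fracsE)
  note zw = denominators_mult[OF z(1) w(1)]
  note Z = denominatorsD(1)[OF z(1)] denominatorsD(1)[OF w(1)]
  have "X = frac (z * w) (w * a)" "Y = frac (z * w) (z * b)"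
    using frac_eq_iff[OF z(1) zw] frac_eq_iff[OF w(1) zw] Z z(3) w(3) by (simp_all add: central_ac)
  then show thesis using that[OF zw S[OF w(1) z(2)] T[OF z(1) w(2)]] by simp
qed

end

section \<open>Ring and field structure of the fractions\<close>

locale prime_superalg_center = prime_superalg +
  assumes even_center_nonzero: "even_center \<noteq> {0}"
begin

lemma obtain_denominator: obtains z where "z \<in> denominators"
  using even_center_nonzero even_center_0 by blast

lemma localization_simps [simp]:
  "carrier central_localization = fracs UNIV" "mult central_localization = frac_mult"
  "one central_localization = frac_one" "zero central_localization = frac_zero"
  "add central_localization = frac_add" "smult central_localization = frac_mult"
  "component central_localization i = fracs (A i)"
  "carrier center_field = fracs even_center" "mult center_field = frac_mult"
  "one center_field = frac_one" "zero center_field = frac_zero" "add center_field = frac_add"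
  by (simp_all add: central_localization_def center_field_def)

lemma fracs_frac_add:
  assumes "X \<in> fracs S" "Y \<in> fracs S"
    and "\<And>w b. w \<in> denominators \<Longrightarrow> b \<in> S \<Longrightarrow> w * b \<in> S" "\<And>a b. a \<in> S \<Longrightarrow> b \<in> S \<Longrightarrow> a + b \<in> S"
  shows "frac_add X Y \<in> fracs S"
proof -
  obtain z a where z: "z \<in> denominators" "a \<in> S" "X = frac z a" using assms(1) by (rule fracsE)
  obtain w b where w: "w \<in> denominators" "b \<in> S" "Y = frac w b" using assms(2) by (rule fracsE)
  show ?thesis
    unfolding z(3) w(3) frac_add_frac[OF z(1) w(1)]
    by (intro frac_in_fracs denominators_mult assms(3,4) z w)
qed

lemma fracs_frac_mult:
  assumes "X \<in> fracs S" "Y \<in> fracs T" "\<And>a b. a \<in> S \<Longrightarrow> b \<in> T \<Longrightarrow> a * b \<in> U"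
  shows "frac_mult X Y \<in> fracs U"
proof -
  obtain z a where z: "z \<in> denominators" "a \<in> S" "X = frac z a" using assms(1) by (rule fracsE)
  obtain w b where w: "w \<in> denominators" "b \<in> T" "Y = frac w b" using assms(2) by (rule fracsE)
  show ?thesis
    unfolding z(3) w(3) frac_mult_frac[OF z(1) w(1)]
    by (intro frac_in_fracs denominators_mult assms(3) z w)
qed

lemma frac_zero_in: "0 \<in> S \<Longrightarrow> frac_zero \<in> fracs S"
  by (rule obtain_denominator) (simp add: frac_zero_eq frac_in_fracs)

lemma frac_one_in: "even_center \<subseteq> S \<Longrightarrow> frac_one \<in> fracs S"
  by (rule obtain_denominator) (auto simp: frac_one_eq frac_in_fracs)

lemma denominators_mult_closed:
  "w \<in> denominators \<Longrightarrow> b \<in> even_center \<Longrightarrow> w * b \<in> even_center"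
  "w \<in> denominators \<Longrightarrow> c \<in> A i \<Longrightarrow> w * c \<in> A i"
  by (simp_all add: even_center_mult) (cases i; simp add: A_intros even_center_even)

lemma frac_add_assoc:
  "X \<in> fracs UNIV \<Longrightarrow> Y \<in> fracs UNIV \<Longrightarrow> V \<in> fracs UNIV \<Longrightarrow>
    frac_add (frac_add X Y) V = frac_add X (frac_add Y V)"
  by (elim fracsE)
     (simp add: frac_add_frac denominators_mult frac_eq_iff distrib_left central_ac
       even_center_mult add.assoc del: Diff_iff, simp add: central_ac even_center_mult)

lemma frac_add_commute:
  "X \<in> fracs UNIV \<Longrightarrow> Y \<in> fracs UNIV \<Longrightarrow> frac_add X Y = frac_add Y X"
  by (elim fracsE) (simp add: frac_add_frac central_commute add.commute)

lemma frac_mult_assoc: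
  "X \<in> fracs UNIV \<Longrightarrow> Y \<in> fracs UNIV \<Longrightarrow> V \<in> fracs UNIV \<Longrightarrow>
    frac_mult (frac_mult X Y) V = frac_mult X (frac_mult Y V)"
  by (elim fracsE) (simp add: frac_mult_frac denominators_mult mult.assoc del: Diff_iff)

lemma frac_distrib_left:
  assumes "X \<in> fracs UNIV" "Y \<in> fracs UNIV" "V \<in> fracs UNIV"
  shows "frac_mult X (frac_add Y V) = frac_add (frac_mult X Y) (frac_mult X V)"
proof -
  obtain w b c where w: "w \<in> denominators" "Y = frac w b" "V = frac w c"
    by (rule common_denominator[OF assms(2,3)]) simp_all
  obtain z a where z: "z \<in> denominators" "X = frac z a" using assms(1) by (rule fracsE)
  show ?thesis
    unfolding z(2) w(2,3) frac_add_same[OF w(1)] frac_mult_frac[OF z(1) w(1)]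
      frac_add_same[OF denominators_mult[OF z(1) w(1)]] distrib_left ..
qed

lemma frac_distrib_right:
  assumes "X \<in> fracs UNIV" "Y \<in> fracs UNIV" "V \<in> fracs UNIV"
  shows "frac_mult (frac_add Y V) X = frac_add (frac_mult Y X) (frac_mult V X)"
proof -
  obtain w b c where w: "w \<in> denominators" "Y = frac w b" "V = frac w c"
    by (rule common_denominator[OF assms(2,3)]) simp_all
  obtain z a where z: "z \<in> denominators" "X = frac z a" using assms(1) by (rule fracsE)
  show ?thesis
    unfolding z(2) w(2,3) frac_add_same[OF w(1)] frac_mult_frac[OF w(1) z(1)]
      frac_add_same[OF denominators_mult[OF w(1) z(1)]] distrib_right ..
qed

lemma frac_mult_one:
  assumes "X \<in> fracs UNIV"
  shows "frac_mult frac_one X = X" "frac_mult X frac_one = X"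
proof -
  obtain z a where z: "z \<in> denominators" "X = frac z a" using assms(1) by (rule fracsE)
  note Z = denominatorsD(1)[OF z(1)]
  show "frac_mult frac_one X = X" "frac_mult X frac_one = X"
    unfolding z(2) frac_one_eq[OF z(1)] frac_mult_frac[OF z(1,1)]
    using frac_eq_iff[OF denominators_mult[OF z(1,1)] z(1)] even_center_commute[OF Z, of a]
    by (simp_all add: mult.assoc)
qed

lemma frac_add_zero:
  assumes "X \<in> fracs UNIV"
  shows "frac_add frac_zero X = X"
proof -
  obtain z a where z: "z \<in> denominators" "X = frac z a" using assms(1) by (rule fracsE)
  show ?thesis unfolding z(2) frac_zero_eq[OF z(1)] frac_add_same[OF z(1)] by simp
qed

lemma frac_add_inverse:
  assumes "X \<in> fracs S" "\<And>a. a \<in> S \<Longrightarrow> - a \<in> S"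
  shows "\<exists>Y\<in>fracs S. frac_add Y X = frac_zero"
proof -
  obtain z a where z: "z \<in> denominators" "a \<in> S" "X = frac z a" using assms(1) by (rule fracsE)
  have "frac_add (frac z (- a)) X = frac_zero"
    unfolding z(3) frac_add_same[OF z(1)] frac_zero_eq[OF z(1)] by simp
  then show ?thesis using frac_in_fracs[OF z(1) assms(2)[OF z(2)]] by blast
qed

lemma fracs_mono: "S \<subseteq> T \<Longrightarrow> X \<in> fracs S \<Longrightarrow> X \<in> fracs T"
  unfolding fracs_def by blast

lemma frac_mult_central:
  assumes "X \<in> fracs even_center" "Y \<in> fracs UNIV"
  shows "frac_mult X Y = frac_mult Y X"
proof -
  obtain z a where z: "z \<in> denominators" "a \<in> even_center" "X = frac z a" using assms(1) by (rule fracsE)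
  obtain w b where w: "w \<in> denominators" "Y = frac w b" using assms(2) by (rule fracsE)
  show ?thesis
    unfolding z(3) w(2) frac_mult_frac[OF z(1) w(1)] frac_mult_frac[OF w(1) z(1)]
    using even_center_commute[OF z(2), of b] even_center_commute[OF denominatorsD(1)[OF z(1)], of w] by simp
qed

lemma ring_central_localization: "ring central_localization"
proof (rule ringI)
  show "abelian_group central_localization"
    by (rule abelian_groupI, simp_all add: fracs_frac_add frac_zero_in)
       (rule frac_add_assoc frac_add_commute frac_add_zero frac_add_inverse; simp)+
  show "Group.monoid central_localization"
    by (rule Group.monoidI) (simp_all add: fracs_frac_mult[where S = UNIV and T = UNIV] frac_one_in
      frac_mult_assoc frac_mult_one)
qed (simp_all add: frac_distrib_left frac_distrib_right)

text \<open>A nonzero fraction over \<open>Z\<close> has a numerator that is itself a denominator,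
  so numerator and denominator can be exchanged to invert it.\<close>

lemma field_center_field: "field center_field"
proof -
  note sub = fracs_mono[OF subset_UNIV[of even_center]]
  have "cring center_field"
  proof (rule cringI)
    show "abelian_group center_field"
      by (rule abelian_groupI, simp_all add: even_center_0 frac_zero_in)
         (rule fracs_frac_add frac_add_assoc frac_add_commute frac_add_zero frac_add_inverse;
          simp add: sub even_center_neg even_center_mult even_center_add)+
    show "comm_monoid center_field"
      by (rule comm_monoidI, simp_all add: fracs_frac_mult[where S = even_center and T = even_center]
            even_center_mult frac_one_in frac_mult_one sub)
         (rule frac_mult_assoc frac_mult_central; simp add: sub)+
  qed (simp_all add: frac_distrib_right sub)
  then show ?thesis
  proof (rule cring.cring_fieldI2)
    obtain z where z: "z \<in> denominators" by (rule obtain_denominator)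
    have "z * 0 \<noteq> z * z" using z even_center_mult_nonzero by simp
    then show "\<zero>\<^bsub>center_field\<^esub> \<noteq> \<one>\<^bsub>center_field\<^esub>"
      using frac_eq_iff[OF z z] z by (simp add: frac_zero_eq[OF z] frac_one_eq[OF z])
  next
    fix X assume "X \<in> carrier center_field" and nz: "X \<noteq> \<zero>\<^bsub>center_field\<^esub>"
    then have "X \<in> fracs even_center" by simp
    then obtain z a where z: "z \<in> denominators" "a \<in> even_center" "X = frac z a" by (rule fracsE)
    have a: "a \<in> denominators" using nz z frac_zero_eq[OF z(1)] by auto
    have "frac_mult X (frac a z) = frac_one"
      unfolding z(3) frac_mult_frac[OF z(1) a] frac_one_eq[OF denominators_mult[OF z(1) a]]
      using central_commute z a by simp
    then show "\<exists>Y\<in>carrier center_field. X \<otimes>\<^bsub>center_field\<^esub> Y = \<one>\<^bsub>center_field\<^esub>"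
      using frac_in_fracs[OF a] z(1) by auto
  qed
qed

end


section \<open>The free algebra\<close>

context abelian_monoid
begin

text \<open>Reindexing of the pairs \<open>j <= i <= n\<close> by \<open>k = i - j\<close>, as
  needed for associativity of the convolution, where \<open>j\<close> and \<open>i\<close> are two
  cut points of a word.\<close>

lemma finsum_triangle:
  assumes "\<And>j i. j \<le> i \<Longrightarrow> i \<le> n \<Longrightarrow> f j i \<in> carrier G"
  shows "(\<Oplus>i\<in>{..n::nat}. \<Oplus>j\<in>{..i}. f j i) = (\<Oplus>j\<in>{..n}. \<Oplus>k\<in>{..n - j}. f j (j + k))"
  using assms
proof (induction n)
  case (Suc n)
  have "(\<Oplus>j\<in>{..n}. \<Oplus>k\<in>{..Suc n - j}. f j (j + k))
      = (\<Oplus>j\<in>{..n}. (\<Oplus>k\<in>{..n - j}. f j (j + k)) \<oplus> f j (Suc n))"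
  proof (rule finsum_cong'[OF refl])
    show "(\<lambda>j. (\<Oplus>k\<in>{..n - j}. f j (j + k)) \<oplus> f j (Suc n)) \<in> {..n} \<rightarrow> carrier G"
      using Suc.prems by (intro Pi_I a_closed finsum_closed) auto
    fix j assume j: "j \<in> {..n}"
    then have e: "Suc n - j = Suc (n - j)" by auto
    have "(\<Oplus>k\<in>{..Suc n - j}. f j (j + k))
        = f j (Suc n) \<oplus> (\<Oplus>k\<in>{..n - j}. f j (j + k))"
      unfolding e by (subst finsum_Suc) (use j Suc.prems in auto)
    also have "\<dots> = (\<Oplus>k\<in>{..n - j}. f j (j + k)) \<oplus> f j (Suc n)"
      using j Suc.prems by (intro a_comm finsum_closed) auto
    finally show "(\<Oplus>k\<in>{..Suc n - j}. f j (j + k)) = (\<Oplus>k\<in>{..n - j}. f j (j + k)) \<oplus> f j (Suc n)" .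
  qed
  also have "\<dots> = (\<Oplus>j\<in>{..n}. \<Oplus>k\<in>{..n - j}. f j (j + k)) \<oplus> (\<Oplus>j\<in>{..n}. f j (Suc n))"
    using Suc.prems by (intro finsum_addf) (auto intro!: finsum_closed)
  also have "(\<Oplus>j\<in>{..n}. \<Oplus>k\<in>{..n - j}. f j (j + k)) = (\<Oplus>i\<in>{..n}. \<Oplus>j\<in>{..i}. f j i)"
    using Suc by simp
  finally have *: "(\<Oplus>j\<in>{..n}. \<Oplus>k\<in>{..Suc n - j}. f j (j + k))
      = (\<Oplus>i\<in>{..n}. \<Oplus>j\<in>{..i}. f j i) \<oplus> (\<Oplus>j\<in>{..n}. f j (Suc n))" .
  have c: "(\<Oplus>i\<in>{..n}. \<Oplus>j\<in>{..i}. f j i) \<in> carrier G" "(\<Oplus>j\<in>{..n}. f j (Suc n)) \<in> carrier G"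
    "f (Suc n) (Suc n) \<in> carrier G"
    using Suc.prems by (auto intro!: finsum_closed)
  have "(\<Oplus>j\<in>{..Suc n}. \<Oplus>k\<in>{..Suc n - j}. f j (j + k))
      = f (Suc n) (Suc n) \<oplus> (\<Oplus>j\<in>{..n}. \<Oplus>k\<in>{..Suc n - j}. f j (j + k))"
    using Suc.prems by (subst finsum_Suc) (auto intro!: finsum_closed)
  moreover have "(\<Oplus>i\<in>{..Suc n}. \<Oplus>j\<in>{..i}. f j i)
      = (f (Suc n) (Suc n) \<oplus> (\<Oplus>j\<in>{..n}. f j (Suc n))) \<oplus> (\<Oplus>i\<in>{..n}. \<Oplus>j\<in>{..i}. f j i)"
    using Suc.prems by (subst finsum_Suc) (auto intro!: finsum_closed simp: finsum_Suc)
  ultimately show ?case unfolding * using c by (simp add: a_ac)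
qed simp

lemma finsum_single:
  assumes "finite S" "i \<in> S" "x \<in> carrier G" "\<And>k. k \<in> S \<Longrightarrow> f k = (if k = i then x else \<zero>)"
  shows "finsum G f S = x"
proof -
  have "finsum G f S = (\<Oplus>k\<in>S. if i = k then x else \<zero>)"
    using assms by (intro finsum_cong') auto
  also have "\<dots> = x" using assms by (intro add.finprod_singleton) auto
  finally show ?thesis .
qed

end

definition monomial :: "('f, 'm) ring_scheme \<Rightarrow> 'f \<Rightarrow> 'x list \<Rightarrow> 'x list \<Rightarrow> 'f" where
  "monomial F c v = (\<lambda>w. if w = v then c else \<zero>\<^bsub>F\<^esub>)"

lemma free_algebra_simps [simp]:
  "zero (free_algebra F X) = (\<lambda>w. \<zero>\<^bsub>F\<^esub>)"
  "add (free_algebra F X) = (\<lambda>f g w. f w \<oplus>\<^bsub>F\<^esub> g w)"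
  "one (free_algebra F X) = monomial F \<one>\<^bsub>F\<^esub> []"
  "smult (free_algebra F X) = (\<lambda>c f w. c \<otimes>\<^bsub>F\<^esub> f w)"
  by (simp_all add: free_algebra_def monomial_def)

lemma free_gen_monomial: "free_gen F x = monomial F \<one>\<^bsub>F\<^esub> [x]"
  by (simp add: free_gen_def monomial_def)

locale free_alg = cring F for F (structure) +
  fixes X :: "'x set"
begin

abbreviation T where "T \<equiv> free_algebra F X"

lemma T_mult: "(f \<otimes>\<^bsub>T\<^esub> g) w = (\<Oplus>k\<in>{..length w}. f (take k w) \<otimes> g (drop k w))"
  by (simp add: free_algebra_def)

lemma T_carrier: "f \<in> carrier T \<longleftrightarrow>
    (\<forall>w. f w \<in> carrier F) \<and> finite {w. f w \<noteq> \<zero>} \<and> {w. f w \<noteq> \<zero>} \<subseteq> lists X"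
  by (auto simp: free_algebra_def)

lemma T_value [simp]: "f \<in> carrier T \<Longrightarrow> f w \<in> carrier F"
  by (simp add: T_carrier)

lemma T_carrierI:
  assumes "\<And>w. f w \<in> carrier F" "finite S" "S \<subseteq> lists X" "\<And>w. w \<notin> S \<Longrightarrow> f w = \<zero>"
  shows "f \<in> carrier T"
proof -
  have "{w. f w \<noteq> \<zero>} \<subseteq> S" using assms(4) by blast
  then show ?thesis using assms(1,2,3) finite_subset unfolding T_carrier by blast
qed

lemma monomial_closed: "c \<in> carrier F \<Longrightarrow> v \<in> lists X \<Longrightarrow> monomial F c v \<in> carrier T"
  by (rule T_carrierI[where S = "{v}"]) (auto simp: monomial_def)

lemma T_add_closed:
  assumes "f \<in> carrier T" "g \<in> carrier T"
  shows "(\<lambda>w. f w \<oplus> g w) \<in> carrier T"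
  by (rule T_carrierI[where S = "{w. f w \<noteq> \<zero>} \<union> {w. g w \<noteq> \<zero>}"])
     (use assms in \<open>auto simp: T_carrier\<close>)

lemma T_mult_closed:
  assumes f: "f \<in> carrier T" and g: "g \<in> carrier T"
  shows "f \<otimes>\<^bsub>T\<^esub> g \<in> carrier T"
proof (rule T_carrierI)
  let ?S = "(\<lambda>(u, v). u @ v) ` ({w. f w \<noteq> \<zero>} \<times> {w. g w \<noteq> \<zero>})"
  show "(f \<otimes>\<^bsub>T\<^esub> g) w \<in> carrier F" for w
    unfolding T_mult using f g by (intro finsum_closed) auto
  show "finite ?S" using f g by (auto simp: T_carrier)
  show "?S \<subseteq> lists X" using f g by (fastforce simp: T_carrier)
  fix w assume w: "w \<notin> ?S"
  have "f (take k w) \<otimes> g (drop k w) = \<zero>" for k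
  proof (rule ccontr)
    assume "f (take k w) \<otimes> g (drop k w) \<noteq> \<zero>"
    then have "f (take k w) \<noteq> \<zero>" "g (drop k w) \<noteq> \<zero>" using f g by auto
    then have "take k w @ drop k w \<in> ?S" by blast
    then show False using w by simp
  qed
  then show "(f \<otimes>\<^bsub>T\<^esub> g) w = \<zero>" unfolding T_mult by simp
qed

lemma T_mult_assoc:
  assumes f: "f \<in> carrier T" and g: "g \<in> carrier T" and h: "h \<in> carrier T"
  shows "(f \<otimes>\<^bsub>T\<^esub> g) \<otimes>\<^bsub>T\<^esub> h = f \<otimes>\<^bsub>T\<^esub> (g \<otimes>\<^bsub>T\<^esub> h)"
proof
  fix w :: "'x list"
  let ?n = "length w"
  \<comment> \<open>The contribution of cutting \<open>w\<close> at \<open>j\<close> and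
    \<open>i\<close>; both bracketings sum it over all \<open>j <= i\<close>.\<close>
  define p where "p j i = f (take j w) \<otimes> g (drop j (take i w)) \<otimes> h (drop i w)" for j i
  have p: "p j i \<in> carrier F" for j i unfolding p_def using f g h by simp
  have "((f \<otimes>\<^bsub>T\<^esub> g) \<otimes>\<^bsub>T\<^esub> h) w = (\<Oplus>i\<in>{..?n}. \<Oplus>j\<in>{..i}. p j i)"
    unfolding T_mult[of _ h]
  proof (rule finsum_cong'[OF refl])
    fix i assume i: "i \<in> {..?n}"
    have "(f \<otimes>\<^bsub>T\<^esub> g) (take i w) \<otimes> h (drop i w)
        = (\<Oplus>j\<in>{..i}. f (take j (take i w)) \<otimes> g (drop j (take i w)) \<otimes> h (drop i w))"
      unfolding T_mult using i f g h by (subst finsum_ldistr) (auto simp: min_absorb2)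
    also have "\<dots> = (\<Oplus>j\<in>{..i}. p j i)"
      using p by (intro finsum_cong') (auto simp: p_def min_absorb1)
    finally show "(f \<otimes>\<^bsub>T\<^esub> g) (take i w) \<otimes> h (drop i w) = (\<Oplus>j\<in>{..i}. p j i)" .
  qed (use p in \<open>auto intro!: finsum_closed\<close>)
  also have "\<dots> = (\<Oplus>j\<in>{..?n}. \<Oplus>k\<in>{..?n - j}. p j (j + k))"
    using p by (rule finsum_triangle)
  also have "\<dots> = (f \<otimes>\<^bsub>T\<^esub> (g \<otimes>\<^bsub>T\<^esub> h)) w"
    unfolding T_mult[of f]
  proof (rule finsum_cong'[OF refl])
    show "(\<lambda>j. f (take j w) \<otimes> (g \<otimes>\<^bsub>T\<^esub> h) (drop j w)) \<in> {..?n} \<rightarrow> carrier F"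
      using f T_mult_closed[OF g h] by simp
    fix j assume "j \<in> {..?n}"
    have "f (take j w) \<otimes> (g \<otimes>\<^bsub>T\<^esub> h) (drop j w) =
        (\<Oplus>k\<in>{..?n - j}. f (take j w) \<otimes> (g (take k (drop j w)) \<otimes> h (drop k (drop j w))))"
      unfolding T_mult using f g h by (subst finsum_rdistr) auto
    also have "\<dots> = (\<Oplus>k\<in>{..?n - j}. p j (j + k))"
      using p f g h
      by (intro finsum_cong') (auto simp: p_def m_assoc take_drop add.commute)
    finally show "(\<Oplus>k\<in>{..?n - j}. p j (j + k)) = f (take j w) \<otimes> (g \<otimes>\<^bsub>T\<^esub> h) (drop j w)" ..
  qed
  finally show "((f \<otimes>\<^bsub>T\<^esub> g) \<otimes>\<^bsub>T\<^esub> h) w = (f \<otimes>\<^bsub>T\<^esub> (g \<otimes>\<^bsub>T\<^esub> h)) w" .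
qed

lemma T_l_one: "f \<in> carrier T \<Longrightarrow> monomial F \<one> [] \<otimes>\<^bsub>T\<^esub> f = f"
  by (rule ext, unfold T_mult, rule finsum_single[where i = 0]) (auto simp: monomial_def)

lemma T_r_one: "f \<in> carrier T \<Longrightarrow> f \<otimes>\<^bsub>T\<^esub> monomial F \<one> [] = f"
proof
  fix w assume f: "f \<in> carrier T"
  show "(f \<otimes>\<^bsub>T\<^esub> monomial F \<one> []) w = f w"
    unfolding T_mult by (rule finsum_single[where i = "length w"]) (use f in \<open>auto simp: monomial_def\<close>)
qed

lemma ring_T: "ring T"
proof (rule ringI)
  show "abelian_group T"
  proof (rule abelian_groupI)
    fix f assume f: "f \<in> carrier T"
    have "(\<lambda>w. \<ominus> f w) \<in> carrier T"
      by (rule T_carrierI[where S = "{w. f w \<noteq> \<zero>}"]) (use f in \<open>auto simp: T_carrier\<close>)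
    then show "\<exists>g\<in>carrier T. g \<oplus>\<^bsub>T\<^esub> f = \<zero>\<^bsub>T\<^esub>" using f by (intro bexI) (auto simp: l_neg)
  qed (auto simp: T_add_closed a_ac intro!: T_carrierI[where S = "{}"])
  show "Group.monoid T"
    by (rule Group.monoidI) (auto simp: T_mult_closed T_mult_assoc T_l_one T_r_one monomial_closed)
next
  fix f g h assume c: "f \<in> carrier T" "g \<in> carrier T" "h \<in> carrier T"
  show "(f \<oplus>\<^bsub>T\<^esub> g) \<otimes>\<^bsub>T\<^esub> h = f \<otimes>\<^bsub>T\<^esub> h \<oplus>\<^bsub>T\<^esub> g \<otimes>\<^bsub>T\<^esub> h"
    by (rule ext) (use c in \<open>simp add: T_mult l_distr finsum_addf Pi_def\<close>)
  show "h \<otimes>\<^bsub>T\<^esub> (f \<oplus>\<^bsub>T\<^esub> g) = h \<otimes>\<^bsub>T\<^esub> f \<oplus>\<^bsub>T\<^esub> h \<otimes>\<^bsub>T\<^esub> g"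
    by (rule ext) (use c in \<open>simp add: T_mult r_distr finsum_addf Pi_def\<close>)
qed

lemma monomial_mult:
  assumes "c \<in> carrier F" "d \<in> carrier F"
  shows "monomial F c v \<otimes>\<^bsub>T\<^esub> monomial F d w = monomial F (c \<otimes> d) (v @ w)"
proof
  fix z
  show "(monomial F c v \<otimes>\<^bsub>T\<^esub> monomial F d w) z = monomial F (c \<otimes> d) (v @ w) z"
  proof (cases "z = v @ w")
    case True
    have "take k z = v \<Longrightarrow> k = length v" if "k \<in> {..length z}" for k
      using that by (metis atMost_iff length_take min_absorb2)
    then have "take k z = v \<and> drop k z = w \<longleftrightarrow> k = length v" if "k \<in> {..length z}" for k
      using that True by auto
    then have *: "monomial F c v (take k z) \<otimes> monomial F d w (drop k z) = (if k = length v then c \<otimes> d else \<zero>)"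
      if "k \<in> {..length z}" for k
      using that assms by (auto simp: monomial_def)
    show ?thesis
      unfolding T_mult
      by (rule trans[OF finsum_single[where i = "length v" and x = "c \<otimes> d"]])
         (use * assms True in \<open>auto simp: monomial_def\<close>)
  next
    case False
    have "monomial F c v (take k z) \<otimes> monomial F d w (drop k z) = \<zero>" for k
    proof (cases "take k z = v \<and> drop k z = w")
      case True
      then have "z = v @ w" by (metis append_take_drop_id)
      then show ?thesis using False by simp
    qed (use assms in \<open>auto simp: monomial_def\<close>)
    then show ?thesis using False by (simp add: T_mult monomial_def)
  qed
qed

lemma T_smult: "c \<in> carrier F \<Longrightarrow> f \<in> carrier T \<Longrightarrow> c \<odot>\<^bsub>T\<^esub> f = monomial F c [] \<otimes>\<^bsub>T\<^esub> f"
proof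
  fix w assume cf: "c \<in> carrier F" "f \<in> carrier T"
  have "(monomial F c [] \<otimes>\<^bsub>T\<^esub> f) w = c \<otimes> f w"
    unfolding T_mult by (rule finsum_single[where i = 0]) (use cf in \<open>auto simp: monomial_def\<close>)
  then show "(c \<odot>\<^bsub>T\<^esub> f) w = (monomial F c [] \<otimes>\<^bsub>T\<^esub> f) w" by simp
qed

text \<open>One monomial of the support is peeled off at a time. The premise
  \<open>g v = \<zero>\<close> rules out cancellation between it and the rest, so support conditions
  such as parity pass to both summands.\<close>

lemma T_induct [consumes 1, case_names zero add]:
  assumes f: "f \<in> carrier T"
    and zero: "P (\<lambda>w. \<zero>)"
    and add: "\<And>c v g. c \<in> carrier F \<Longrightarrow> v \<in> lists X \<Longrightarrow> g \<in> carrier T \<Longrightarrow> g v = \<zero> \<Longrightarrow> P g \<Longrightarrow>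
      P (\<lambda>w. monomial F c v w \<oplus> g w)"
  shows "P f"
proof -
  have "finite {w. f w \<noteq> \<zero>}" using f by (simp add: T_carrier)
  then show ?thesis
    using f
  proof (induction "{w. f w \<noteq> \<zero>}" arbitrary: f rule: finite_induct)
    case empty
    then have "f = (\<lambda>w. \<zero>)" by auto
    then show ?case using zero by simp
  next
    case (insert v S)
    define g where "g = (\<lambda>w. if w = v then \<zero> else f w)"
    have S: "S = {w. g w \<noteq> \<zero>}" using insert.hyps by (auto simp: g_def)
    have v: "v \<in> lists X" using insert.hyps(4) insert.prems by (auto simp: T_carrier)
    have g: "g \<in> carrier T"
      using insert.prems by (intro T_carrierI[where S = "{w. f w \<noteq> \<zero>}"]) (auto simp: T_carrier g_def)
    have "P (\<lambda>w. monomial F (f v) v w \<oplus> g w)"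
      using insert.prems v g by (intro add insert.hyps(3)[OF S g]) (simp_all add: g_def)
    also have "(\<lambda>w. monomial F (f v) v w \<oplus> g w) = f"
      using insert.prems by (auto simp: monomial_def g_def)
    finally show ?case .
  qed
qed

end


section \<open>Evaluation of the free algebra in a ring with central scalars\<close>

locale free_alg_eval = free_alg F X + B: ring B
  for F (structure) and X :: "'x set" and B +
  fixes \<sigma> j
  assumes \<sigma>: "\<sigma> \<in> ring_hom F B"
    and \<sigma>_central: "c \<in> carrier F \<Longrightarrow> b \<in> carrier B \<Longrightarrow> \<sigma> c \<otimes>\<^bsub>B\<^esub> b = b \<otimes>\<^bsub>B\<^esub> \<sigma> c"
    and j_closed: "v \<in> X \<Longrightarrow> j v \<in> carrier B"
begin

lemma \<sigma>_simps [simp]: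
  "c \<in> carrier F \<Longrightarrow> \<sigma> c \<in> carrier B" "\<sigma> \<zero> = \<zero>\<^bsub>B\<^esub>" "\<sigma> \<one> = \<one>\<^bsub>B\<^esub>"
  "c \<in> carrier F \<Longrightarrow> d \<in> carrier F \<Longrightarrow> \<sigma> (c \<oplus> d) = \<sigma> c \<oplus>\<^bsub>B\<^esub> \<sigma> d"
  "c \<in> carrier F \<Longrightarrow> d \<in> carrier F \<Longrightarrow> \<sigma> (c \<otimes> d) = \<sigma> c \<otimes>\<^bsub>B\<^esub> \<sigma> d"
  using \<sigma> ring_hom_zero[OF \<sigma> ring_axioms B.ring_axioms]
  by (simp_all add: ring_hom_closed ring_hom_one ring_hom_add ring_hom_mult)

definition word_prod where
  "word_prod w = foldr (\<lambda>v b. j v \<otimes>\<^bsub>B\<^esub> b) w \<one>\<^bsub>B\<^esub>"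

lemma word_prod_simps [simp]:
  "word_prod [] = \<one>\<^bsub>B\<^esub>" "word_prod (v # w) = j v \<otimes>\<^bsub>B\<^esub> word_prod w"
  by (simp_all add: word_prod_def)

lemma word_prod_closed [simp]: "w \<in> lists X \<Longrightarrow> word_prod w \<in> carrier B"
  by (induction w) (auto simp: j_closed)

lemma word_prod_append:
  "v \<in> lists X \<Longrightarrow> w \<in> lists X \<Longrightarrow> word_prod (v @ w) = word_prod v \<otimes>\<^bsub>B\<^esub> word_prod w"
  by (induction v) (auto simp: j_closed B.m_assoc)

definition eval where
  "eval f = (\<Oplus>\<^bsub>B\<^esub>w\<in>{w. f w \<noteq> \<zero>}. \<sigma> (f w) \<otimes>\<^bsub>B\<^esub> word_prod w)"

text \<open>Supports can shrink under addition, so additivity is proved by summing over a common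
  finite superset.\<close>

lemma eval_superset:
  assumes f: "f \<in> carrier T" and D: "finite D" "D \<subseteq> lists X" "{w. f w \<noteq> \<zero>} \<subseteq> D"
  shows "eval f = (\<Oplus>\<^bsub>B\<^esub>w\<in>D. \<sigma> (f w) \<otimes>\<^bsub>B\<^esub> word_prod w)"
  unfolding eval_def
  by (rule B.add.finprod_mono_neutral_cong_left[OF D(1,3)]) (use D f in \<open>auto simp: Pi_def subset_iff\<close>)

lemma eval_closed: "f \<in> carrier T \<Longrightarrow> eval f \<in> carrier B"
  unfolding eval_def by (rule B.finsum_closed) (auto simp: T_carrier Pi_def subset_iff)

lemma eval_zero: "eval (\<lambda>w. \<zero>) = \<zero>\<^bsub>B\<^esub>"
  by (simp add: eval_def)

lemma eval_add:
  assumes f: "f \<in> carrier T" and g: "g \<in> carrier T"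
  shows "eval (\<lambda>w. f w \<oplus> g w) = eval f \<oplus>\<^bsub>B\<^esub> eval g"
proof -
  define D where "D = {w. f w \<noteq> \<zero>} \<union> {w. g w \<noteq> \<zero>}"
  have D: "finite D" "D \<subseteq> lists X" using f g by (auto simp: D_def T_carrier)
  have "eval (\<lambda>w. f w \<oplus> g w) = (\<Oplus>\<^bsub>B\<^esub>w\<in>D. \<sigma> (f w \<oplus> g w) \<otimes>\<^bsub>B\<^esub> word_prod w)"
    by (rule eval_superset[OF T_add_closed[OF f g] D]) (use f g in \<open>auto simp: D_def\<close>)
  also have "\<dots> = (\<Oplus>\<^bsub>B\<^esub>w\<in>D. \<sigma> (f w) \<otimes>\<^bsub>B\<^esub> word_prod w \<oplus>\<^bsub>B\<^esub> \<sigma> (g w) \<otimes>\<^bsub>B\<^esub> word_prod w)"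
    by (rule B.finsum_cong') (use f g D(2) in \<open>auto simp: B.l_distr subset_iff Pi_def\<close>)
  also have "\<dots> = (\<Oplus>\<^bsub>B\<^esub>w\<in>D. \<sigma> (f w) \<otimes>\<^bsub>B\<^esub> word_prod w) \<oplus>\<^bsub>B\<^esub> (\<Oplus>\<^bsub>B\<^esub>w\<in>D. \<sigma> (g w) \<otimes>\<^bsub>B\<^esub> word_prod w)"
    by (rule B.finsum_addf) (use f g D(2) in \<open>auto simp: subset_iff Pi_def\<close>)
  also have "\<dots> = eval f \<oplus>\<^bsub>B\<^esub> eval g"
    using eval_superset[OF f D] eval_superset[OF g D] by (auto simp: D_def)
  finally show ?thesis .
qed

lemma eval_monomial:
  assumes c: "c \<in> carrier F" and v: "v \<in> lists X"
  shows "eval (monomial F c v) = \<sigma> c \<otimes>\<^bsub>B\<^esub> word_prod v"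
proof -
  have "eval (monomial F c v) = (\<Oplus>\<^bsub>B\<^esub>w\<in>{v}. \<sigma> (monomial F c v w) \<otimes>\<^bsub>B\<^esub> word_prod w)"
    by (rule eval_superset[OF monomial_closed[OF c v]]) (use v in \<open>auto simp: monomial_def\<close>)
  also have "\<dots> = \<sigma> c \<otimes>\<^bsub>B\<^esub> word_prod v"
    by (rule B.finsum_single[where i = v]) (use c v in \<open>auto simp: monomial_def\<close>)
  finally show ?thesis .
qed

text \<open>Two inductions: over the right factor with a monomial on the left, where centrality of
  \<open>\<sigma>\<close> lets a coefficient pass a word, and then over the left factor.\<close>

lemma eval_mult:
  assumes f: "f \<in> carrier T" and g: "g \<in> carrier T"
  shows "eval (f \<otimes>\<^bsub>T\<^esub> g) = eval f \<otimes>\<^bsub>B\<^esub> eval g"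
proof -
  interpret T: ring T by (rule ring_T)
  have mono: "eval (monomial F c v \<otimes>\<^bsub>T\<^esub> h) = \<sigma> c \<otimes>\<^bsub>B\<^esub> word_prod v \<otimes>\<^bsub>B\<^esub> eval h"
    if c: "c \<in> carrier F" and v: "v \<in> lists X" and h: "h \<in> carrier T" for c v h
    using h
  proof (induction h rule: T_induct)
    case zero
    have "monomial F c v \<otimes>\<^bsub>T\<^esub> (\<lambda>w. \<zero>) = (\<lambda>w. \<zero>)"
      using T.r_null[OF monomial_closed[OF c v]] by simp
    then show ?case using c v by (simp add: eval_zero)
  next
    case (add d w h)
    note cl = monomial_closed[OF c v] monomial_closed[OF add(1,2)]
    have "monomial F c v \<otimes>\<^bsub>T\<^esub> (\<lambda>z. monomial F d w z \<oplus> h z)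
        = (\<lambda>z. monomial F (c \<otimes> d) (v @ w) z \<oplus> (monomial F c v \<otimes>\<^bsub>T\<^esub> h) z)"
      using T.r_distr[OF cl(2) add(3) cl(1)] monomial_mult[OF c add(1)] by simp
    then have "eval (monomial F c v \<otimes>\<^bsub>T\<^esub> (\<lambda>z. monomial F d w z \<oplus> h z))
        = \<sigma> (c \<otimes> d) \<otimes>\<^bsub>B\<^esub> word_prod (v @ w) \<oplus>\<^bsub>B\<^esub> \<sigma> c \<otimes>\<^bsub>B\<^esub> word_prod v \<otimes>\<^bsub>B\<^esub> eval h"
      using c v add cl
      by (subst eval_monomial[symmetric]) (simp_all add: eval_add monomial_closed T_mult_closed del: word_prod_simps)
    also have "\<sigma> (c \<otimes> d) \<otimes>\<^bsub>B\<^esub> word_prod (v @ w) = \<sigma> c \<otimes>\<^bsub>B\<^esub> word_prod v \<otimes>\<^bsub>B\<^esub> (\<sigma> d \<otimes>\<^bsub>B\<^esub> word_prod w)"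
    proof -
      have "\<sigma> c \<otimes>\<^bsub>B\<^esub> word_prod v \<otimes>\<^bsub>B\<^esub> (\<sigma> d \<otimes>\<^bsub>B\<^esub> word_prod w)
          = \<sigma> c \<otimes>\<^bsub>B\<^esub> (word_prod v \<otimes>\<^bsub>B\<^esub> \<sigma> d) \<otimes>\<^bsub>B\<^esub> word_prod w"
        using c v add(1,2) by (simp add: B.m_assoc)
      also have "word_prod v \<otimes>\<^bsub>B\<^esub> \<sigma> d = \<sigma> d \<otimes>\<^bsub>B\<^esub> word_prod v"
        using \<sigma>_central[OF add(1), of "word_prod v"] v by simp
      finally show ?thesis using c v add(1,2) by (simp add: word_prod_append B.m_assoc)
    qed
    finally show ?case
      using c v add cl by (simp add: eval_add eval_monomial B.r_distr eval_closed)
  qed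
  show ?thesis
    using f
  proof (induction f rule: T_induct)
    case zero
    have "(\<lambda>w. \<zero>) \<otimes>\<^bsub>T\<^esub> g = (\<lambda>w. \<zero>)" using T.l_null[OF g] by simp
    then show ?case using eval_closed[OF g] by (simp add: eval_zero)
  next
    case (add c v h)
    note cl = monomial_closed[OF add(1,2)]
    have "(\<lambda>z. monomial F c v z \<oplus> h z) \<otimes>\<^bsub>T\<^esub> g
        = (\<lambda>z. (monomial F c v \<otimes>\<^bsub>T\<^esub> g) z \<oplus> (h \<otimes>\<^bsub>T\<^esub> g) z)"
      using T.l_distr[OF cl add(3) g] by simp
    then have "eval ((\<lambda>z. monomial F c v z \<oplus> h z) \<otimes>\<^bsub>T\<^esub> g)
        = \<sigma> c \<otimes>\<^bsub>B\<^esub> word_prod v \<otimes>\<^bsub>B\<^esub> eval g \<oplus>\<^bsub>B\<^esub> eval h \<otimes>\<^bsub>B\<^esub> eval g"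
      using mono[OF add(1,2) g] add g cl by (simp add: eval_add T_mult_closed)
    then show ?case
      using add g cl by (simp add: eval_add eval_monomial B.l_distr eval_closed)
  qed
qed

lemma eval_ring_hom: "eval \<in> ring_hom T B"
  by (rule ring_hom_memI)
     (simp_all add: eval_closed eval_mult eval_add eval_monomial)

end

text \<open>A single generator is the case \<open>e\<^sub>1 = 0\<close>, \<open>\<xi> = 0\<close>.\<close>

locale clifford_relations_in = R: ring R + F: cring F
  for R and F (structure) +
  fixes \<sigma> \<zeta> \<xi> e\<^sub>0 e\<^sub>1
  assumes \<sigma>: "\<sigma> \<in> ring_hom F R"
    and \<sigma>_central: "c \<in> carrier F \<Longrightarrow> b \<in> carrier R \<Longrightarrow> \<sigma> c \<otimes>\<^bsub>R\<^esub> b = b \<otimes>\<^bsub>R\<^esub> \<sigma> c"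
    and param [simp]: "\<zeta> \<in> carrier F" "\<xi> \<in> carrier F"
    and gen [simp]: "e\<^sub>0 \<in> carrier R" "e\<^sub>1 \<in> carrier R"
    and rel00: "e\<^sub>0 \<otimes>\<^bsub>R\<^esub> e\<^sub>0 = \<sigma> \<zeta>" and rel11: "e\<^sub>1 \<otimes>\<^bsub>R\<^esub> e\<^sub>1 = \<sigma> \<xi>"
    and rel01: "e\<^sub>0 \<otimes>\<^bsub>R\<^esub> e\<^sub>1 \<oplus>\<^bsub>R\<^esub> e\<^sub>1 \<otimes>\<^bsub>R\<^esub> e\<^sub>0 = \<zero>\<^bsub>R\<^esub>"
begin

lemma \<sigma>_simps [simp]:
  "c \<in> carrier F \<Longrightarrow> \<sigma> c \<in> carrier R" "\<sigma> \<zero> = \<zero>\<^bsub>R\<^esub>" "\<sigma> \<one> = \<one>\<^bsub>R\<^esub>"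
  "c \<in> carrier F \<Longrightarrow> d \<in> carrier F \<Longrightarrow> \<sigma> (c \<oplus> d) = \<sigma> c \<oplus>\<^bsub>R\<^esub> \<sigma> d"
  "c \<in> carrier F \<Longrightarrow> d \<in> carrier F \<Longrightarrow> \<sigma> (c \<otimes> d) = \<sigma> c \<otimes>\<^bsub>R\<^esub> \<sigma> d"
  using \<sigma> ring_hom_zero[OF \<sigma> F.ring_axioms R.ring_axioms]
  by (simp_all add: ring_hom_closed ring_hom_one ring_hom_add ring_hom_mult)

lemma \<sigma>_minus [simp]: "c \<in> carrier F \<Longrightarrow> \<sigma> (\<ominus> c) = \<ominus>\<^bsub>R\<^esub> \<sigma> c"
proof -
  assume c: "c \<in> carrier F"
  interpret ring_hom_ring F R \<sigma>
    by (rule ring_hom_ringI2) (use \<sigma> in \<open>simp_all add: F.ring_axioms R.ring_axioms\<close>)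
  show ?thesis using c by simp
qed

lemma \<sigma>_left_commute: "c \<in> carrier F \<Longrightarrow> a \<in> carrier R \<Longrightarrow> b \<in> carrier R \<Longrightarrow>
    a \<otimes>\<^bsub>R\<^esub> (\<sigma> c \<otimes>\<^bsub>R\<^esub> b) = \<sigma> c \<otimes>\<^bsub>R\<^esub> (a \<otimes>\<^bsub>R\<^esub> b)"
  using \<sigma>_central[of c a] by (simp flip: R.m_assoc)

lemma gen_left:
  "b \<in> carrier R \<Longrightarrow> e\<^sub>0 \<otimes>\<^bsub>R\<^esub> (e\<^sub>0 \<otimes>\<^bsub>R\<^esub> b) = \<sigma> \<zeta> \<otimes>\<^bsub>R\<^esub> b"
  "b \<in> carrier R \<Longrightarrow> e\<^sub>1 \<otimes>\<^bsub>R\<^esub> (e\<^sub>1 \<otimes>\<^bsub>R\<^esub> b) = \<sigma> \<xi> \<otimes>\<^bsub>R\<^esub> b"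
  "e\<^sub>1 \<otimes>\<^bsub>R\<^esub> e\<^sub>0 = \<ominus>\<^bsub>R\<^esub> (e\<^sub>0 \<otimes>\<^bsub>R\<^esub> e\<^sub>1)"
  "b \<in> carrier R \<Longrightarrow> e\<^sub>1 \<otimes>\<^bsub>R\<^esub> (e\<^sub>0 \<otimes>\<^bsub>R\<^esub> b) = \<ominus>\<^bsub>R\<^esub> (e\<^sub>0 \<otimes>\<^bsub>R\<^esub> (e\<^sub>1 \<otimes>\<^bsub>R\<^esub> b))"
proof -
  show *: "e\<^sub>1 \<otimes>\<^bsub>R\<^esub> e\<^sub>0 = \<ominus>\<^bsub>R\<^esub> (e\<^sub>0 \<otimes>\<^bsub>R\<^esub> e\<^sub>1)"
    using rel01 by (intro R.minus_equality[symmetric]) (simp_all add: R.a_comm)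
  assume b: "b \<in> carrier R"
  show "e\<^sub>0 \<otimes>\<^bsub>R\<^esub> (e\<^sub>0 \<otimes>\<^bsub>R\<^esub> b) = \<sigma> \<zeta> \<otimes>\<^bsub>R\<^esub> b" "e\<^sub>1 \<otimes>\<^bsub>R\<^esub> (e\<^sub>1 \<otimes>\<^bsub>R\<^esub> b) = \<sigma> \<xi> \<otimes>\<^bsub>R\<^esub> b"
    using b rel00 rel11 by (simp_all flip: R.m_assoc)
  show "e\<^sub>1 \<otimes>\<^bsub>R\<^esub> (e\<^sub>0 \<otimes>\<^bsub>R\<^esub> b) = \<ominus>\<^bsub>R\<^esub> (e\<^sub>0 \<otimes>\<^bsub>R\<^esub> (e\<^sub>1 \<otimes>\<^bsub>R\<^esub> b))"
    using b * by (simp add: R.l_minus flip: R.m_assoc)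
qed

text \<open>Uniqueness of the coefficients is deliberately left open, because the same locale is
  interpreted both in the target ring and in the Clifford quotient, where independence is not known
  beforehand.\<close>

definition normal_form where
  "normal_form c\<^sub>0 c\<^sub>1 c\<^sub>2 c\<^sub>3 = \<sigma> c\<^sub>0 \<oplus>\<^bsub>R\<^esub> (\<sigma> c\<^sub>1 \<otimes>\<^bsub>R\<^esub> e\<^sub>0 \<oplus>\<^bsub>R\<^esub> (\<sigma> c\<^sub>2 \<otimes>\<^bsub>R\<^esub> e\<^sub>1 \<oplus>\<^bsub>R\<^esub> \<sigma> c\<^sub>3 \<otimes>\<^bsub>R\<^esub> (e\<^sub>0 \<otimes>\<^bsub>R\<^esub> e\<^sub>1)))"

lemma normal_form_closed:
  "c\<^sub>0 \<in> carrier F \<Longrightarrow> c\<^sub>1 \<in> carrier F \<Longrightarrow> c\<^sub>2 \<in> carrier F \<Longrightarrow> c\<^sub>3 \<in> carrier F \<Longrightarrow>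
    normal_form c\<^sub>0 c\<^sub>1 c\<^sub>2 c\<^sub>3 \<in> carrier R"
  by (simp add: normal_form_def)

lemma normal_form_add:
  assumes "c\<^sub>0 \<in> carrier F" "c\<^sub>1 \<in> carrier F" "c\<^sub>2 \<in> carrier F" "c\<^sub>3 \<in> carrier F"
    and "d\<^sub>0 \<in> carrier F" "d\<^sub>1 \<in> carrier F" "d\<^sub>2 \<in> carrier F" "d\<^sub>3 \<in> carrier F"
  shows "normal_form c\<^sub>0 c\<^sub>1 c\<^sub>2 c\<^sub>3 \<oplus>\<^bsub>R\<^esub> normal_form d\<^sub>0 d\<^sub>1 d\<^sub>2 d\<^sub>3
    = normal_form (c\<^sub>0 \<oplus> d\<^sub>0) (c\<^sub>1 \<oplus> d\<^sub>1) (c\<^sub>2 \<oplus> d\<^sub>2) (c\<^sub>3 \<oplus> d\<^sub>3)"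
  using assms by (simp add: normal_form_def R.l_distr R.a_ac)

lemma normal_form_scale:
  assumes "c\<^sub>0 \<in> carrier F" "c\<^sub>1 \<in> carrier F" "c\<^sub>2 \<in> carrier F" "c\<^sub>3 \<in> carrier F" "d \<in> carrier F"
  shows "\<sigma> d \<otimes>\<^bsub>R\<^esub> normal_form c\<^sub>0 c\<^sub>1 c\<^sub>2 c\<^sub>3
    = normal_form (d \<otimes> c\<^sub>0) (d \<otimes> c\<^sub>1) (d \<otimes> c\<^sub>2) (d \<otimes> c\<^sub>3)"
  using assms by (simp add: normal_form_def R.r_distr R.m_assoc)

lemma normal_form_gen0:
  assumes "c\<^sub>0 \<in> carrier F" "c\<^sub>1 \<in> carrier F" "c\<^sub>2 \<in> carrier F" "c\<^sub>3 \<in> carrier F"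
  shows "e\<^sub>0 \<otimes>\<^bsub>R\<^esub> normal_form c\<^sub>0 c\<^sub>1 c\<^sub>2 c\<^sub>3 = normal_form (c\<^sub>1 \<otimes> \<zeta>) c\<^sub>0 (c\<^sub>3 \<otimes> \<zeta>) c\<^sub>2"
  using assms \<sigma>_central[of c\<^sub>0 e\<^sub>0]
  by (simp add: normal_form_def R.r_distr \<sigma>_left_commute[where a = e\<^sub>0] gen_left rel00 R.a_ac R.m_assoc)

lemma normal_form_gen1:
  assumes "c\<^sub>0 \<in> carrier F" "c\<^sub>1 \<in> carrier F" "c\<^sub>2 \<in> carrier F" "c\<^sub>3 \<in> carrier F"
  shows "e\<^sub>1 \<otimes>\<^bsub>R\<^esub> normal_form c\<^sub>0 c\<^sub>1 c\<^sub>2 c\<^sub>3 = normal_form (c\<^sub>2 \<otimes> \<xi>) (\<ominus> (c\<^sub>3 \<otimes> \<xi>)) c\<^sub>0 (\<ominus> c\<^sub>1)"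
  using assms \<sigma>_central[of c\<^sub>0 e\<^sub>1] \<sigma>_central[of \<xi> e\<^sub>0]
  by (simp add: normal_form_def R.r_distr \<sigma>_left_commute[where a = e\<^sub>1] gen_left rel11 R.a_ac R.m_assoc
      R.r_minus R.l_minus)

lemma normal_form_one: "normal_form \<one> \<zero> \<zero> \<zero> = \<one>\<^bsub>R\<^esub>"
  and normal_form_zero: "normal_form \<zero> \<zero> \<zero> \<zero> = \<zero>\<^bsub>R\<^esub>"
  by (simp_all add: normal_form_def)

text \<open>The new coefficients depend only on \<open>F\<close>, \<open>\<zeta>\<close> and
  \<open>\<xi>\<close>, not on \<open>R\<close>. This is what allows one induction on words to serve
  two rings at once.\<close>

lemma normal_form_left:
  assumes c: "c\<^sub>0 \<in> carrier F" "c\<^sub>1 \<in> carrier F" "c\<^sub>2 \<in> carrier F" "c\<^sub>3 \<in> carrier F"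
    and ab: "a \<in> carrier F" "b \<in> carrier F"
  shows "(\<sigma> a \<otimes>\<^bsub>R\<^esub> e\<^sub>0 \<oplus>\<^bsub>R\<^esub> \<sigma> b \<otimes>\<^bsub>R\<^esub> e\<^sub>1) \<otimes>\<^bsub>R\<^esub> normal_form c\<^sub>0 c\<^sub>1 c\<^sub>2 c\<^sub>3
    = normal_form (a \<otimes> (c\<^sub>1 \<otimes> \<zeta>) \<oplus> b \<otimes> (c\<^sub>2 \<otimes> \<xi>)) (a \<otimes> c\<^sub>0 \<oplus> b \<otimes> \<ominus> (c\<^sub>3 \<otimes> \<xi>))
        (a \<otimes> (c\<^sub>3 \<otimes> \<zeta>) \<oplus> b \<otimes> c\<^sub>0) (a \<otimes> c\<^sub>2 \<oplus> b \<otimes> \<ominus> c\<^sub>1)"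
proof -
  have "(\<sigma> a \<otimes>\<^bsub>R\<^esub> e\<^sub>0 \<oplus>\<^bsub>R\<^esub> \<sigma> b \<otimes>\<^bsub>R\<^esub> e\<^sub>1) \<otimes>\<^bsub>R\<^esub> normal_form c\<^sub>0 c\<^sub>1 c\<^sub>2 c\<^sub>3
    = \<sigma> a \<otimes>\<^bsub>R\<^esub> (e\<^sub>0 \<otimes>\<^bsub>R\<^esub> normal_form c\<^sub>0 c\<^sub>1 c\<^sub>2 c\<^sub>3) \<oplus>\<^bsub>R\<^esub> \<sigma> b \<otimes>\<^bsub>R\<^esub> (e\<^sub>1 \<otimes>\<^bsub>R\<^esub> normal_form c\<^sub>0 c\<^sub>1 c\<^sub>2 c\<^sub>3)"
    using c ab by (simp add: R.l_distr R.m_assoc normal_form_closed)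
  then show ?thesis
    using c ab by (simp add: normal_form_gen0 normal_form_gen1 normal_form_scale normal_form_add)
qed

end


section \<open>The Clifford superalgebra of a diagonal form\<close>

text \<open>Vectors are functions on \<open>nat\<close> vanishing from \<open>n\<close> on, to match
  the vector type in \<open>central_order_in_C\<close>.\<close>

definition coordinate_space :: "('f, 'm) ring_scheme \<Rightarrow> nat \<Rightarrow> ('f, nat \<Rightarrow> 'f) module" where
  "coordinate_space F n =
    \<lparr>carrier = {f. (\<forall>i<n. f i \<in> carrier F) \<and> (\<forall>i\<ge>n. f i = \<zero>\<^bsub>F\<^esub>)},
     mult = (\<lambda>f g. f), one = (\<lambda>i. \<zero>\<^bsub>F\<^esub>), zero = (\<lambda>i. \<zero>\<^bsub>F\<^esub>),
     add = (\<lambda>f g i. f i \<oplus>\<^bsub>F\<^esub> g i), smult = (\<lambda>c f i. c \<otimes>\<^bsub>F\<^esub> f i)\<rparr>"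

definition unit_vector :: "('f, 'm) ring_scheme \<Rightarrow> nat \<Rightarrow> nat \<Rightarrow> 'f" where
  "unit_vector F i = (\<lambda>k. if k = i then \<one>\<^bsub>F\<^esub> else \<zero>\<^bsub>F\<^esub>)"

text \<open>One formula serves both dimensions, since the coordinate \<open>f 1\<close> vanishes
  when \<open>n = 1\<close>.\<close>

definition diagonal_form :: "('f, 'm) ring_scheme \<Rightarrow> 'f \<Rightarrow> 'f \<Rightarrow> (nat \<Rightarrow> 'f) \<Rightarrow> 'f" where
  "diagonal_form F \<zeta> \<xi> f =
    f 0 \<otimes>\<^bsub>F\<^esub> f 0 \<otimes>\<^bsub>F\<^esub> \<zeta> \<oplus>\<^bsub>F\<^esub> f 1 \<otimes>\<^bsub>F\<^esub> f 1 \<otimes>\<^bsub>F\<^esub> \<xi>"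

lemma coordinate_space_simps [simp]:
  "zero (coordinate_space F n) = (\<lambda>i. \<zero>\<^bsub>F\<^esub>)"
  "add (coordinate_space F n) = (\<lambda>f g i. f i \<oplus>\<^bsub>F\<^esub> g i)"
  "smult (coordinate_space F n) = (\<lambda>c f i. c \<otimes>\<^bsub>F\<^esub> f i)"
  by (simp_all add: coordinate_space_def)

locale diagonal_quadratic = field F for F (structure) +
  fixes n :: nat and \<zeta> \<xi>
  assumes \<zeta>: "\<zeta> \<in> carrier F" "\<zeta> \<noteq> \<zero>" and \<xi>: "\<xi> \<in> carrier F"
    and n_cases: "n = 1 \<and> \<xi> = \<zero> \<or> n = 2 \<and> \<xi> \<noteq> \<zero>"
    and two_nonzero: "\<one> \<oplus> \<one> \<noteq> \<zero>"
begin

abbreviation V where "V \<equiv> coordinate_space F n"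
abbreviation q where "q \<equiv> diagonal_form F \<zeta> \<xi>"

lemma V_carrier: "f \<in> carrier V \<longleftrightarrow> (\<forall>i<n. f i \<in> carrier F) \<and> (\<forall>i\<ge>n. f i = \<zero>)"
  by (simp add: coordinate_space_def)

lemma V_value [simp]: "f \<in> carrier V \<Longrightarrow> f i \<in> carrier F"
  by (cases "i < n") (auto simp: V_carrier)

lemma V_beyond: "f \<in> carrier V \<Longrightarrow> i \<ge> n \<Longrightarrow> f i = \<zero>"
  by (simp add: V_carrier)

lemma n_pos: "0 < n" and n_le: "n \<le> 2"
  using n_cases by auto

lemma V_closed [simp]:
  "f \<in> carrier V \<Longrightarrow> g \<in> carrier V \<Longrightarrow> (\<lambda>i. f i \<oplus> g i) \<in> carrier V"
  "c \<in> carrier F \<Longrightarrow> f \<in> carrier V \<Longrightarrow> (\<lambda>i. c \<otimes> f i) \<in> carrier V"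
  "i < n \<Longrightarrow> unit_vector F i \<in> carrier V"
  by (auto simp: V_carrier unit_vector_def)

lemma module_V: "Module.module F V"
proof (rule moduleI)
  show "abelian_group V"
  proof (rule abelian_groupI)
    fix f assume f: "f \<in> carrier V"
    have "(\<lambda>i. \<ominus> f i) \<in> carrier V" using f by (auto simp: V_carrier)
    then show "\<exists>g\<in>carrier V. g \<oplus>\<^bsub>V\<^esub> f = \<zero>\<^bsub>V\<^esub>" using f by (intro bexI) (auto simp: l_neg)
  qed (auto simp: a_ac V_carrier)
qed (auto simp: is_cring l_distr r_distr m_assoc)

lemma q_closed: "f \<in> carrier V \<Longrightarrow> q f \<in> carrier F"
  using \<zeta> \<xi> by (simp add: diagonal_form_def)

lemma polar_q:
  assumes "f \<in> carrier V" "g \<in> carrier V"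
  shows "polar_form F V q f g = (f 0 \<otimes> g 0 \<otimes> \<zeta> \<oplus> f 0 \<otimes> g 0 \<otimes> \<zeta>) \<oplus> (f 1 \<otimes> g 1 \<otimes> \<xi> \<oplus> f 1 \<otimes> g 1 \<otimes> \<xi>)"
proof -
  have "((a \<oplus> c) \<otimes> (a \<oplus> c) \<otimes> s \<oplus> (b \<oplus> d) \<otimes> (b \<oplus> d) \<otimes> t) \<ominus> (a \<otimes> a \<otimes> s \<oplus> b \<otimes> b \<otimes> t)
      \<ominus> (c \<otimes> c \<otimes> s \<oplus> d \<otimes> d \<otimes> t) = (a \<otimes> c \<otimes> s \<oplus> a \<otimes> c \<otimes> s) \<oplus> (b \<otimes> d \<otimes> t \<oplus> b \<otimes> d \<otimes> t)"
    if "a \<in> carrier F" "b \<in> carrier F" "c \<in> carrier F" "d \<in> carrier F" "s \<in> carrier F" "t \<in> carrier F"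
    for a b c d s t
    using that by algebra
  then show ?thesis using assms \<zeta> \<xi> by (simp add: polar_form_def diagonal_form_def)
qed

lemma quadratic_space_V: "quadratic_space F V q"
proof -
  interpret V: Module.module F V by (rule module_V)
  show ?thesis
  proof unfold_locales
    fix f g h assume f: "f \<in> carrier V" and g: "g \<in> carrier V" and h: "h \<in> carrier V"
    have "((a \<oplus> c) \<otimes> e \<otimes> s \<oplus> (a \<oplus> c) \<otimes> e \<otimes> s) \<oplus> ((b \<oplus> d) \<otimes> p \<otimes> t \<oplus> (b \<oplus> d) \<otimes> p \<otimes> t)
      = (a \<otimes> e \<otimes> s \<oplus> a \<otimes> e \<otimes> s) \<oplus> (b \<otimes> p \<otimes> t \<oplus> b \<otimes> p \<otimes> t)
        \<oplus> ((c \<otimes> e \<otimes> s \<oplus> c \<otimes> e \<otimes> s) \<oplus> (d \<otimes> p \<otimes> t \<oplus> d \<otimes> p \<otimes> t))"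
      if "a \<in> carrier F" "b \<in> carrier F" "c \<in> carrier F" "d \<in> carrier F" "e \<in> carrier F"
        "p \<in> carrier F" "s \<in> carrier F" "t \<in> carrier F" for a b c d e p s t
      using that by algebra
    then show "polar_form F V q (f \<oplus>\<^bsub>V\<^esub> g) h = polar_form F V q f h \<oplus> polar_form F V q g h"
      using f g h \<zeta> \<xi> by (simp add: polar_q)
  next
    fix c f g assume c: "c \<in> carrier F" and f: "f \<in> carrier V" and g: "g \<in> carrier V"
    have "(c \<otimes> a \<otimes> e \<otimes> s \<oplus> c \<otimes> a \<otimes> e \<otimes> s) \<oplus> (c \<otimes> b \<otimes> p \<otimes> t \<oplus> c \<otimes> b \<otimes> p \<otimes> t)
      = c \<otimes> ((a \<otimes> e \<otimes> s \<oplus> a \<otimes> e \<otimes> s) \<oplus> (b \<otimes> p \<otimes> t \<oplus> b \<otimes> p \<otimes> t))"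
      if "a \<in> carrier F" "b \<in> carrier F" "e \<in> carrier F"
        "p \<in> carrier F" "s \<in> carrier F" "t \<in> carrier F" for a b e p s t
      using that c by algebra
    then show "polar_form F V q (c \<odot>\<^bsub>V\<^esub> f) g = c \<otimes> polar_form F V q f g"
      using c f g \<zeta> \<xi> by (simp add: polar_q)
  next
    fix c f assume c: "c \<in> carrier F" and f: "f \<in> carrier V"
    have "c \<otimes> a \<otimes> (c \<otimes> a) \<otimes> s \<oplus> c \<otimes> b \<otimes> (c \<otimes> b) \<otimes> t = c \<otimes> c \<otimes> (a \<otimes> a \<otimes> s \<oplus> b \<otimes> b \<otimes> t)"
      if "a \<in> carrier F" "b \<in> carrier F" "s \<in> carrier F" "t \<in> carrier F" for a b s t
      using that c by algebra
    then show "q (c \<odot>\<^bsub>V\<^esub> f) = c \<otimes> c \<otimes> q f"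
      using c f \<zeta> \<xi> by (simp add: diagonal_form_def)
  qed (rule q_closed)
qed

lemma double_zero_F: "a \<in> carrier F \<Longrightarrow> a \<oplus> a = \<zero> \<Longrightarrow> a = \<zero>"
proof -
  assume a: "a \<in> carrier F" "a \<oplus> a = \<zero>"
  then have "(\<one> \<oplus> \<one>) \<otimes> a = \<zero>" by (simp add: l_distr)
  then show "a = \<zero>" using integral[of "\<one> \<oplus> \<one>" a] a two_nonzero by simp
qed

text \<open>Pairing with a unit vector returns twice the coordinate times \<open>\<zeta>\<close> or
  \<open>\<xi>\<close>, so characteristic different from 2 enters here.\<close>

lemma nondegenerate_V: "nondegenerate_form F V q"
  unfolding nondegenerate_form_def
proof (intro ballI impI)
  fix f assume f: "f \<in> carrier V" and zero: "\<forall>g\<in>carrier V. polar_form F V q f g = \<zero>"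
  have "f 0 = \<zero>"
  proof -
    have "polar_form F V q f (unit_vector F 0) = \<zero>" using zero n_pos by simp
    then have "f 0 \<otimes> \<zeta> \<oplus> f 0 \<otimes> \<zeta> = \<zero>"
      using f \<zeta> \<xi> n_pos by (simp add: polar_q) (simp add: unit_vector_def)
    then have "f 0 \<otimes> \<zeta> = \<zero>" by (rule double_zero_F[rotated]) (use f \<zeta> in simp)
    then show ?thesis using integral[of "f 0" \<zeta>] f \<zeta> by simp
  qed
  moreover have "f 1 = \<zero>"
  proof (cases "n = 1")
    case True
    then show ?thesis using V_beyond[OF f] by simp
  next
    case False
    then have n: "1 < n" "\<xi> \<noteq> \<zero>" using n_cases by auto
    have "polar_form F V q f (unit_vector F 1) = \<zero>" using zero n by simp
    then have "f 1 \<otimes> \<xi> \<oplus> f 1 \<otimes> \<xi> = \<zero>"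
      using f \<zeta> \<xi> n V_closed(3)[of 1] by (simp add: polar_q) (simp add: unit_vector_def)
    then have "f 1 \<otimes> \<xi> = \<zero>" by (rule double_zero_F[rotated]) (use f \<xi> in simp)
    then show ?thesis using integral[of "f 1" \<xi>] f \<xi> n by simp
  qed
  moreover have "f i = \<zero>" if "2 \<le> i" for i using V_beyond[OF f, of i] n_le that by simp
  ultimately have "f i = \<zero>" for i by (metis One_nat_def less_2_cases not_less)
  then show "f = \<zero>\<^bsub>V\<^esub>" by auto
qed

lemma has_dimension_V: "has_dimension F V n"
proof -
  interpret V: Module.module F V by (rule module_V)
  have sum: "(\<Oplus>\<^bsub>V\<^esub>i\<in>{..<m}. c i \<odot>\<^bsub>V\<^esub> unit_vector F i) = (\<lambda>k. if k < m then c k else \<zero>)"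
    if "m \<le> n" "\<And>i. i < m \<Longrightarrow> c i \<in> carrier F" for m c
    using that
  proof (induction m)
    case (Suc m)
    have cl: "(\<lambda>i. c i \<odot>\<^bsub>V\<^esub> unit_vector F i) \<in> {..<m} \<rightarrow> carrier V"
      using Suc.prems by auto
    have cm: "c m \<odot>\<^bsub>V\<^esub> unit_vector F m \<in> carrier V" using Suc.prems by simp
    have "(\<Oplus>\<^bsub>V\<^esub>i\<in>insert m {..<m}. c i \<odot>\<^bsub>V\<^esub> unit_vector F i)
        = c m \<odot>\<^bsub>V\<^esub> unit_vector F m \<oplus>\<^bsub>V\<^esub> (\<Oplus>\<^bsub>V\<^esub>i\<in>{..<m}. c i \<odot>\<^bsub>V\<^esub> unit_vector F i)"
      by (rule V.finsum_insert) (use cl cm in auto)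
    also have "\<dots> = (\<lambda>k. if k < Suc m then c k else \<zero>)"
    proof -
      have "(\<Oplus>\<^bsub>V\<^esub>i\<in>{..<m}. c i \<odot>\<^bsub>V\<^esub> unit_vector F i) = (\<lambda>k. if k < m then c k else \<zero>)"
        using Suc.prems by (intro Suc.IH) auto
      then show ?thesis using Suc.prems by (auto simp: unit_vector_def less_Suc_eq fun_eq_iff)
    qed
    finally show ?case by (simp add: lessThan_Suc)
  qed simp
  show ?thesis
    unfolding has_dimension_def
  proof (intro exI[of _ "unit_vector F"] conjI allI impI ballI)
    fix f assume f: "f \<in> carrier V"
    show "\<exists>!c. c \<in> {..<n} \<rightarrow>\<^sub>E carrier F \<and> f = (\<Oplus>\<^bsub>V\<^esub>i\<in>{..<n}. c i \<odot>\<^bsub>V\<^esub> unit_vector F i)"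
    \<comment> \<open>Coefficient families are extensional, so the coordinates must be cut off to
      \<open>undefined\<close> outside the index set.\<close>
    proof (rule ex1I[of _ "restrict f {..<n}"])
      have "(\<Oplus>\<^bsub>V\<^esub>i\<in>{..<n}. restrict f {..<n} i \<odot>\<^bsub>V\<^esub> unit_vector F i) =
          (\<lambda>k. if k < n then restrict f {..<n} k else \<zero>)"
        using f by (intro sum) auto
      also have "\<dots> = f" using V_beyond[OF f] by (auto simp: not_less)
      finally show "restrict f {..<n} \<in> {..<n} \<rightarrow>\<^sub>E carrier F \<and>
          f = (\<Oplus>\<^bsub>V\<^esub>i\<in>{..<n}. restrict f {..<n} i \<odot>\<^bsub>V\<^esub> unit_vector F i)"
        using f by auto
      fix c assume c: "c \<in> {..<n} \<rightarrow>\<^sub>E carrier F \<and> f = (\<Oplus>\<^bsub>V\<^esub>i\<in>{..<n}. c i \<odot>\<^bsub>V\<^esub> unit_vector F i)"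
      then have "(\<Oplus>\<^bsub>V\<^esub>i\<in>{..<n}. c i \<odot>\<^bsub>V\<^esub> unit_vector F i) = (\<lambda>k. if k < n then c k else \<zero>)"
        by (intro sum) auto
      then have "f = (\<lambda>k. if k < n then c k else \<zero>)" using c by simp
      then show "c = restrict f {..<n}"
        using c by (auto simp: fun_eq_iff restrict_def PiE_def extensional_def)
    qed
  qed (use V_closed(3) in simp)
qed

end


section \<open>Recognizing the Clifford superalgebra of a diagonal form\<close>

lemma (in ring) anticommute_of_square_add:
  assumes "a \<in> carrier R" "b \<in> carrier R" "(a \<oplus> b) \<otimes> (a \<oplus> b) = a \<otimes> a \<oplus> b \<otimes> b"
  shows "a \<otimes> b \<oplus> b \<otimes> a = \<zero>"
proof -
  have "(a \<otimes> a \<oplus> b \<otimes> b) \<oplus> (a \<otimes> b \<oplus> b \<otimes> a) = (a \<oplus> b) \<otimes> (a \<oplus> b)"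
    using assms(1,2) by (simp add: l_distr r_distr a_ac)
  also note assms(3)
  finally show ?thesis using assms(1,2) by (simp add: add.l_cancel_one)
qed

lemma clifford_superalg_simps:
  assumes "I = Idl\<^bsub>free_algebra F (carrier V)\<^esub> (clifford_relations F V q)"
  shows "carrier (clifford_superalg F V q) = carrier (free_algebra F (carrier V) Quot I)"
    "mult (clifford_superalg F V q) = mult (free_algebra F (carrier V) Quot I)"
    "one (clifford_superalg F V q) = one (free_algebra F (carrier V) Quot I)"
    "zero (clifford_superalg F V q) = zero (free_algebra F (carrier V) Quot I)"
    "add (clifford_superalg F V q) = add (free_algebra F (carrier V) Quot I)"
    "smult (clifford_superalg F V q) =
      (\<lambda>c X. \<Union>f\<in>X. I +>\<^bsub>free_algebra F (carrier V)\<^esub> (c \<odot>\<^bsub>free_algebra F (carrier V)\<^esub> f))"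
    "component (clifford_superalg F V q) = (\<lambda>i. {I +>\<^bsub>free_algebra F (carrier V)\<^esub> f | f.
      f \<in> carrier (free_algebra F (carrier V)) \<and> (\<forall>w. f w \<noteq> \<zero>\<^bsub>F\<^esub> \<longrightarrow> of_nat (length w) = i)})"
  by (simp_all add: clifford_superalg_def Let_def assms)

text \<open>An abstract description of the localization: the field is literally a subring of
  \<open>B\<close>, as the fractions over \<open>Z\<close> are, and the frame spans each component
  and is independent. Independence of the terms in \<open>x\<close> is demanded only for
  \<open>n = 2\<close>, as \<open>x\<close> vanishes for \<open>n = 1\<close>.\<close>

locale clifford_target = diagonal_quadratic F n \<zeta> \<xi> + B: ring B
  for F :: "'f ring" (structure) and n \<zeta> \<xi> and B :: "('f, 'f) superalg" +
  fixes u x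
  assumes F_subset: "carrier F \<subseteq> carrier B"
    and F_ops: "mult F = mult B" "one F = one B" "zero F = zero B" "add F = add B"
    and smult_B: "c \<in> carrier F \<Longrightarrow> b \<in> carrier B \<Longrightarrow> c \<odot>\<^bsub>B\<^esub> b = c \<otimes>\<^bsub>B\<^esub> b"
    and F_central: "c \<in> carrier F \<Longrightarrow> b \<in> carrier B \<Longrightarrow> c \<otimes>\<^bsub>B\<^esub> b = b \<otimes>\<^bsub>B\<^esub> c"
    and uu: "u \<otimes>\<^bsub>B\<^esub> u = \<zeta>" and xx: "x \<otimes>\<^bsub>B\<^esub> x = \<xi>" and x1: "n = 1 \<Longrightarrow> x = \<zero>"
    and ux: "u \<otimes>\<^bsub>B\<^esub> x \<oplus>\<^bsub>B\<^esub> x \<otimes>\<^bsub>B\<^esub> u = \<zero>"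
    and comp_subset: "component B i \<subseteq> carrier B"
    and comp_zero: "\<zero> \<in> component B i"
    and comp_add: "a \<in> component B i \<Longrightarrow> b \<in> component B i \<Longrightarrow> a \<oplus>\<^bsub>B\<^esub> b \<in> component B i"
    and comp_mult: "a \<in> component B i \<Longrightarrow> b \<in> component B k \<Longrightarrow> a \<otimes>\<^bsub>B\<^esub> b \<in> component B (i + k)"
    and comp_F: "carrier F \<subseteq> component B 0"
    and comp_gen: "u \<in> component B 1" "x \<in> component B 1"
    and comp_sum: "b \<in> carrier B \<Longrightarrow> \<exists>c\<in>component B 0. \<exists>d\<in>component B 1. b = c \<oplus>\<^bsub>B\<^esub> d"
    and comp_even: "b \<in> component B 0 \<Longrightarrow> \<exists>c\<in>carrier F. \<exists>d\<in>carrier F. b = c \<oplus>\<^bsub>B\<^esub> d \<otimes>\<^bsub>B\<^esub> (u \<otimes>\<^bsub>B\<^esub> x)"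
    and comp_odd: "b \<in> component B 1 \<Longrightarrow> \<exists>c\<in>carrier F. \<exists>d\<in>carrier F. b = c \<otimes>\<^bsub>B\<^esub> u \<oplus>\<^bsub>B\<^esub> d \<otimes>\<^bsub>B\<^esub> x"
    and indep: "c\<^sub>0 \<in> carrier F \<Longrightarrow> c\<^sub>1 \<in> carrier F \<Longrightarrow> c\<^sub>2 \<in> carrier F \<Longrightarrow> c\<^sub>3 \<in> carrier F \<Longrightarrow>
      c\<^sub>0 \<oplus>\<^bsub>B\<^esub> (c\<^sub>1 \<otimes>\<^bsub>B\<^esub> u \<oplus>\<^bsub>B\<^esub> (c\<^sub>2 \<otimes>\<^bsub>B\<^esub> x \<oplus>\<^bsub>B\<^esub> c\<^sub>3 \<otimes>\<^bsub>B\<^esub> (u \<otimes>\<^bsub>B\<^esub> x))) = \<zero> \<Longrightarrow>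
      c\<^sub>0 = \<zero> \<and> c\<^sub>1 = \<zero> \<and> (n = 2 \<longrightarrow> c\<^sub>2 = \<zero> \<and> c\<^sub>3 = \<zero>)"
begin

lemma F_in_B: "c \<in> carrier F \<Longrightarrow> c \<in> carrier B"
  using F_subset by blast

lemma gen_closed: "u \<in> carrier B" "x \<in> carrier B"
  using comp_gen comp_subset by blast+

definition emb where "emb v = v 0 \<otimes>\<^bsub>B\<^esub> u \<oplus>\<^bsub>B\<^esub> v 1 \<otimes>\<^bsub>B\<^esub> x"

text \<open>A constant for the inclusion keeps the simplifier from rewriting the operations of \<open>F\<close>
  into those of \<open>B\<close>.\<close>

definition incl :: "'f \<Rightarrow> 'f" where "incl c = c"

lemma incl_hom: "incl \<in> ring_hom F B"
  by (rule ring_hom_memI) (simp_all add: F_in_B F_ops incl_def)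

sublocale ev: free_alg_eval F "carrier V" B incl emb
proof unfold_locales
  show "incl c \<otimes>\<^bsub>B\<^esub> b = b \<otimes>\<^bsub>B\<^esub> incl c" if "c \<in> carrier F" "b \<in> carrier B" for c b
    unfolding incl_def by (rule F_central[OF that])
  show "emb v \<in> carrier B" if "v \<in> carrier V" for v
    using that by (simp add: emb_def F_in_B gen_closed)
qed (rule incl_hom)

sublocale inB: clifford_relations_in B F incl \<zeta> \<xi> u x
proof unfold_locales
  show "incl c \<otimes>\<^bsub>B\<^esub> b = b \<otimes>\<^bsub>B\<^esub> incl c" if "c \<in> carrier F" "b \<in> carrier B" for c b
    unfolding incl_def by (rule F_central[OF that])
  show "u \<otimes>\<^bsub>B\<^esub> x \<oplus>\<^bsub>B\<^esub> x \<otimes>\<^bsub>B\<^esub> u = \<zero>\<^bsub>B\<^esub>" using ux by (simp only: F_ops)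
  show "u \<otimes>\<^bsub>B\<^esub> u = incl \<zeta>" "x \<otimes>\<^bsub>B\<^esub> x = incl \<xi>" using uu xx by (simp_all only: incl_def)
qed (fact incl_hom \<zeta> \<xi> gen_closed)+

abbreviation T where "T \<equiv> free_algebra F (carrier V)"
abbreviation I where "I \<equiv> Idl\<^bsub>T\<^esub> (clifford_relations F V q)"

sublocale T: ring T by (rule ev.ring_T)

sublocale evh: ring_hom_ring T B ev.eval
  by (rule ring_hom_ringI2) (simp_all add: T.ring_axioms B.ring_axioms ev.eval_ring_hom)

lemma gen_T: "v \<in> carrier V \<Longrightarrow> free_gen F v \<in> carrier T"
  by (simp add: free_gen_monomial ev.monomial_closed)

lemma scal_T: "c \<in> carrier F \<Longrightarrow> monomial F c [] \<in> carrier T"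
  by (simp add: ev.monomial_closed)

lemma eval_gen: "v \<in> carrier V \<Longrightarrow> ev.eval (free_gen F v) = emb v"
  by (simp add: free_gen_monomial ev.eval_monomial ev.j_closed)

lemma eval_scal: "c \<in> carrier F \<Longrightarrow> ev.eval (monomial F c []) = c"
  by (simp add: ev.eval_monomial) (simp add: incl_def F_in_B)

lemma emb_closed [simp]: "v \<in> carrier V \<Longrightarrow> emb v \<in> carrier B"
  by (rule ev.j_closed)

lemma emb_square: "v \<in> carrier V \<Longrightarrow> emb v \<otimes>\<^bsub>B\<^esub> emb v = q v"
proof -
  assume v: "v \<in> carrier V"
  have nf: "emb v = inB.normal_form \<zero> (v 0) (v 1) \<zero>"
    using v gen_closed by (simp add: inB.normal_form_def) (simp add: emb_def F_in_B incl_def)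
  have emb: "emb v = incl (v 0) \<otimes>\<^bsub>B\<^esub> u \<oplus>\<^bsub>B\<^esub> incl (v 1) \<otimes>\<^bsub>B\<^esub> x"
    by (simp add: emb_def incl_def)
  have "emb v \<otimes>\<^bsub>B\<^esub> emb v
      = (incl (v 0) \<otimes>\<^bsub>B\<^esub> u \<oplus>\<^bsub>B\<^esub> incl (v 1) \<otimes>\<^bsub>B\<^esub> x) \<otimes>\<^bsub>B\<^esub> inB.normal_form \<zero> (v 0) (v 1) \<zero>"
    by (simp only: nf[symmetric] emb[symmetric])
  also have "\<dots> = inB.normal_form (v 0 \<otimes> (v 0 \<otimes> \<zeta>) \<oplus> v 1 \<otimes> (v 1 \<otimes> \<xi>)) (v 0 \<otimes> \<zero> \<oplus> v 1 \<otimes> \<ominus> (\<zero> \<otimes> \<xi>))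
      (v 0 \<otimes> (\<zero> \<otimes> \<zeta>) \<oplus> v 1 \<otimes> \<zero>) (v 0 \<otimes> v 1 \<oplus> v 1 \<otimes> \<ominus> (v 0))"
    using v \<zeta> \<xi> by (intro inB.normal_form_left) simp_all
  also have "\<dots> = inB.normal_form (q v) \<zero> \<zero> \<zero>"
  proof -
    have "v 0 \<otimes> v 1 \<oplus> v 1 \<otimes> \<ominus> (v 0) = \<zero>"
      using v by (simp add: r_minus m_comm[of "v (Suc 0)" "v 0"] r_neg)
    then show ?thesis using v \<zeta> \<xi> by (simp add: diagonal_form_def m_assoc)
  qed
  also have "\<dots> = q v"
    using q_closed[OF v] gen_closed by (simp add: inB.normal_form_def) (simp add: incl_def)
  finally show ?thesis .
qed

text \<open>Scalar multiples are rewritten as products with \<open>monomial F c []\<close>, so that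
  ring homomorphisms can be applied to the relations.\<close>

lemma relation_cases:
  assumes "t \<in> clifford_relations F V q"
  obtains (add) v w where "v \<in> carrier V" "w \<in> carrier V"
      "t = free_gen F (v \<oplus>\<^bsub>V\<^esub> w) \<ominus>\<^bsub>T\<^esub> (free_gen F v \<oplus>\<^bsub>T\<^esub> free_gen F w)"
    | (scale) c v where "c \<in> carrier F" "v \<in> carrier V"
      "t = free_gen F (c \<odot>\<^bsub>V\<^esub> v) \<ominus>\<^bsub>T\<^esub> monomial F c [] \<otimes>\<^bsub>T\<^esub> free_gen F v"
    | (square) v where "v \<in> carrier V"
      "t = free_gen F v \<otimes>\<^bsub>T\<^esub> free_gen F v \<ominus>\<^bsub>T\<^esub> monomial F (q v) []"
proof -
  have one: "q v \<odot>\<^bsub>T\<^esub> \<one>\<^bsub>T\<^esub> = monomial F (q v) []" if "v \<in> carrier V" for v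
    using q_closed[OF that] by (auto simp: monomial_def)
  show thesis
    using assms add scale square one ev.T_smult[OF _ gen_T]
    unfolding clifford_relations_def Let_def by fastforce
qed

lemma relation_members:
  "v \<in> carrier V \<Longrightarrow> w \<in> carrier V \<Longrightarrow>
    free_gen F (v \<oplus>\<^bsub>V\<^esub> w) \<ominus>\<^bsub>T\<^esub> (free_gen F v \<oplus>\<^bsub>T\<^esub> free_gen F w) \<in> clifford_relations F V q"
  "c \<in> carrier F \<Longrightarrow> v \<in> carrier V \<Longrightarrow>
    free_gen F (c \<odot>\<^bsub>V\<^esub> v) \<ominus>\<^bsub>T\<^esub> monomial F c [] \<otimes>\<^bsub>T\<^esub> free_gen F v \<in> clifford_relations F V q"
  "v \<in> carrier V \<Longrightarrow>
    free_gen F v \<otimes>\<^bsub>T\<^esub> free_gen F v \<ominus>\<^bsub>T\<^esub> monomial F (q v) [] \<in> clifford_relations F V q"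
proof -
  have one: "q v \<odot>\<^bsub>T\<^esub> \<one>\<^bsub>T\<^esub> = monomial F (q v) []" if "v \<in> carrier V" for v
    using q_closed[OF that] by (auto simp: monomial_def)
  show "v \<in> carrier V \<Longrightarrow> w \<in> carrier V \<Longrightarrow>
    free_gen F (v \<oplus>\<^bsub>V\<^esub> w) \<ominus>\<^bsub>T\<^esub> (free_gen F v \<oplus>\<^bsub>T\<^esub> free_gen F w) \<in> clifford_relations F V q"
    unfolding clifford_relations_def Let_def by blast
  show "c \<in> carrier F \<Longrightarrow> v \<in> carrier V \<Longrightarrow>
    free_gen F (c \<odot>\<^bsub>V\<^esub> v) \<ominus>\<^bsub>T\<^esub> monomial F c [] \<otimes>\<^bsub>T\<^esub> free_gen F v \<in> clifford_relations F V q"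
    unfolding clifford_relations_def Let_def using ev.T_smult[OF _ gen_T, of c v] by auto
  show "v \<in> carrier V \<Longrightarrow>
    free_gen F v \<otimes>\<^bsub>T\<^esub> free_gen F v \<ominus>\<^bsub>T\<^esub> monomial F (q v) [] \<in> clifford_relations F V q"
    unfolding clifford_relations_def Let_def using one[of v] by force
qed

lemma relations_closed: "clifford_relations F V q \<subseteq> carrier T"
proof
  fix t assume "t \<in> clifford_relations F V q"
  then show "t \<in> carrier T"
    by (cases rule: relation_cases)
       (simp_all only: T.minus_closed T.add.m_closed T.m_closed gen_T scal_T q_closed
         V_closed coordinate_space_simps)
qed

sublocale I: ideal I T
  by (rule T.genideal_ideal[OF relations_closed])

lemma I_subset_kernel: "I \<subseteq> a_kernel T B ev.eval"
proof (rule T.genideal_minimal[OF evh.kernel_is_ideal])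
  show "clifford_relations F V q \<subseteq> a_kernel T B ev.eval"
  proof
    fix t assume t: "t \<in> clifford_relations F V q"
    have minus: "ev.eval (a \<ominus>\<^bsub>T\<^esub> b) = \<zero>\<^bsub>B\<^esub>"
      if "a \<in> carrier T" "b \<in> carrier T" "ev.eval a = ev.eval b" for a b
      using that by (simp only: T.minus_eq evh.hom_add T.a_inv_closed evh.hom_a_inv B.r_neg evh.hom_closed)
    note cl = gen_T scal_T q_closed V_closed T.add.m_closed T.m_closed coordinate_space_simps(2,3)
    from t have "ev.eval t = \<zero>\<^bsub>B\<^esub>"
    proof (cases rule: relation_cases)
      case (add v w)
      show ?thesis unfolding add(3)
      proof (rule minus)
        show "ev.eval (free_gen F (v \<oplus>\<^bsub>V\<^esub> w)) = ev.eval (free_gen F v \<oplus>\<^bsub>T\<^esub> free_gen F w)"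
          using add(1,2) gen_closed
          by (simp add: eval_gen evh.hom_add gen_T del: free_algebra_simps)
             (simp add: emb_def F_ops F_in_B B.l_distr B.a_ac)
      qed (use add(1,2) in \<open>simp_all only: cl\<close>)
    next
      case (scale c v)
      show ?thesis unfolding scale(3)
      proof (rule minus)
        show "ev.eval (free_gen F (c \<odot>\<^bsub>V\<^esub> v)) = ev.eval (monomial F c [] \<otimes>\<^bsub>T\<^esub> free_gen F v)"
          using scale(1,2) gen_closed
          by (simp add: eval_gen eval_scal evh.hom_mult gen_T scal_T)
             (simp add: emb_def F_ops F_in_B B.r_distr B.m_assoc)
      qed (use scale(1,2) in \<open>simp_all only: cl\<close>)
    next
      case (square v)
      show ?thesis unfolding square(2)
      proof (rule minus)
        show "ev.eval (free_gen F v \<otimes>\<^bsub>T\<^esub> free_gen F v) = ev.eval (monomial F (q v) [])"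
          using square(1) by (simp add: eval_gen eval_scal evh.hom_mult gen_T q_closed emb_square)
      qed (use square(1) in \<open>simp_all only: cl\<close>)
    qed
    then show "t \<in> a_kernel T B ev.eval"
      unfolding a_kernel_def' using subsetD[OF relations_closed t] by blast
  qed
qed

abbreviation C where "C \<equiv> T Quot I"

definition cls where "cls f = I +>\<^bsub>T\<^esub> f"
definition scal where "scal c = cls (monomial F c [])"
text \<open>For \<open>n = 1\<close> there is no second unit vector in the space, and zero takes its
  place.\<close>

definition gen1 where "gen1 = (if n = 2 then cls (free_gen F (unit_vector F 1)) else \<zero>\<^bsub>C\<^esub>)"

sublocale cl: ring_hom_ring T C cls
  unfolding cls_def[abs_def] by (rule I.rcos_ring_hom_ring)

lemma gen1_two: "n = 2 \<Longrightarrow> gen1 = cls (free_gen F (unit_vector F 1))"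
  unfolding gen1_def by (rule if_P)

lemma gen1_one: "n \<noteq> 2 \<Longrightarrow> gen1 = \<zero>\<^bsub>C\<^esub>"
  unfolding gen1_def by (rule if_not_P)

lemma cls_eq: "a \<in> carrier T \<Longrightarrow> b \<in> carrier T \<Longrightarrow> a \<ominus>\<^bsub>T\<^esub> b \<in> I \<Longrightarrow> cls a = cls b"
  unfolding cls_def using T.quotient_eq_iff_same_a_r_cos[OF I.ideal_axioms] by blast

lemma cls_gen_add: "v \<in> carrier V \<Longrightarrow> w \<in> carrier V \<Longrightarrow>
    cls (free_gen F (v \<oplus>\<^bsub>V\<^esub> w)) = cls (free_gen F v) \<oplus>\<^bsub>C\<^esub> cls (free_gen F w)"
proof -
  assume v: "v \<in> carrier V" "w \<in> carrier V"
  have "v \<oplus>\<^bsub>V\<^esub> w \<in> carrier V" using v by simp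
  then show ?thesis
    using cls_eq[OF _ _ subsetD[OF T.genideal_self[OF relations_closed] relation_members(1)[OF v]]]
      cl.hom_add[OF v[THEN gen_T]] v[THEN gen_T] gen_T by (metis T.add.m_closed)
qed

lemma cls_gen_scale: "c \<in> carrier F \<Longrightarrow> v \<in> carrier V \<Longrightarrow>
    cls (free_gen F (c \<odot>\<^bsub>V\<^esub> v)) = scal c \<otimes>\<^bsub>C\<^esub> cls (free_gen F v)"
proof -
  assume v: "c \<in> carrier F" "v \<in> carrier V"
  have "c \<odot>\<^bsub>V\<^esub> v \<in> carrier V" using v by simp
  then show ?thesis
    using cls_eq[OF _ _ subsetD[OF T.genideal_self[OF relations_closed] relation_members(2)[OF v]]]
      cl.hom_mult[OF scal_T[OF v(1)] gen_T[OF v(2)]] v scal_T gen_T by (metis T.m_closed scal_def)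
qed

lemma cls_gen_square: "v \<in> carrier V \<Longrightarrow>
    cls (free_gen F v) \<otimes>\<^bsub>C\<^esub> cls (free_gen F v) = scal (q v)"
  using cls_eq[OF _ _ subsetD[OF T.genideal_self[OF relations_closed] relation_members(3)], of v]
  by (simp add: gen_T scal_T q_closed scal_def cl.hom_mult del: free_algebra_simps)

lemma scal_hom: "scal \<in> ring_hom F C"
proof (rule ring_hom_memI)
  show "scal c \<in> carrier C" if "c \<in> carrier F" for c
    using cl.hom_closed[OF scal_T[OF that]] by (simp add: scal_def)
  show "scal (c \<otimes> d) = scal c \<otimes>\<^bsub>C\<^esub> scal d" if "c \<in> carrier F" "d \<in> carrier F" for c d
    using cl.hom_mult[OF scal_T[OF that(1)] scal_T[OF that(2)]] ev.monomial_mult[OF that, of "[]" "[]"]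
    by (simp add: scal_def)
  show "scal (c \<oplus> d) = scal c \<oplus>\<^bsub>C\<^esub> scal d" if "c \<in> carrier F" "d \<in> carrier F" for c d
  proof -
    have "monomial F (c \<oplus> d) [] = monomial F c [] \<oplus>\<^bsub>T\<^esub> monomial F d []"
      by (auto simp: monomial_def fun_eq_iff)
    then show ?thesis
      using cl.hom_add[OF scal_T[OF that(1)] scal_T[OF that(2)]] by (simp only: scal_def)
  qed
  show "scal \<one> = \<one>\<^bsub>C\<^esub>" using cl.hom_one by (simp add: scal_def)
qed

lemma scal_central:
  assumes c: "c \<in> carrier F" and b: "b \<in> carrier C"
  shows "scal c \<otimes>\<^bsub>C\<^esub> b = b \<otimes>\<^bsub>C\<^esub> scal c"
proof -
  obtain f where f: "f \<in> carrier T" "b = cls f"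
    using b unfolding cls_def FactRing_def A_RCOSETS_def' by auto
  have "monomial F c [] \<otimes>\<^bsub>T\<^esub> f = f \<otimes>\<^bsub>T\<^esub> monomial F c []"
  proof
    fix w
    have "(f \<otimes>\<^bsub>T\<^esub> monomial F c []) w = f w \<otimes> c"
      unfolding ev.T_mult
      by (rule finsum_single[where i = "length w"]) (use f c in \<open>auto simp: monomial_def\<close>)
    moreover have "(monomial F c [] \<otimes>\<^bsub>T\<^esub> f) w = c \<otimes> f w"
      using ev.T_smult[OF c f(1)] by (metis free_algebra_simps(4))
    ultimately show "(monomial F c [] \<otimes>\<^bsub>T\<^esub> f) w = (f \<otimes>\<^bsub>T\<^esub> monomial F c []) w"
      using c f(1) by (simp add: m_comm)
  qed
  then show ?thesis
    unfolding f(2) scal_def using cl.hom_mult[OF scal_T[OF c] f(1)] cl.hom_mult[OF f(1) scal_T[OF c]] by simp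
qed

lemma scal_zero: "scal \<zero> = \<zero>\<^bsub>C\<^esub>"
  by (rule ring_hom_zero[OF scal_hom ring_axioms I.quotient_is_ring])

lemma V_decomp:
  assumes v: "v \<in> carrier V"
  shows "cls (free_gen F v) = scal (v 0) \<otimes>\<^bsub>C\<^esub> cls (free_gen F (unit_vector F 0)) \<oplus>\<^bsub>C\<^esub> scal (v 1) \<otimes>\<^bsub>C\<^esub> gen1"
proof (cases "n = 2")
  case True
  then have n: "0 < n" "1 < n" by simp_all
  have e: "unit_vector F 0 \<in> carrier V" "unit_vector F 1 \<in> carrier V"
    by (rule V_closed(3)[OF n(1)], rule V_closed(3)[OF n(2)])
  have "v i = (v 0 \<odot>\<^bsub>V\<^esub> unit_vector F 0 \<oplus>\<^bsub>V\<^esub> v 1 \<odot>\<^bsub>V\<^esub> unit_vector F 1) i" for i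
  proof (cases "i < 2")
    case True
    then have "i = 0 \<or> i = 1" by auto
    then show ?thesis using v by (auto simp: unit_vector_def)
  next
    case False
    then show ?thesis using V_beyond[OF v, of i] True v by (auto simp: unit_vector_def)
  qed
  then have "v = v 0 \<odot>\<^bsub>V\<^esub> unit_vector F 0 \<oplus>\<^bsub>V\<^esub> v 1 \<odot>\<^bsub>V\<^esub> unit_vector F 1" by blast
  then have "cls (free_gen F v) = cls (free_gen F (v 0 \<odot>\<^bsub>V\<^esub> unit_vector F 0 \<oplus>\<^bsub>V\<^esub> v 1 \<odot>\<^bsub>V\<^esub> unit_vector F 1))"
    by simp
  also have "\<dots> = scal (v 0) \<otimes>\<^bsub>C\<^esub> cls (free_gen F (unit_vector F 0)) \<oplus>\<^bsub>C\<^esub> scal (v 1) \<otimes>\<^bsub>C\<^esub> cls (free_gen F (unit_vector F 1))"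
    using v e cls_gen_add[of "v 0 \<odot>\<^bsub>V\<^esub> unit_vector F 0" "v 1 \<odot>\<^bsub>V\<^esub> unit_vector F 1"]
      cls_gen_scale[of "v 0"] cls_gen_scale[of "v 1"] by simp
  finally show ?thesis unfolding gen1_two[OF True] .
next
  case False
  then have n: "n = 1" using n_cases by auto
  have e: "unit_vector F 0 \<in> carrier V" by (rule V_closed(3)[OF n_pos])
  have "v i = (v 0 \<odot>\<^bsub>V\<^esub> unit_vector F 0) i" for i
    using V_beyond[OF v, of i] n v by (cases "i = 0") (auto simp: unit_vector_def)
  then have "v = v 0 \<odot>\<^bsub>V\<^esub> unit_vector F 0" by blast
  then have "cls (free_gen F v) = cls (free_gen F (v 0 \<odot>\<^bsub>V\<^esub> unit_vector F 0))" by simp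
  also have "\<dots> = scal (v 0) \<otimes>\<^bsub>C\<^esub> cls (free_gen F (unit_vector F 0))"
    using v e by (intro cls_gen_scale) simp_all
  finally show ?thesis
    unfolding gen1_one[OF False]
    using v ring_hom_closed[OF scal_hom] cl.hom_closed[OF gen_T[OF e]] by simp
qed

lemma gen_C_closed: "cls (free_gen F (unit_vector F 0)) \<in> carrier C" "gen1 \<in> carrier C"
proof -
  show "cls (free_gen F (unit_vector F 0)) \<in> carrier C"
    by (rule cl.hom_closed[OF gen_T[OF V_closed(3)[OF n_pos]]])
  show "gen1 \<in> carrier C"
  proof (cases "n = 2")
    case True
    then have "1 < n" by simp
    then show ?thesis unfolding gen1_two[OF True] by (intro cl.hom_closed gen_T V_closed(3))
  next
    case False
    then show ?thesis by (simp add: gen1_one)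
  qed
qed

sublocale inC: clifford_relations_in C F scal \<zeta> \<xi> "cls (free_gen F (unit_vector F 0))" gen1
proof unfold_locales
  have e0: "unit_vector F 0 \<in> carrier V" using n_pos by simp
  have q0: "q (unit_vector F 0) = \<zeta>" using \<zeta> \<xi> by (simp add: diagonal_form_def unit_vector_def)
  show "cls (free_gen F (unit_vector F 0)) \<otimes>\<^bsub>C\<^esub> cls (free_gen F (unit_vector F 0)) = scal \<zeta>"
    using cls_gen_square[OF e0] q0 by simp
  show "gen1 \<otimes>\<^bsub>C\<^esub> gen1 = scal \<xi>"
  proof (cases "n = 2")
    case True
    have q1: "q (unit_vector F 1) = \<xi>" using \<zeta> \<xi> by (simp add: diagonal_form_def unit_vector_def)
    have "1 < n" using True by simp
    then have "unit_vector F 1 \<in> carrier V" by (rule V_closed(3))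
    then show ?thesis unfolding gen1_two[OF True] using cls_gen_square[of "unit_vector F 1"] q1 by simp
  next
    case False
    then have "\<xi> = \<zero>" using n_cases by auto
    then have "scal \<xi> = \<zero>\<^bsub>C\<^esub>" using scal_zero by (simp only:)
    then show ?thesis unfolding gen1_one[OF False] by simp
  qed
  show "cls (free_gen F (unit_vector F 0)) \<otimes>\<^bsub>C\<^esub> gen1 \<oplus>\<^bsub>C\<^esub> gen1 \<otimes>\<^bsub>C\<^esub> cls (free_gen F (unit_vector F 0)) = \<zero>\<^bsub>C\<^esub>"
  proof (cases "n = 2")
    case True
    let ?a = "cls (free_gen F (unit_vector F 0))" and ?b = "cls (free_gen F (unit_vector F 1))"
    have "1 < n" using True by simp
    then have e1: "unit_vector F 1 \<in> carrier V" by (rule V_closed(3))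
    have ab: "?a \<in> carrier C" "?b \<in> carrier C" using e0 e1 cl.hom_closed gen_T by blast+
    have q1: "q (unit_vector F 1) = \<xi>" using \<zeta> \<xi> by (simp add: diagonal_form_def unit_vector_def)
    have q01: "q (unit_vector F 0 \<oplus>\<^bsub>V\<^esub> unit_vector F 1) = \<zeta> \<oplus> \<xi>"
      using \<zeta> \<xi> by (simp add: diagonal_form_def unit_vector_def)
    \<comment> \<open>Anticommutation is not among the defining relations; it follows by polarizing
      the square relation at the sum of the two unit vectors, whose value is
      \<open>\<zeta> \<oplus> \<xi>\<close>.\<close>
    have "(?a \<oplus>\<^bsub>C\<^esub> ?b) \<otimes>\<^bsub>C\<^esub> (?a \<oplus>\<^bsub>C\<^esub> ?b) = scal (\<zeta> \<oplus> \<xi>)"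
      using cls_gen_square[of "unit_vector F 0 \<oplus>\<^bsub>V\<^esub> unit_vector F 1"] cls_gen_add[OF e0 e1] q01 e0 e1
      by simp
    also have "\<dots> = ?a \<otimes>\<^bsub>C\<^esub> ?a \<oplus>\<^bsub>C\<^esub> ?b \<otimes>\<^bsub>C\<^esub> ?b"
      using ring_hom_add[OF scal_hom \<zeta>(1) \<xi>] cls_gen_square[OF e0] cls_gen_square[OF e1] q0 q1 by simp
    finally have "?a \<otimes>\<^bsub>C\<^esub> ?b \<oplus>\<^bsub>C\<^esub> ?b \<otimes>\<^bsub>C\<^esub> ?a = \<zero>\<^bsub>C\<^esub>"
      by (rule cl.S.anticommute_of_square_add[OF ab])
    then show ?thesis unfolding gen1_two[OF True] .
  next
    case False
    then show ?thesis using gen_C_closed(1) by (simp add: gen1_one)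
  qed
qed (use \<zeta> \<xi> gen_C_closed scal_hom scal_central in auto)

text \<open>\<open>cls\<close> and \<open>ev.eval\<close> obey the same rule for left multiplication
  by a vector, so induction on words and then on sums yields one tuple of coefficients valid in both
  rings.\<close>

lemma common_normal_form:
  assumes "f \<in> carrier T"
  shows "\<exists>c\<^sub>0\<in>carrier F. \<exists>c\<^sub>1\<in>carrier F. \<exists>c\<^sub>2\<in>carrier F. \<exists>c\<^sub>3\<in>carrier F.
    cls f = inC.normal_form c\<^sub>0 c\<^sub>1 c\<^sub>2 c\<^sub>3 \<and> ev.eval f = inB.normal_form c\<^sub>0 c\<^sub>1 c\<^sub>2 c\<^sub>3"
proof -
  have word: "\<exists>c\<^sub>0\<in>carrier F. \<exists>c\<^sub>1\<in>carrier F. \<exists>c\<^sub>2\<in>carrier F. \<exists>c\<^sub>3\<in>carrier F.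
    cls (monomial F \<one> w) = inC.normal_form c\<^sub>0 c\<^sub>1 c\<^sub>2 c\<^sub>3 \<and> ev.word_prod w = inB.normal_form c\<^sub>0 c\<^sub>1 c\<^sub>2 c\<^sub>3"
    if "w \<in> lists (carrier V)" for w
    using that
  proof (induction w)
    case Nil
    have "cls (monomial F \<one> []) = inC.normal_form \<one> \<zero> \<zero> \<zero>"
      using cl.hom_one inC.normal_form_one by simp
    moreover have "ev.word_prod [] = inB.normal_form \<one> \<zero> \<zero> \<zero>"
      using inB.normal_form_one by simp
    ultimately show ?case using one_closed zero_closed by blast
  next
    case (Cons v w)
    then obtain c\<^sub>0 c\<^sub>1 c\<^sub>2 c\<^sub>3 where c: "c\<^sub>0 \<in> carrier F" "c\<^sub>1 \<in> carrier F" "c\<^sub>2 \<in> carrier F" "c\<^sub>3 \<in> carrier F"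
      and nf: "cls (monomial F \<one> w) = inC.normal_form c\<^sub>0 c\<^sub>1 c\<^sub>2 c\<^sub>3" "ev.word_prod w = inB.normal_form c\<^sub>0 c\<^sub>1 c\<^sub>2 c\<^sub>3"
      by blast
    have v: "v \<in> carrier V" "w \<in> lists (carrier V)" using Cons by auto
    have "monomial F \<one> (v # w) = free_gen F v \<otimes>\<^bsub>T\<^esub> monomial F \<one> w"
      using ev.monomial_mult[of \<one> \<one> "[v]" w] by (simp add: free_gen_monomial)
    then have "cls (monomial F \<one> (v # w)) = cls (free_gen F v) \<otimes>\<^bsub>C\<^esub> inC.normal_form c\<^sub>0 c\<^sub>1 c\<^sub>2 c\<^sub>3"
      using cl.hom_mult[OF gen_T[OF v(1)] ev.monomial_closed[OF one_closed v(2)]] nf by simp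
    then have 1: "cls (monomial F \<one> (v # w)) =
        inC.normal_form (v 0 \<otimes> (c\<^sub>1 \<otimes> \<zeta>) \<oplus> v 1 \<otimes> (c\<^sub>2 \<otimes> \<xi>)) (v 0 \<otimes> c\<^sub>0 \<oplus> v 1 \<otimes> \<ominus> (c\<^sub>3 \<otimes> \<xi>))
        (v 0 \<otimes> (c\<^sub>3 \<otimes> \<zeta>) \<oplus> v 1 \<otimes> c\<^sub>0) (v 0 \<otimes> c\<^sub>2 \<oplus> v 1 \<otimes> \<ominus> c\<^sub>1)"
      using inC.normal_form_left[OF c, of "v 0" "v 1"] V_decomp[OF v(1)] v(1) by simp
    have 2: "ev.word_prod (v # w) =
        inB.normal_form (v 0 \<otimes> (c\<^sub>1 \<otimes> \<zeta>) \<oplus> v 1 \<otimes> (c\<^sub>2 \<otimes> \<xi>)) (v 0 \<otimes> c\<^sub>0 \<oplus> v 1 \<otimes> \<ominus> (c\<^sub>3 \<otimes> \<xi>))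
        (v 0 \<otimes> (c\<^sub>3 \<otimes> \<zeta>) \<oplus> v 1 \<otimes> c\<^sub>0) (v 0 \<otimes> c\<^sub>2 \<oplus> v 1 \<otimes> \<ominus> c\<^sub>1)"
      using inB.normal_form_left[OF c, of "v 0" "v 1"] v(1) nf(2) by (simp add: emb_def incl_def)
    have "v 0 \<otimes> (c\<^sub>1 \<otimes> \<zeta>) \<oplus> v 1 \<otimes> (c\<^sub>2 \<otimes> \<xi>) \<in> carrier F" "v 0 \<otimes> c\<^sub>0 \<oplus> v 1 \<otimes> \<ominus> (c\<^sub>3 \<otimes> \<xi>) \<in> carrier F"
      "v 0 \<otimes> (c\<^sub>3 \<otimes> \<zeta>) \<oplus> v 1 \<otimes> c\<^sub>0 \<in> carrier F" "v 0 \<otimes> c\<^sub>2 \<oplus> v 1 \<otimes> \<ominus> c\<^sub>1 \<in> carrier F"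
      using v(1) c \<zeta> \<xi> by simp_all
    then show ?case using 1 2 by blast
  qed
  show ?thesis
    using assms
  proof (induction f rule: ev.T_induct)
    case zero
    have "cls (\<lambda>w. \<zero>) = inC.normal_form \<zero> \<zero> \<zero> \<zero>"
      using cl.hom_zero inC.normal_form_zero by simp
    moreover have "ev.eval (\<lambda>w. \<zero>) = inB.normal_form \<zero> \<zero> \<zero> \<zero>"
      using ev.eval_zero inB.normal_form_zero by simp
    ultimately show ?case using zero_closed by blast
  next
    case (add d w g)
    obtain c\<^sub>0 c\<^sub>1 c\<^sub>2 c\<^sub>3 where c: "c\<^sub>0 \<in> carrier F" "c\<^sub>1 \<in> carrier F" "c\<^sub>2 \<in> carrier F" "c\<^sub>3 \<in> carrier F"
      and nf: "cls (monomial F \<one> w) = inC.normal_form c\<^sub>0 c\<^sub>1 c\<^sub>2 c\<^sub>3" "ev.word_prod w = inB.normal_form c\<^sub>0 c\<^sub>1 c\<^sub>2 c\<^sub>3"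
      using word[OF add(2)] by blast
    obtain d\<^sub>0 d\<^sub>1 d\<^sub>2 d\<^sub>3 where d: "d\<^sub>0 \<in> carrier F" "d\<^sub>1 \<in> carrier F" "d\<^sub>2 \<in> carrier F" "d\<^sub>3 \<in> carrier F"
      and nf': "cls g = inC.normal_form d\<^sub>0 d\<^sub>1 d\<^sub>2 d\<^sub>3" "ev.eval g = inB.normal_form d\<^sub>0 d\<^sub>1 d\<^sub>2 d\<^sub>3"
      using add(5) by blast
    have m: "monomial F d w = monomial F d [] \<otimes>\<^bsub>T\<^esub> monomial F \<one> w"
      using ev.monomial_mult[OF add(1) one_closed, of "[]" w] add(1) by simp
    have mc: "monomial F d w \<in> carrier T" by (rule ev.monomial_closed[OF add(1,2)])
    have "cls (monomial F d w) = scal d \<otimes>\<^bsub>C\<^esub> inC.normal_form c\<^sub>0 c\<^sub>1 c\<^sub>2 c\<^sub>3"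
      unfolding m using cl.hom_mult[OF scal_T[OF add(1)] ev.monomial_closed[OF one_closed add(2)]] nf(1)
      by (simp add: scal_def)
    then have m1: "cls (monomial F d w) = inC.normal_form (d \<otimes> c\<^sub>0) (d \<otimes> c\<^sub>1) (d \<otimes> c\<^sub>2) (d \<otimes> c\<^sub>3)"
      using inC.normal_form_scale[OF c add(1)] by simp
    have m2: "ev.eval (monomial F d w) = inB.normal_form (d \<otimes> c\<^sub>0) (d \<otimes> c\<^sub>1) (d \<otimes> c\<^sub>2) (d \<otimes> c\<^sub>3)"
      using ev.eval_monomial[OF add(1,2)] nf(2) inB.normal_form_scale[OF c add(1)] by simp
    have dc: "d \<otimes> c\<^sub>0 \<in> carrier F" "d \<otimes> c\<^sub>1 \<in> carrier F" "d \<otimes> c\<^sub>2 \<in> carrier F" "d \<otimes> c\<^sub>3 \<in> carrier F"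
      using c add(1) by simp_all
    have "cls (\<lambda>z. monomial F d w z \<oplus> g z) = inC.normal_form (d \<otimes> c\<^sub>0 \<oplus> d\<^sub>0) (d \<otimes> c\<^sub>1 \<oplus> d\<^sub>1) (d \<otimes> c\<^sub>2 \<oplus> d\<^sub>2) (d \<otimes> c\<^sub>3 \<oplus> d\<^sub>3)"
      using cl.hom_add[OF mc add(3)] m1 nf'(1) inC.normal_form_add[OF dc d] by simp
    moreover have "ev.eval (\<lambda>z. monomial F d w z \<oplus> g z) = inB.normal_form (d \<otimes> c\<^sub>0 \<oplus> d\<^sub>0) (d \<otimes> c\<^sub>1 \<oplus> d\<^sub>1) (d \<otimes> c\<^sub>2 \<oplus> d\<^sub>2) (d \<otimes> c\<^sub>3 \<oplus> d\<^sub>3)"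
      using ev.eval_add[OF mc add(3)] m2 nf'(2) inB.normal_form_add[OF dc d] by simp
    moreover have "d \<otimes> c\<^sub>0 \<oplus> d\<^sub>0 \<in> carrier F" "d \<otimes> c\<^sub>1 \<oplus> d\<^sub>1 \<in> carrier F" "d \<otimes> c\<^sub>2 \<oplus> d\<^sub>2 \<in> carrier F" "d \<otimes> c\<^sub>3 \<oplus> d\<^sub>3 \<in> carrier F"
      using dc d by simp_all
    ultimately show ?case by blast
  qed
qed

text \<open>If the evaluation of \<open>f\<close> vanishes, independence in \<open>B\<close> kills
  the common coefficients, so the class of \<open>f\<close> is zero too. For \<open>n = 1\<close>
  the last two coefficients stay undetermined but multiply \<open>gen1 = \<zero>\<close>.\<close>

lemma kernel_eq: "a_kernel T B ev.eval = I"
proof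
  show "a_kernel T B ev.eval \<subseteq> I"
  proof
    fix f assume "f \<in> a_kernel T B ev.eval"
    then have f: "f \<in> carrier T" "ev.eval f = \<zero>"
      unfolding a_kernel_def' mem_Collect_eq F_ops(3) by (rule conjunct1, rule conjunct2)
    obtain c\<^sub>0 c\<^sub>1 c\<^sub>2 c\<^sub>3 where c: "c\<^sub>0 \<in> carrier F" "c\<^sub>1 \<in> carrier F" "c\<^sub>2 \<in> carrier F" "c\<^sub>3 \<in> carrier F"
      and nf: "cls f = inC.normal_form c\<^sub>0 c\<^sub>1 c\<^sub>2 c\<^sub>3" "ev.eval f = inB.normal_form c\<^sub>0 c\<^sub>1 c\<^sub>2 c\<^sub>3"
      using common_normal_form[OF f(1)] by blast
    have z: "c\<^sub>0 = \<zero> \<and> c\<^sub>1 = \<zero> \<and> (n = 2 \<longrightarrow> c\<^sub>2 = \<zero> \<and> c\<^sub>3 = \<zero>)"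
      by (rule indep[OF c]) (use f(2) nf(2) in \<open>simp add: inB.normal_form_def incl_def\<close>)
    have "cls f = \<zero>\<^bsub>C\<^esub>"
    proof (cases "n = 2")
      case True
      then show ?thesis using nf(1) z inC.normal_form_zero by simp
    next
      case False
      have "c\<^sub>0 = \<zero>" "c\<^sub>1 = \<zero>" using z by simp_all
      moreover have "cls f = scal c\<^sub>0 \<oplus>\<^bsub>C\<^esub> (scal c\<^sub>1 \<otimes>\<^bsub>C\<^esub> cls (free_gen F (unit_vector F 0)) \<oplus>\<^bsub>C\<^esub>
          (scal c\<^sub>2 \<otimes>\<^bsub>C\<^esub> gen1 \<oplus>\<^bsub>C\<^esub> scal c\<^sub>3 \<otimes>\<^bsub>C\<^esub> (cls (free_gen F (unit_vector F 0)) \<otimes>\<^bsub>C\<^esub> gen1)))"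
        using nf(1) by (simp only: inC.normal_form_def)
      ultimately show ?thesis unfolding gen1_one[OF False] using c gen_C_closed(1) by simp
    qed
    then have "I +>\<^bsub>T\<^esub> f = I" unfolding cls_def FactRing_def by (simp only: ring.simps)
    then show "f \<in> I" using I.a_rcos_self[OF f(1)] by (simp only:)
  qed
qed (rule I_subset_kernel)

definition parity_part where
  "parity_part i = {f \<in> carrier T. \<forall>w. f w \<noteq> \<zero> \<longrightarrow> of_nat (length w) = (i::bit)}"

lemma word_prod_parity: "w \<in> lists (carrier V) \<Longrightarrow> ev.word_prod w \<in> component B (of_nat (length w))"
proof (induction w)
  case Nil
  have "\<one> \<in> component B 0" using comp_F one_closed by blast
  then show ?case by (simp add: F_ops)
next
  case (Cons v w)
  then have v: "v \<in> carrier V" "w \<in> lists (carrier V)" by auto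
  have "v i \<in> component B 0" for i using comp_F V_value[OF v(1)] by blast
  then have "emb v \<in> component B (0 + 1)"
    unfolding emb_def by (intro comp_add comp_mult comp_gen)
  then have "emb v \<otimes>\<^bsub>B\<^esub> ev.word_prod w \<in> component B (0 + 1 + of_nat (length w))"
    by (rule comp_mult) (rule Cons.IH[OF v(2)])
  then show ?case by (simp only: ev.word_prod_simps length_Cons of_nat_Suc add_0)
qed

lemma eval_parity:
  assumes "f \<in> parity_part i"
  shows "ev.eval f \<in> component B i"
proof -
  \<comment> \<open>The parity condition is kept inside the induction formula, as it has to be
    passed on from the sum to the remainder \<open>g\<close>.\<close>
  have "(\<forall>w. f w \<noteq> \<zero> \<longrightarrow> of_nat (length w) = i) \<longrightarrow> ev.eval f \<in> component B i" if "f \<in> carrier T"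
    using that
  proof (induction f rule: ev.T_induct)
    case zero
    show ?case unfolding ev.eval_zero using comp_zero[unfolded F_ops(3)] by blast
  next
    case (add c v g)
    show ?case
    proof (intro impI)
      assume *: "\<forall>w. monomial F c v w \<oplus> g w \<noteq> \<zero> \<longrightarrow> of_nat (length w) = i"
      have "of_nat (length w) = i" if "g w \<noteq> \<zero>" for w
      proof -
        have "w \<noteq> v" using that add(4) by blast
        then have "monomial F c v w \<oplus> g w = g w" using add(3) by (simp add: monomial_def)
        then show ?thesis using * that by metis
      qed
      then have g: "ev.eval g \<in> component B i" using add(5) by blast
      have "ev.eval (monomial F c v) \<in> component B i"
      proof (cases "c = \<zero>")
        case True
        have "ev.eval (monomial F \<zero> v) = \<zero>\<^bsub>B\<^esub>"
          using ev.eval_monomial[OF zero_closed add(2)] add(2) by simp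
        then show ?thesis using True comp_zero by (simp only: F_ops(3))
      next
        case False
        have "monomial F c v v \<oplus> g v \<noteq> \<zero>" using False add(1,4) by (simp add: monomial_def)
        then have i: "of_nat (length v) = i" using * by blast
        have "ev.eval (monomial F c v) = c \<otimes>\<^bsub>B\<^esub> ev.word_prod v"
          using ev.eval_monomial[OF add(1,2)] by (simp add: incl_def)
        moreover have "c \<otimes>\<^bsub>B\<^esub> ev.word_prod v \<in> component B (0 + i)"
          using comp_F add(1) word_prod_parity[OF add(2)] unfolding i by (intro comp_mult) auto
        ultimately show ?thesis by (simp only: add_0)
      qed
      then show "ev.eval (\<lambda>w. monomial F c v w \<oplus> g w) \<in> component B i"
        unfolding ev.eval_add[OF ev.monomial_closed[OF add(1,2)] add(3)] using g by (rule comp_add)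
    qed
  qed
  then show ?thesis using assms by (simp add: parity_part_def)
qed

lemma monomial_parity:
  "c \<in> carrier F \<Longrightarrow> v \<in> lists (carrier V) \<Longrightarrow> of_nat (length v) = i \<Longrightarrow> monomial F c v \<in> parity_part i"
  by (simp add: parity_part_def ev.monomial_closed) (simp add: monomial_def)

lemma parity_part_add:
  assumes "f \<in> parity_part i" "g \<in> parity_part i"
  shows "(\<lambda>w. f w \<oplus> g w) \<in> parity_part i"
proof -
  have "of_nat (length w) = i" if "f w \<oplus> g w \<noteq> \<zero>" for w
  proof -
    have "f w \<noteq> \<zero> \<or> g w \<noteq> \<zero>" using that by auto
    then show ?thesis using assms by (auto simp: parity_part_def)
  qed
  moreover have "(\<lambda>w. f w \<oplus> g w) \<in> carrier T"
    using assms by (intro ev.T_add_closed) (simp_all add: parity_part_def)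
  ultimately show ?thesis by (simp add: parity_part_def)
qed

lemma zero_parity: "(\<lambda>w. \<zero>) \<in> parity_part i"
  using T.zero_closed by (simp add: parity_part_def)

lemma emb_unit_0: "emb (unit_vector F 0) = u"
  and emb_unit_1: "emb (unit_vector F 1) = x"
  using gen_closed by (simp_all add: emb_def unit_vector_def F_ops)

text \<open>The spanning elements are values of words of the right parity: 1 and \<open>u x\<close>
  of words of length 0 and 2, \<open>u\<close> and \<open>x\<close> of words of length 1.\<close>

lemma eval_of_parity:
  assumes b: "b \<in> component B i"
  shows "\<exists>f\<in>parity_part i. ev.eval f = b"
proof -
  have e0: "unit_vector F 0 \<in> carrier V" by (rule V_closed(3)[OF n_pos])
  have mono: "\<exists>f\<in>parity_part i. ev.eval f = c \<otimes>\<^bsub>B\<^esub> ev.word_prod v"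
    if "c \<in> carrier F" "v \<in> lists (carrier V)" "of_nat (length v) = i" for c v i
  proof
    show "ev.eval (monomial F c v) = c \<otimes>\<^bsub>B\<^esub> ev.word_prod v"
      using ev.eval_monomial[OF that(1,2)] by (simp add: incl_def)
  qed (rule monomial_parity[OF that])
  have add: "\<exists>f\<in>parity_part i. ev.eval f = a \<oplus>\<^bsub>B\<^esub> b"
    if ab: "\<exists>f\<in>parity_part i. ev.eval f = a" "\<exists>f\<in>parity_part i. ev.eval f = b" for a b i
  proof -
    obtain f g where fg: "f \<in> parity_part i" "g \<in> parity_part i" "ev.eval f = a" "ev.eval g = b"
      using ab by blast
    then have "ev.eval (\<lambda>w. f w \<oplus> g w) = a \<oplus>\<^bsub>B\<^esub> b"
      using ev.eval_add[of f g] by (simp add: parity_part_def)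
    then show ?thesis using parity_part_add[OF fg(1,2)] by blast
  qed
  have zero: "\<exists>f\<in>parity_part i. ev.eval f = \<zero>\<^bsub>B\<^esub>" for i
    using zero_parity ev.eval_zero by blast
  have x0: "x = \<zero>\<^bsub>B\<^esub>" if "n \<noteq> 2"
    using that n_cases x1 by (simp add: F_ops)
  have e1: "unit_vector F 1 \<in> carrier V" if "n = 2"
    by (rule V_closed(3)) (use that in simp)
  have i: "i = 0 \<or> i = 1" by (cases i) simp_all
  then show ?thesis
  proof
    assume i: "i = 0"
    obtain c d where cd: "c \<in> carrier F" "d \<in> carrier F" "b = c \<oplus>\<^bsub>B\<^esub> d \<otimes>\<^bsub>B\<^esub> (u \<otimes>\<^bsub>B\<^esub> x)"
      using comp_even b i by blast
    have "\<exists>f\<in>parity_part 0. ev.eval f = c"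
      using mono[OF cd(1), of "[]" 0] F_in_B[OF cd(1)] by simp
    moreover have "\<exists>f\<in>parity_part 0. ev.eval f = d \<otimes>\<^bsub>B\<^esub> (u \<otimes>\<^bsub>B\<^esub> x)"
    proof (cases "n = 2")
      case True
      have "ev.word_prod [unit_vector F 0, unit_vector F 1] = u \<otimes>\<^bsub>B\<^esub> x"
        using emb_unit_0 emb_unit_1 gen_closed by (simp del: One_nat_def)
      then show ?thesis
        using mono[OF cd(2), of "[unit_vector F 0, unit_vector F 1]" 0] e0 e1[OF True]
        by (simp del: One_nat_def ev.word_prod_simps)
    next
      case False
      then show ?thesis using zero x0 F_in_B[OF cd(2)] gen_closed by simp
    qed
    ultimately show ?thesis unfolding i cd(3) by (rule add)
  next
    assume i: "i = 1"
    obtain c d where cd: "c \<in> carrier F" "d \<in> carrier F" "b = c \<otimes>\<^bsub>B\<^esub> u \<oplus>\<^bsub>B\<^esub> d \<otimes>\<^bsub>B\<^esub> x"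
      using comp_odd b i by blast
    have "\<exists>f\<in>parity_part 1. ev.eval f = c \<otimes>\<^bsub>B\<^esub> u"
      using mono[OF cd(1), of "[unit_vector F 0]" 1] emb_unit_0 e0 gen_closed by simp
    moreover have "\<exists>f\<in>parity_part 1. ev.eval f = d \<otimes>\<^bsub>B\<^esub> x"
    proof (cases "n = 2")
      case True
      then show ?thesis
        using mono[OF cd(2), of "[unit_vector F 1]" 1] emb_unit_1 e1[OF True] gen_closed
        by (simp del: One_nat_def)
    next
      case False
      then show ?thesis using zero x0 F_in_B[OF cd(2)] by simp
    qed
    ultimately show ?thesis unfolding i cd(3) by (rule add)
  qed
qed

lemma eval_surj: "ev.eval ` carrier T = carrier B"
proof
  show "ev.eval ` carrier T \<subseteq> carrier B" using ev.eval_closed by blast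
  show "carrier B \<subseteq> ev.eval ` carrier T"
  proof
    fix b assume "b \<in> carrier B"
    then obtain c d where cd: "c \<in> component B 0" "d \<in> component B 1" "b = c \<oplus>\<^bsub>B\<^esub> d"
      using comp_sum by blast
    obtain f g where fg: "f \<in> parity_part 0" "g \<in> parity_part 1" "ev.eval f = c" "ev.eval g = d"
      using eval_of_parity[OF cd(1)] eval_of_parity[OF cd(2)] by blast
    then have "f \<in> carrier T" "g \<in> carrier T" by (simp_all add: parity_part_def)
    then have "b = ev.eval (\<lambda>w. f w \<oplus> g w)" "(\<lambda>w. f w \<oplus> g w) \<in> carrier T"
      using fg cd(3) ev.eval_add ev.T_add_closed by simp_all
    then show "b \<in> ev.eval ` carrier T" by blast
  qed
qed

definition bar where "bar X = the_elem (ev.eval ` X)"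

lemma bar_iso: "bar \<in> ring_iso C B"
  using evh.FactRing_iso_set[OF eval_surj] unfolding kernel_eq bar_def[abs_def] .

lemma bar_cls: "f \<in> carrier T \<Longrightarrow> bar (cls f) = ev.eval f"
  using evh.the_elem_simp unfolding kernel_eq bar_def cls_def .

text \<open>The first isomorphism theorem gives a map out of the quotient, whereas
  \<open>superalg_isomorphic\<close> asks for one into it.\<close>

definition lift where "lift = inv_into (carrier C) bar"

lemma lift_iso: "lift \<in> ring_iso B C"
  unfolding lift_def by (rule ring_iso_set_sym[OF I.quotient_is_ring bar_iso])

lemma lift_eval: "f \<in> carrier T \<Longrightarrow> lift (ev.eval f) = cls f"
proof -
  assume f: "f \<in> carrier T"
  have "inj_on bar (carrier C)" using ring_iso_memE(5)[OF bar_iso] by (rule bij_betw_imp_inj_on)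
  then have "inv_into (carrier C) bar (bar (cls f)) = cls f"
    using cl.hom_closed[OF f] by (rule inv_into_f_f)
  then show ?thesis unfolding lift_def bar_cls[OF f] .
qed

text \<open>The scalar action is a union over the members of a coset; each member yields the same
  coset because scaling is multiplication by a class.\<close>

lemma smult_clifford:
  assumes c: "c \<in> carrier F" and f: "f \<in> carrier T"
  shows "c \<odot>\<^bsub>clifford_superalg F V q\<^esub> cls f = scal c \<otimes>\<^bsub>C\<^esub> cls f"
proof -
  have "I +>\<^bsub>T\<^esub> (c \<odot>\<^bsub>T\<^esub> g) = scal c \<otimes>\<^bsub>C\<^esub> cls f" if g: "g \<in> cls f" for g
  proof -
    have "cls f = cls g" using g unfolding cls_def by (rule T.a_repr_independence[OF _ f I.a_subgroup])
    moreover have gT: "g \<in> carrier T"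
      using g f I.a_subset T.a_r_coset_subset_G unfolding cls_def by blast
    ultimately show ?thesis
      using ev.T_smult[OF c gT] cl.hom_mult[OF scal_T[OF c] gT] by (simp only: scal_def cls_def[symmetric])
  qed
  moreover have "f \<in> cls f" unfolding cls_def by (rule I.a_rcos_self[OF f])
  ultimately have "(\<Union>g\<in>cls f. I +>\<^bsub>T\<^esub> (c \<odot>\<^bsub>T\<^esub> g)) = scal c \<otimes>\<^bsub>C\<^esub> cls f" by blast
  then show ?thesis unfolding clifford_superalg_simps(6)[OF refl] .
qed

theorem isomorphic_clifford: "superalg_isomorphic F B (clifford_superalg F V q)"
  unfolding superalg_isomorphic_def
proof (intro bexI conjI ballI allI)
  show "lift \<in> ring_iso B (clifford_superalg F V q)"
    using ring_iso_memE[OF lift_iso]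
    by (intro ring_iso_memI) (simp_all only: clifford_superalg_simps[OF refl])
  fix c b assume c: "c \<in> carrier F" and b: "b \<in> carrier B"
  obtain f where f: "f \<in> carrier T" "b = ev.eval f" using b eval_surj by blast
  have "c \<odot>\<^bsub>B\<^esub> b = ev.eval (monomial F c [] \<otimes>\<^bsub>T\<^esub> f)"
    unfolding smult_B[OF c b] using f evh.hom_mult[OF scal_T[OF c] f(1)] eval_scal[OF c] by simp
  then show "lift (c \<odot>\<^bsub>B\<^esub> b) = c \<odot>\<^bsub>clifford_superalg F V q\<^esub> lift b"
    using lift_eval[OF T.m_closed[OF scal_T[OF c] f(1)]] cl.hom_mult[OF scal_T[OF c] f(1)]
    by (simp only: f(2) lift_eval[OF f(1)] smult_clifford[OF c f(1)] scal_def)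
next
  fix i
  have comp: "component (clifford_superalg F V q) i = cls ` parity_part i"
    unfolding clifford_superalg_simps[OF refl] cls_def parity_part_def by blast
  have pT: "f \<in> carrier T" if "f \<in> parity_part i" for f using that by (simp add: parity_part_def)
  show "lift ` component B i = component (clifford_superalg F V q) i"
    unfolding comp
  proof (intro subset_antisym subsetI)
    fix X assume "X \<in> lift ` component B i"
    then obtain b where b: "b \<in> component B i" "X = lift b" by blast
    obtain f where f: "f \<in> parity_part i" "ev.eval f = b" using eval_of_parity[OF b(1)] by blast
    then show "X \<in> cls ` parity_part i" using b(2) lift_eval[OF pT] by blast
  next
    fix X assume "X \<in> cls ` parity_part i"
    then obtain f where f: "f \<in> parity_part i" "X = cls f" by blast
    then show "X \<in> lift ` component B i"
      using lift_eval[OF pT[OF f(1)]] eval_parity[OF f(1)] by (metis imageI)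
  qed
qed

end


section \<open>From a frame to a central order\<close>

context prime_superalg
begin

text \<open>The grading separates the relation into two. Commuting the even one and anticommuting
  the odd one with \<open>u\<close> doubles one term and cancels the other, and regularity of
  \<open>u u\<close> removes the factor. The coefficients of \<open>x\<close> and \<open>u x\<close>
  need \<open>x x\<close> regular as well.\<close>

lemma frame_independent:
  assumes u: "u \<in> A 1" and x: "x \<in> A 1" and ux: "u * x + x * u = 0"
    and uu: "u * u \<in> even_center" "u * u \<noteq> 0" and xx: "x * x \<in> even_center"
    and c: "c\<^sub>0 \<in> even_center" "c\<^sub>1 \<in> even_center" "c\<^sub>2 \<in> even_center" "c\<^sub>3 \<in> even_center"
    and zero: "c\<^sub>0 + (c\<^sub>1 * u + (c\<^sub>2 * x + c\<^sub>3 * (u * x))) = 0"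
  shows "c\<^sub>0 = 0 \<and> c\<^sub>1 = 0 \<and> (x * x \<noteq> 0 \<longrightarrow> c\<^sub>2 = 0 \<and> c\<^sub>3 = 0)"
proof -
  have xu: "x * u = - (u * x)" using ux by (simp add: eq_neg_iff_add_eq_0 add.commute)
  note comm = even_center_commute[OF c(1)] even_center_commute[OF c(2)]
    even_center_commute[OF c(3)] even_center_commute[OF c(4)]
  note lcomm = even_center_left_commute[OF c(2), of u] even_center_left_commute[OF c(3), of u]
    even_center_left_commute[OF c(4), of u]
  have "c\<^sub>0 + c\<^sub>3 * (u * x) \<in> A 0" "c\<^sub>1 * u + c\<^sub>2 * x \<in> A (0 + 1)"
    using c u x by (simp_all add: A_intros even_center_even)
  then have "part 0 (c\<^sub>0 + c\<^sub>3 * (u * x) + (c\<^sub>1 * u + c\<^sub>2 * x)) = c\<^sub>0 + c\<^sub>3 * (u * x)"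
    by (rule part_sum)
  moreover have "c\<^sub>0 + c\<^sub>3 * (u * x) + (c\<^sub>1 * u + c\<^sub>2 * x) = 0" using zero by (simp add: algebra_simps)
  ultimately have even: "c\<^sub>0 + c\<^sub>3 * (u * x) = 0" and odd: "c\<^sub>1 * u + c\<^sub>2 * x = 0" by simp_all
  have "u * (c\<^sub>0 + c\<^sub>3 * (u * x)) - (c\<^sub>0 + c\<^sub>3 * (u * x)) * u = u * u * (c\<^sub>3 * x) + u * u * (c\<^sub>3 * x)"
    using comm(1)[of u] xu by (simp add: algebra_simps lcomm)
  then have "u * u * (c\<^sub>3 * x) = 0" unfolding even by (intro double_zero[of "u * u * (c\<^sub>3 * x)"]) simp
  then have c3x: "c\<^sub>3 * x = 0" by (rule even_center_mult_zero[OF uu])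
  then have "c\<^sub>3 * (u * x) = 0" using lcomm(3)[of x] by simp
  then have c0: "c\<^sub>0 = 0" using even by simp
  have "u * (c\<^sub>1 * u + c\<^sub>2 * x) + (c\<^sub>1 * u + c\<^sub>2 * x) * u = u * u * c\<^sub>1 + u * u * c\<^sub>1"
    using comm(2)[of "u * u"] xu by (simp add: algebra_simps lcomm)
  then have "u * u * c\<^sub>1 = 0" unfolding odd by (intro double_zero[of "u * u * c\<^sub>1"]) simp
  then have c1: "c\<^sub>1 = 0" by (rule even_center_mult_zero[OF uu])
  have "c\<^sub>2 = 0 \<and> c\<^sub>3 = 0" if "x * x \<noteq> 0"
  proof -
    have "c\<^sub>2 * x = 0" using odd c1 by simp
    then have "x * x * c\<^sub>2 = 0" "x * x * c\<^sub>3 = 0"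
      using c3x comm(3,4)[of "x * x"] by (simp_all flip: mult.assoc)
    then show ?thesis using even_center_mult_zero[OF xx that] by simp
  qed
  then show ?thesis using c0 c1 by blast
qed

end

context prime_superalg_center
begin

lemma frac_scale:
  assumes "w \<in> denominators" "z \<in> denominators"
  shows "frac (w * z) (w * a) = frac z a"
  using frac_eq_iff[OF denominators_mult[OF assms] assms(2)] assms by (simp add: central_ac)

lemma frame_central_order:
  assumes frame: "clifford_frame n u x"
  shows "central_order_in_C n"
proof -
  have u: "u \<in> A 1" and x: "x \<in> A 1" and ux: "u * x + x * u = 0"
    and uu: "u * u \<in> even_center" "u * u \<noteq> 0" and xx: "x * x \<in> even_center"
    and n: "n = 1 \<and> x = 0 \<or> n = 2 \<and> x * x \<noteq> 0"
    and a0: "\<And>a. a \<in> A 0 \<Longrightarrow> \<exists>z\<in>denominators. \<exists>c\<in>even_center. \<exists>d\<in>even_center. z * a = c + d * (u * x)"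
    and a1: "\<And>a. a \<in> A 1 \<Longrightarrow> \<exists>z\<in>denominators. \<exists>c\<in>even_center. \<exists>d\<in>even_center. z * a = c * u + d * x"
    using frame unfolding clifford_frame_def by blast+
  obtain s where s: "s \<in> denominators" by (rule obtain_denominator)
  note ss = denominators_mult[OF s s]
  \<comment> \<open>The canonical map into the localization; without a unit in \<open>A\<close> the
    fraction with denominator 1 is replaced by \<open>s a\<close> over \<open>s\<close>.\<close>
  define \<iota> where "\<iota> a = frac s (s * a)" for a
  have \<iota>_add: "frac_add (\<iota> a) (\<iota> b) = \<iota> (a + b)" for a b
    by (simp only: \<iota>_def frac_add_same[OF s] distrib_left)
  have frac_\<iota>: "frac_mult (frac z c) (\<iota> a) = frac z (c * a)" if z: "z \<in> denominators" for z c a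
  proof -
    have "frac_mult (frac z c) (\<iota> a) = frac (s * z) (s * (c * a))"
      unfolding \<iota>_def frac_mult_frac[OF z s]
      using even_center_left_commute[OF denominatorsD(1)[OF s], of c a]
        central_commute[OF denominatorsD(1)[OF s] denominatorsD(1)[OF z]] by simp
    then show ?thesis using frac_scale[OF s z] by simp
  qed
  have \<iota>_mult: "frac_mult (\<iota> a) (\<iota> b) = \<iota> (a * b)" for a b
    using frac_\<iota>[OF s, of "s * a" b] by (simp only: \<iota>_def mult.assoc)
  have \<iota>_zero: "\<iota> 0 = frac_zero" using frac_zero_eq[OF s] by (simp add: \<iota>_def)
  have \<iota>_nz: "\<iota> a \<noteq> frac_zero" if "a \<noteq> 0" for a
  proof
    assume "\<iota> a = frac_zero"
    then have "s * (s * a) = s * 0" using frac_eq_iff[OF s s] by (simp add: \<iota>_def frac_zero_eq[OF s])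
    then have "s * a = 0" using even_center_cancel[OF denominatorsD[OF s]] by blast
    then show False using even_center_mult_zero[OF denominatorsD[OF s]] that by blast
  qed
  have \<iota>_Z: "\<iota> c \<in> fracs even_center" if "c \<in> even_center" for c
    unfolding \<iota>_def by (rule frac_in_fracs[OF s denominators_mult_closed(1)[OF s that]])
  have \<iota>_A: "\<iota> a \<in> fracs (A i)" if "a \<in> A i" for a i
    unfolding \<iota>_def by (rule frac_in_fracs[OF s denominators_mult_closed(2)[OF s that]])
  \<comment> \<open>Characteristic different from 2 is inherited from the absence of 2-torsion in
    \<open>A\<close>.\<close>
  have two: "frac_add frac_one frac_one \<noteq> frac_zero"
  proof
    assume "frac_add frac_one frac_one = frac_zero"
    then have "s * (s + s) = s * 0"
      using frac_eq_iff[OF s s] by (simp add: frac_one_eq[OF s] frac_zero_eq[OF s] frac_add_same[OF s])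
    then have "s + s = 0" by (rule even_center_cancel[OF denominatorsD[OF s]])
    then show False using double_zero denominatorsD(2)[OF s] by blast
  qed
  have Z_A: "fracs even_center \<subseteq> fracs (A 0)"
    using fracs_mono[of even_center "A 0"] even_center_even by blast
  have indep: "c\<^sub>0 = frac_zero \<and> c\<^sub>1 = frac_zero \<and> (n = 2 \<longrightarrow> c\<^sub>2 = frac_zero \<and> c\<^sub>3 = frac_zero)"
    if c: "c\<^sub>0 \<in> fracs even_center" "c\<^sub>1 \<in> fracs even_center" "c\<^sub>2 \<in> fracs even_center" "c\<^sub>3 \<in> fracs even_center"
      and zero: "frac_add c\<^sub>0 (frac_add (frac_mult c\<^sub>1 (\<iota> u)) (frac_add (frac_mult c\<^sub>2 (\<iota> x))
        (frac_mult c\<^sub>3 (frac_mult (\<iota> u) (\<iota> x))))) = frac_zero" for c\<^sub>0 c\<^sub>1 c\<^sub>2 c\<^sub>3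
  proof -
    \<comment> \<open>All four coefficients are brought to the common denominator
      \<open>p r\<close>, which turns the relation into one between numerators in
      \<open>A\<close>.\<close>
    obtain p b\<^sub>0 b\<^sub>1 where p: "p \<in> denominators" "b\<^sub>0 \<in> even_center" "b\<^sub>1 \<in> even_center" "c\<^sub>0 = frac p b\<^sub>0" "c\<^sub>1 = frac p b\<^sub>1"
      by (rule common_denominator[OF c(1,2) denominators_mult_closed(1) denominators_mult_closed(1)])
    obtain r b\<^sub>2 b\<^sub>3 where r: "r \<in> denominators" "b\<^sub>2 \<in> even_center" "b\<^sub>3 \<in> even_center" "c\<^sub>2 = frac r b\<^sub>2" "c\<^sub>3 = frac r b\<^sub>3"
      by (rule common_denominator[OF c(3,4) denominators_mult_closed(1) denominators_mult_closed(1)])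
    define z where "z = p * r"
    have z: "z \<in> denominators" unfolding z_def by (rule denominators_mult[OF p(1) r(1)])
    have z': "z = r * p"
      unfolding z_def by (rule central_commute[OF denominatorsD(1)[OF p(1)] denominatorsD(1)[OF r(1)]])
    have e: "c\<^sub>0 = frac z (r * b\<^sub>0)" "c\<^sub>1 = frac z (r * b\<^sub>1)" "c\<^sub>2 = frac z (p * b\<^sub>2)" "c\<^sub>3 = frac z (p * b\<^sub>3)"
      using p(4,5) r(4,5) frac_scale[OF r(1) p(1)] frac_scale[OF p(1) r(1)] z_def z' by simp_all
    have "frac z (r * b\<^sub>0 + (r * b\<^sub>1 * u + (p * b\<^sub>2 * x + p * b\<^sub>3 * (u * x)))) = frac z 0"
      using zero unfolding e \<iota>_mult frac_\<iota>[OF z] frac_add_same[OF z] frac_zero_eq[OF z] .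
    then have "z * (r * b\<^sub>0 + (r * b\<^sub>1 * u + (p * b\<^sub>2 * x + p * b\<^sub>3 * (u * x)))) = z * 0"
      using frac_eq_iff[OF z z] by blast
    then have "r * b\<^sub>0 + (r * b\<^sub>1 * u + (p * b\<^sub>2 * x + p * b\<^sub>3 * (u * x))) = 0"
      by (rule even_center_cancel[OF denominatorsD[OF z]])
    then have "r * b\<^sub>0 = 0 \<and> r * b\<^sub>1 = 0 \<and> (x * x \<noteq> 0 \<longrightarrow> p * b\<^sub>2 = 0 \<and> p * b\<^sub>3 = 0)"
      by (intro frame_independent[OF u x ux uu xx] denominators_mult_closed(1) p r)
    then show ?thesis unfolding e frac_zero_eq[OF z] using n by auto
  qed
  let ?B = central_localization and ?F = center_field
  have "clifford_target center_field n (\<iota> (u * u)) (\<iota> (x * x)) central_localization (\<iota> u) (\<iota> x)"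
  proof (intro clifford_target.intro clifford_target_axioms.intro diagonal_quadratic.intro
      diagonal_quadratic_axioms.intro field_center_field ring_central_localization)
    show "n = 1 \<and> \<iota> (x * x) = \<zero>\<^bsub>?F\<^esub> \<or> n = 2 \<and> \<iota> (x * x) \<noteq> \<zero>\<^bsub>?F\<^esub>"
      using n \<iota>_zero \<iota>_nz[of "x * x"] by auto
    show "\<exists>c\<in>component ?B 0. \<exists>d\<in>component ?B 1. b = c \<oplus>\<^bsub>?B\<^esub> d"
      if b: "b \<in> carrier ?B" for b
    proof -
      have "b \<in> fracs UNIV" using b by simp
      then obtain z a where z: "z \<in> denominators" "b = frac z a" by (rule fracsE)
      have "b = frac_add (frac z (part 0 a)) (frac z (part 1 a))"
        unfolding frac_add_same[OF z(1)] part_add_eq by (rule z(2))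
      then show ?thesis using frac_in_fracs[OF z(1) part_in] unfolding localization_simps by blast
    qed
    show "\<exists>c\<in>carrier ?F. \<exists>d\<in>carrier ?F. b =
        c \<oplus>\<^bsub>?B\<^esub> d \<otimes>\<^bsub>?B\<^esub> (\<iota> u \<otimes>\<^bsub>?B\<^esub> \<iota> x)"
      if b: "b \<in> component ?B 0" for b
    proof -
      have "b \<in> fracs (A 0)" using b by simp
      then obtain z a where z: "z \<in> denominators" "a \<in> A 0" "b = frac z a" by (rule fracsE)
      obtain w c d where w: "w \<in> denominators" "c \<in> even_center" "d \<in> even_center" "w * a = c + d * (u * x)"
        using a0[OF z(2)] by blast
      note wz = denominators_mult[OF w(1) z(1)]
      have "b = frac (w * z) (w * a)" using frac_scale[OF w(1) z(1)] z(3) by simp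
      also have "\<dots> = frac_add (frac (w * z) c) (frac_mult (frac (w * z) d) (frac_mult (\<iota> u) (\<iota> x)))"
        unfolding w(4) \<iota>_mult frac_\<iota>[OF wz] frac_add_same[OF wz] ..
      finally show ?thesis
        using frac_in_fracs[OF wz w(2)] frac_in_fracs[OF wz w(3)] unfolding localization_simps by blast
    qed
    show "\<exists>c\<in>carrier ?F. \<exists>d\<in>carrier ?F. b =
        c \<otimes>\<^bsub>?B\<^esub> \<iota> u \<oplus>\<^bsub>?B\<^esub> d \<otimes>\<^bsub>?B\<^esub> \<iota> x"
      if b: "b \<in> component ?B 1" for b
    proof -
      have "b \<in> fracs (A 1)" using b by simp
      then obtain z a where z: "z \<in> denominators" "a \<in> A 1" "b = frac z a" by (rule fracsE)
      obtain w c d where w: "w \<in> denominators" "c \<in> even_center" "d \<in> even_center" "w * a = c * u + d * x"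
        using a1[OF z(2)] by blast
      note wz = denominators_mult[OF w(1) z(1)]
      have "b = frac (w * z) (w * a)" using frac_scale[OF w(1) z(1)] z(3) by simp
      also have "\<dots> = frac_add (frac_mult (frac (w * z) c) (\<iota> u)) (frac_mult (frac (w * z) d) (\<iota> x))"
        unfolding w(4) frac_\<iota>[OF wz] frac_add_same[OF wz] ..
      finally show ?thesis
        using frac_in_fracs[OF wz w(2)] frac_in_fracs[OF wz w(3)] unfolding localization_simps by blast
    qed
    show "a \<oplus>\<^bsub>?B\<^esub> b \<in> component ?B i"
      if "a \<in> component ?B i" "b \<in> component ?B i" for a b i
      using that unfolding localization_simps
      by (rule fracs_frac_add) (erule (1) denominators_mult_closed(2), erule (1) A_add)
    show "a \<otimes>\<^bsub>?B\<^esub> b \<in> component ?B (i + k)"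
      if "a \<in> component ?B i" "b \<in> component ?B k" for a b i k
      using that unfolding localization_simps by (rule fracs_frac_mult) (erule (1) A_mult)
    show "\<iota> u \<otimes>\<^bsub>?B\<^esub> \<iota> x \<oplus>\<^bsub>?B\<^esub> \<iota> x \<otimes>\<^bsub>?B\<^esub> \<iota> u = \<zero>\<^bsub>?F\<^esub>"
      unfolding localization_simps \<iota>_mult \<iota>_add ux by (rule \<iota>_zero)
    show "c\<^sub>0 = \<zero>\<^bsub>?F\<^esub> \<and> c\<^sub>1 = \<zero>\<^bsub>?F\<^esub> \<and>
        (n = 2 \<longrightarrow> c\<^sub>2 = \<zero>\<^bsub>?F\<^esub> \<and> c\<^sub>3 = \<zero>\<^bsub>?F\<^esub>)"
      if "c\<^sub>0 \<in> carrier ?F" "c\<^sub>1 \<in> carrier ?F"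
        "c\<^sub>2 \<in> carrier ?F" "c\<^sub>3 \<in> carrier ?F"
        "c\<^sub>0 \<oplus>\<^bsub>?B\<^esub> (c\<^sub>1 \<otimes>\<^bsub>?B\<^esub> \<iota> u \<oplus>\<^bsub>?B\<^esub>
          (c\<^sub>2 \<otimes>\<^bsub>?B\<^esub> \<iota> x \<oplus>\<^bsub>?B\<^esub>
          c\<^sub>3 \<otimes>\<^bsub>?B\<^esub> (\<iota> u \<otimes>\<^bsub>?B\<^esub> \<iota> x))) = \<zero>\<^bsub>?F\<^esub>"
      for c\<^sub>0 c\<^sub>1 c\<^sub>2 c\<^sub>3
      using that unfolding localization_simps by (rule indep)
    show "c \<otimes>\<^bsub>?B\<^esub> b = b \<otimes>\<^bsub>?B\<^esub> c"
      if "c \<in> carrier ?F" "b \<in> carrier ?B" for c b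
      using that unfolding localization_simps by (rule frac_mult_central)
    show "component ?B i \<subseteq> carrier ?B" for i
      unfolding localization_simps using fracs_mono[OF subset_UNIV] by blast
    show "carrier ?F \<subseteq> carrier ?B"
      unfolding localization_simps using fracs_mono[OF subset_UNIV] by blast
    show "carrier ?F \<subseteq> component ?B 0"
      unfolding localization_simps by (rule Z_A)
    show "\<zero>\<^bsub>?F\<^esub> \<in> component ?B i" for i
      unfolding localization_simps by (rule frac_zero_in) simp
  qed (simp_all add: \<iota>_mult \<iota>_Z[OF uu(1)] \<iota>_nz[OF uu(2)] \<iota>_Z[OF xx] two \<iota>_A u x,
       use n \<iota>_zero in auto)
  then interpret clifford_target center_field n "\<iota> (u * u)" "\<iota> (x * x)" central_localization "\<iota> u" "\<iota> x" .
  show ?thesis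
    unfolding central_order_in_C_def
    using even_center_nonzero quadratic_space_V nondegenerate_V has_dimension_V isomorphic_clifford by blast
qed

end

context prime_superalg
begin

text \<open>The nonzero central square \<open>u u\<close> of the frame supplies the denominator
  needed to localize.\<close>

lemma clifford_frame_central_order:
  assumes "clifford_frame n u x"
  shows "n \<in> {1, 2} \<and> central_order_in_C n"
proof -
  have "u * u \<in> even_center" "u * u \<noteq> 0" and n: "n \<in> {1, 2}"
    using assms unfolding clifford_frame_def by auto
  then interpret prime_superalg_center scale A by unfold_locales blast
  show ?thesis using frame_central_order[OF assms] n by blast
qed

end

theorem theorem2p6:
  fixes scale :: "'r::comm_ring_1 \<Rightarrow> 'a::ring \<Rightarrow> 'a"
    and A :: "bit \<Rightarrow> 'a set"
    and W L :: "'a set"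
  assumes "2 dvd (1::'r)"
    and "superalgebra scale A"
    and "superalgebra.nontrivial A"
    and "superalgebra.prime_superalgebra scale A"
    and "\<forall>n\<in>{1, 2, 3}. \<not> superalgebra.central_order_in_C A n"
    and "superalgebra.graded_subalgebra scale A W"
    and "superalgebra.lie_ideal scale A L"
    and "superalgebra.bracket_span scale A W L \<subseteq> W"
  shows "L \<subseteq> superalgebra.even_center A \<or> W \<subseteq> superalgebra.even_center A \<or>
    superalgebra.dense_in scale A W"
proof -
  interpret prime_superalg scale A
    by (intro prime_superalg.intro prime_superalg_axioms.intro assms)
  have "\<not> clifford_frame n u x" for n u x
    using clifford_frame_central_order assms(5) by blast
  then show ?thesis using central_or_dense_or_frame[OF assms(6-8)] by blast
qed

end
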